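(* Let $p$ be a prime and let $G$ be a finite non-abelian $p$-group with cyclic center. Suppose $p^e=\max\mathrm{cd}(G)$ and $p^\alpha=\min\{\chi(1)\mid \ker(\chi)=1,\ \chi\in\mathrm{nl}(G)\}$. Then \[ p^\alpha |Z(G)| \text{ divides } c(G)\quad\text{and}\quad c(G)\text{ divides } p^e\cdot \exp(G). \] In particular, if $\mathrm{cd}(G)=\{1,p,p^e\}$ with $e>1$ and $\exp(G)=p$, then $c(G)=p^{e+1}$.
   Context: $\exp(G)$ is the exponent of $G$; $Z(G)$ is its center; $\mathrm{cd}(G)=\{\chi(1)\mid \chi\in\mathrm{Irr}(G)\}$ is the set of degrees of irreducible complex characters of $G$; $\mathrm{nl}(G)$ is the set of nonlinear irreducible complex characters of $G$. A quasi-permutation matrix is a square matrix over $\mathbb{C}$ with non-negative integral trace. $c(G)$ denotes the minimal degree of a faithful representation of $G$ by complex quasi-permutation matrices, i.e. the least $n$ such that there is an injective homomorphism $G\to \mathrm{GL}_n(\mathbb{C})$ all of whose image elements have non-negative integer trace. *)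

theory Defs
  imports
    "HOL-Computational_Algebra.Primes"
    "HOL-Algebra.Elementary_Groups"
    "Jordan_Normal_Form.VS_Connect"
begin

definition center :: "('a, 'b) monoid_scheme \<Rightarrow> 'a set" where
  "center G = {z \<in> carrier G. \<forall>g \<in> carrier G. z \<otimes>\<^bsub>G\<^esub> g = g \<otimes>\<^bsub>G\<^esub> z}"

definition group_exponent :: "('a, 'b) monoid_scheme \<Rightarrow> nat" where
  "group_exponent G = (LEAST n. 0 < n \<and> (\<forall>g \<in> carrier G. g [^]\<^bsub>G\<^esub> n = \<one>\<^bsub>G\<^esub>))"

definition p_group :: "nat \<Rightarrow> ('a, 'b) monoid_scheme \<Rightarrow> bool" where
  "p_group p G \<longleftrightarrow> group G \<and> finite (carrier G) \<and> (\<exists>m. Coset.order G = p ^ m)"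

definition mat_trace :: "complex mat \<Rightarrow> complex" where
  "mat_trace A = (\<Sum>i < dim_row A. A $$ (i, i))"

definition GL :: "nat \<Rightarrow> complex mat monoid" where
  "GL n = units_of (ring_mat TYPE(complex) n ())"

text \<open>
  A complex representation of \<open>G\<close> of degree \<open>n\<close> is an element of \<open>hom G (GL n)\<close>.
  Irreducible representations are required to have positive degree.
\<close>

definition irreducible_rep ::
    "('a, 'b) monoid_scheme \<Rightarrow> nat \<Rightarrow> ('a \<Rightarrow> complex mat) \<Rightarrow> bool" where
  "irreducible_rep G n \<rho> \<longleftrightarrow>
     0 < n \<and> \<rho> \<in> hom G (GL n) \<and>
     (\<forall>W. VectorSpace.subspace class_ring W (module_vec TYPE(complex) n) \<and>
          (\<forall>g \<in> carrier G. \<forall>w \<in> W. \<rho> g *\<^sub>v w \<in> W)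
        \<longrightarrow> W = {0\<^sub>v n} \<or> W = carrier_vec n)"

text \<open>
  Characters are restricted to the carrier (\<open>undefined\<close> outside), so that distinct elements of
  \<open>Irr G\<close> are distinct class functions on \<open>G\<close>.
\<close>

definition character ::
    "('a, 'b) monoid_scheme \<Rightarrow> ('a \<Rightarrow> complex mat) \<Rightarrow> ('a \<Rightarrow> complex)" where
  "character G \<rho> = (\<lambda>g \<in> carrier G. mat_trace (\<rho> g))"

definition Irr :: "('a, 'b) monoid_scheme \<Rightarrow> ('a \<Rightarrow> complex) set" where
  "Irr G = {character G \<rho> | n \<rho>. irreducible_rep G n \<rho>}"

text \<open>The degree \<open>\<chi>(1)\<close> of a character, as a natural number.\<close>

definition char_degree :: "('a, 'b) monoid_scheme \<Rightarrow> ('a \<Rightarrow> complex) \<Rightarrow> nat" where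
  "char_degree G \<chi> = (THE d. \<chi> \<one>\<^bsub>G\<^esub> = of_nat d)"

definition char_kernel :: "('a, 'b) monoid_scheme \<Rightarrow> ('a \<Rightarrow> complex) \<Rightarrow> 'a set" where
  "char_kernel G \<chi> = {g \<in> carrier G. \<chi> g = \<chi> \<one>\<^bsub>G\<^esub>}"

definition cd :: "('a, 'b) monoid_scheme \<Rightarrow> nat set" where
  "cd G = {char_degree G \<chi> | \<chi>. \<chi> \<in> Irr G}"

definition nl :: "('a, 'b) monoid_scheme \<Rightarrow> ('a \<Rightarrow> complex) set" where
  "nl G = {\<chi> \<in> Irr G. char_degree G \<chi> \<noteq> 1}"

definition quasi_permutation_mat :: "complex mat \<Rightarrow> bool" where
  "quasi_permutation_mat A \<longleftrightarrow> square_mat A \<and> mat_trace A \<in> \<nat>"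

definition min_quasi_perm_degree :: "('a, 'b) monoid_scheme \<Rightarrow> nat" where
  "min_quasi_perm_degree G =
     (LEAST n. \<exists>\<rho> \<in> hom G (GL n). inj_on \<rho> (carrier G) \<and>
                 (\<forall>g \<in> carrier G. quasi_permutation_mat (\<rho> g)))"

end

theory Submission
  imports Defs "Jordan_Normal_Form.Spectral_Radius" "HOL-Algebra.Group_Action" "HOL-Number_Theory.Residues"
begin

text \<open>
  Let \<open>z0\<close> be an element of order \<open>p\<close> in the cyclic center.  Every nontrivial normal subgroup of \<open>G\<close>
  meets the center, hence contains \<open>z0\<close>; so an irreducible character \<open>\<chi>\<close> is faithful exactly if
  \<open>\<chi> z0 \<noteq> \<chi> \<one>\<close>.  The theorem follows from the exact formula \<open>min_quasi_perm_degree_formula\<close>: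
  the number \<open>c(G)\<close> equals \<open>p ^ Suc j * \<chi>(1)\<close> for a faithful irreducible \<open>\<chi>\<close> that has
  \<open>(p - 1) * p ^ j\<close> Galois conjugates.  Here \<open>\<chi>(1)\<close> is a power of \<open>p\<close> between \<open>p ^ \<alpha>\<close> and \<open>p ^ e\<close>,
  and \<open>p ^ Suc j\<close> lies between \<open>|Z(G)|\<close> and the exponent, so that both divisibilities only compare
  exponents of \<open>p\<close>.

  The arithmetic of the characters comes from monomiality (\<open>p_group_monomial\<close>): an irreducible
  character \<open>\<chi>\<close> of a p-group is induced from a linear character \<open>\<mu>\<close> of a subgroup.  Its degree is the index
  of that subgroup, a power of \<open>p\<close>.  For \<open>m\<close> prime to \<open>p\<close>, the function \<open>g \<mapsto> \<chi>(g ^ m)\<close> is induced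
  from \<open>\<mu> ^ m\<close> and has the same norm as \<open>\<chi>\<close>; therefore it is irreducible (\<open>power_conj_Irr\<close>).
  These functions are the Galois conjugates of \<open>\<chi>\<close>.  If \<open>\<chi>\<close> is faithful, an exponent \<open>m\<close> that fixes
  \<open>\<chi>\<close> fixes its value at \<open>z0\<close> and so is \<open>1\<close> modulo \<open>p\<close>.  The stabilizer thus is a p-group, and
  the orbit has \<open>(p - 1) * p ^ j\<close> elements.  The orbit is at least as large as the set of its values at a
  generator of the center, which bounds \<open>j\<close> from below (\<open>orbit_size\<close>).

  The formula is proved from two sides.  The sum \<open>\<Psi>\<close> over the orbit of a faithful \<open>\<chi>\<close> has integral values,
  all at least \<open>- p ^ j * \<chi>(1)\<close>, because the sum of the powers \<open>z ^ m\<close> of a root of unity over the units \<open>m\<close>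
  modulo the exponent is an explicit integer (\<open>sum_unit_powers\<close>).  So \<open>\<Psi>\<close> together with \<open>p ^ j * \<chi>(1)\<close>
  copies of the trivial representation is a faithful quasi-permutation representation
  (\<open>quasi_perm_degree_orbit\<close>).  Conversely, the character \<open>\<theta>\<close> of a faithful quasi-permutation
  representation has integral values, which forces \<open>\<theta>(g ^ m) = \<theta>(g)\<close> for \<open>m\<close> prime to \<open>p\<close>
  (\<open>power_sum_integral_invariant\<close>).  Hence with a faithful constituent \<open>\<chi>\<close> it contains the whole orbit of
  \<open>\<chi>\<close>.  By the same invariance \<open>(p - 1) * \<theta>(z0)\<close> is \<open>p - 1\<close> times the degree of the part of \<open>\<theta>\<close> that is
  trivial on \<open>z0\<close>, minus the degree of the other part.  As \<open>\<theta>(z0)\<close> is nonnegative, the degree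
  of \<open>\<theta>\<close> is at least \<open>p / (p - 1)\<close> times the degree of \<open>\<Psi>\<close> (\<open>quasi_perm_degree_ge_orbit\<close>).

  For the last claim, a faithful irreducible character of degree \<open>p\<close> is induced from an abelian
  subgroup of index \<open>p\<close>; then Frobenius reciprocity bounds all irreducible degrees by \<open>p\<close>
  (\<open>degree_le_prime_of_faithful_degree_prime\<close>).  Since \<open>p ^ e > p\<close> is a degree, all faithful
  irreducible characters have degree \<open>p ^ e\<close>, and \<open>j = 0\<close> because the exponent is \<open>p\<close>.
\<close>

section \<open>Finitely supported matrices\<close>

text \<open>
  Matrices of all sizes live in one ring without unit, so that sums over groups, products of
  matrices of different sizes and algebraic simplification need no conditions on
  dimensions.  The \<open>n\<close> by \<open>n\<close> matrices are the corner cut out by the idempotent \<open>ident n\<close>.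
\<close>

typedef fmat = "{f :: nat \<Rightarrow> nat \<Rightarrow> complex. \<exists>N. \<forall>i j. N \<le> i \<or> N \<le> j \<longrightarrow> f i j = 0}"
  morphisms ent Abs_fmat
  by (rule exI[of _ "\<lambda>_ _. 0"]) auto

setup_lifting type_definition_fmat

definition bounded :: "nat \<Rightarrow> fmat \<Rightarrow> bool" where
  "bounded N A \<longleftrightarrow> (\<forall>i j. N \<le> i \<or> N \<le> j \<longrightarrow> ent A i j = 0)"

lemma boundedD: "bounded N A \<Longrightarrow> N \<le> i \<or> N \<le> j \<Longrightarrow> ent A i j = 0"
  by (auto simp: bounded_def)

lemma bounded_mono: "bounded N A \<Longrightarrow> N \<le> M \<Longrightarrow> bounded M A"
  unfolding bounded_def by (meson order_trans)

lemma bounded_ex: "\<exists>N. bounded N A"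
  using ent[of A] by (auto simp: bounded_def)

lemma bounded_ex2: "\<exists>N. bounded N A \<and> bounded N B"
proof -
  obtain N M where "bounded N A" "bounded M B" using bounded_ex by metis
  then have "bounded (max N M) A" "bounded (max N M) B" using bounded_mono by auto
  then show ?thesis by blast
qed

lemma bounded_ex3: "\<exists>N. bounded N A \<and> bounded N B \<and> bounded N C"
proof -
  obtain N M where "bounded N A \<and> bounded N B" "bounded M C" using bounded_ex2 bounded_ex by metis
  then have "bounded (max N M) A" "bounded (max N M) B" "bounded (max N M) C" using bounded_mono by auto
  then show ?thesis by blast
qed

lemma fmat_eqI: "(\<And>i j. ent A i j = ent B i j) \<Longrightarrow> A = B"
  by (simp add: ent_inject[symmetric] ext)

instantiation fmat :: ring
begin

lift_definition zero_fmat :: fmat is "\<lambda>_ _. 0" by auto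

lift_definition plus_fmat :: "fmat \<Rightarrow> fmat \<Rightarrow> fmat" is "\<lambda>A B i j. A i j + B i j"
proof -
  fix A B :: "nat \<Rightarrow> nat \<Rightarrow> complex"
  assume "\<exists>N. \<forall>i j. N \<le> i \<or> N \<le> j \<longrightarrow> A i j = 0" "\<exists>N. \<forall>i j. N \<le> i \<or> N \<le> j \<longrightarrow> B i j = 0"
  then obtain N M where "\<forall>i j. N \<le> i \<or> N \<le> j \<longrightarrow> A i j = 0" "\<forall>i j. M \<le> i \<or> M \<le> j \<longrightarrow> B i j = 0"
    by blast
  then show "\<exists>N. \<forall>i j. N \<le> i \<or> N \<le> j \<longrightarrow> A i j + B i j = 0"
    by (intro exI[of _ "max N M"]) auto
qed

lift_definition uminus_fmat :: "fmat \<Rightarrow> fmat" is "\<lambda>A i j. - A i j" by auto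

lift_definition minus_fmat :: "fmat \<Rightarrow> fmat \<Rightarrow> fmat" is "\<lambda>A B i j. A i j - B i j"
proof -
  fix A B :: "nat \<Rightarrow> nat \<Rightarrow> complex"
  assume "\<exists>N. \<forall>i j. N \<le> i \<or> N \<le> j \<longrightarrow> A i j = 0" "\<exists>N. \<forall>i j. N \<le> i \<or> N \<le> j \<longrightarrow> B i j = 0"
  then obtain N M where "\<forall>i j. N \<le> i \<or> N \<le> j \<longrightarrow> A i j = 0" "\<forall>i j. M \<le> i \<or> M \<le> j \<longrightarrow> B i j = 0"
    by blast
  then show "\<exists>N. \<forall>i j. N \<le> i \<or> N \<le> j \<longrightarrow> A i j - B i j = 0"
    by (intro exI[of _ "max N M"]) auto
qed

lift_definition times_fmat :: "fmat \<Rightarrow> fmat \<Rightarrow> fmat"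
  is "\<lambda>A B i j. \<Sum>k | A i k \<noteq> 0. A i k * B k j"
proof -
  fix A B :: "nat \<Rightarrow> nat \<Rightarrow> complex"
  assume "\<exists>N. \<forall>i j. N \<le> i \<or> N \<le> j \<longrightarrow> A i j = 0" "\<exists>N. \<forall>i j. N \<le> i \<or> N \<le> j \<longrightarrow> B i j = 0"
  then obtain N M where "\<forall>i j. N \<le> i \<or> N \<le> j \<longrightarrow> A i j = 0" "\<forall>i j. M \<le> i \<or> M \<le> j \<longrightarrow> B i j = 0"
    by blast
  then show "\<exists>N. \<forall>i j. N \<le> i \<or> N \<le> j \<longrightarrow> (\<Sum>k | A i k \<noteq> 0. A i k * B k j) = 0"
    by (intro exI[of _ "max N M"]) auto
qed

lemma ent_mult_bounded:
  assumes "bounded N A \<or> bounded N B"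
  shows "ent (A * B) i j = (\<Sum>k<N. ent A i k * ent B k j)"
proof -
  obtain M where M: "bounded M A" using bounded_ex by blast
  have sub: "{k. ent A i k \<noteq> 0} \<subseteq> {..<M}" using boundedD[OF M] by (auto intro: leI)
  then have fin: "finite {k. ent A i k \<noteq> 0}" using finite_subset by blast
  have "ent (A * B) i j = (\<Sum>k | ent A i k \<noteq> 0. ent A i k * ent B k j)"
    by transfer simp
  also have "\<dots> = (\<Sum>k\<in>{k. ent A i k \<noteq> 0} \<union> {..<N}. ent A i k * ent B k j)"
    by (rule sum.mono_neutral_left) (use fin in auto)
  also have "\<dots> = (\<Sum>k<N. ent A i k * ent B k j)"
    by (rule sum.mono_neutral_right) (use fin assms in \<open>auto simp: bounded_def\<close>)
  finally show ?thesis .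
qed

lemma ent_add [simp]: "ent (A + B) i j = ent A i j + ent B i j" by transfer simp
lemma ent_diff [simp]: "ent (A - B) i j = ent A i j - ent B i j" by transfer simp
lemma ent_minus [simp]: "ent (- A) i j = - ent A i j" by transfer simp
lemma ent_zero [simp]: "ent 0 i j = 0" by transfer simp

lemma bounded_mult: "bounded N A \<Longrightarrow> bounded N B \<Longrightarrow> bounded N (A * B)"
proof -
  assume N: "bounded N A" "bounded N B"
  show "bounded N (A * B)"
    unfolding bounded_def[of N "A * B"] ent_mult_bounded[OF disjI1[OF N(1)]]
    using boundedD[OF N(1)] boundedD[OF N(2)] by auto
qed

instance
proof
  fix A B C :: fmat
  obtain N where N: "bounded N A" "bounded N B" "bounded N C" using bounded_ex3 by blast
  show "A * B * C = A * (B * C)"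
  proof (rule fmat_eqI)
    fix i j
    have "ent (A * B * C) i j = (\<Sum>k<N. \<Sum>l<N. ent A i l * ent B l k * ent C k j)"
      by (simp add: ent_mult_bounded[OF disjI1[OF N(1)]] ent_mult_bounded[OF disjI2[OF N(3)]] sum_distrib_right)
    also have "\<dots> = (\<Sum>l<N. \<Sum>k<N. ent A i l * ent B l k * ent C k j)" by (rule sum.swap)
    also have "\<dots> = ent (A * (B * C)) i j"
      by (simp add: ent_mult_bounded[OF disjI1[OF N(1)]] ent_mult_bounded[OF disjI2[OF N(3)]] sum_distrib_left mult.assoc)
    finally show "ent (A * B * C) i j = ent (A * (B * C)) i j" .
  qed
  show "(A + B) * C = A * C + B * C"
    by (rule fmat_eqI) (simp add: ent_mult_bounded[OF disjI2[OF N(3)]] sum.distrib distrib_right)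
  show "A * (B + C) = A * B + A * C"
    by (rule fmat_eqI) (simp add: ent_mult_bounded[OF disjI1[OF N(1)]] sum.distrib distrib_left)
qed (auto intro: fmat_eqI)

end

lift_definition smul :: "complex \<Rightarrow> fmat \<Rightarrow> fmat" is "\<lambda>c A i j. c * A i j" by auto

lift_definition ident :: "nat \<Rightarrow> fmat" is "\<lambda>n i j. if i < n \<and> i = j then 1 else (0::complex)"
proof -
  fix n :: nat show "\<exists>N. \<forall>i j. N \<le> i \<or> N \<le> j \<longrightarrow> (if i < n \<and> i = j then 1 else 0) = (0::complex)"
    by (intro exI[of _ n]) auto
qed

lift_definition munit :: "nat \<Rightarrow> nat \<Rightarrow> fmat" is "\<lambda>a b i j. if i = a \<and> j = b then 1 else 0"
proof -
  fix a b :: nat show "\<exists>N. \<forall>i j. N \<le> i \<or> N \<le> j \<longrightarrow> (if i = a \<and> j = b then 1 else 0) = (0::complex)"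
    by (intro exI[of _ "Suc (max a b)"]) auto
qed

lemma ent_smul [simp]: "ent (smul c A) i j = c * ent A i j" by transfer simp
lemma ent_ident: "ent (ident n) i j = (if i < n \<and> i = j then 1 else 0)" by transfer simp
lemma ent_munit: "ent (munit a b) i j = (if i = a \<and> j = b then 1 else 0)" by transfer simp

lemma ent_sum: "ent (sum f S) i j = (\<Sum>x\<in>S. ent (f x) i j)"
  by (induction S rule: infinite_finite_induct) auto

lemma bounded_smul [simp]: "bounded N A \<Longrightarrow> bounded N (smul c A)" by (auto simp: bounded_def)
lemma bounded_add [simp]: "bounded N A \<Longrightarrow> bounded N B \<Longrightarrow> bounded N (A + B)" by (auto simp: bounded_def)

lemma smul_mult_left: "smul c A * B = smul c (A * B)"
proof -
  obtain N where N: "bounded N B" using bounded_ex by blast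
  show ?thesis
    by (intro fmat_eqI) (simp add: ent_mult_bounded[OF disjI2[OF N]] sum_distrib_left mult.assoc)
qed

lemma smul_mult_right: "A * smul c B = smul c (A * B)"
proof -
  obtain N where N: "bounded N A" using bounded_ex by blast
  show ?thesis
    by (intro fmat_eqI) (simp add: ent_mult_bounded[OF disjI1[OF N]] sum_distrib_left mult.left_commute)
qed

lemmas smul_mult = smul_mult_left smul_mult_right

lemma smul_smul [simp]: "smul a (smul b A) = smul (a * b) A" by (auto intro: fmat_eqI)
lemma smul_add: "smul a (A + B) = smul a A + smul a B" by (auto intro!: fmat_eqI simp: algebra_simps)
lemma smul_add_left: "smul (a + b) A = smul a A + smul b A" by (auto intro!: fmat_eqI simp: algebra_simps)
lemma smul_one [simp]: "smul 1 A = A" by (auto intro!: fmat_eqI)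
lemma smul_zero [simp]: "smul 0 A = 0" by (auto intro!: fmat_eqI)
lemma smul_zero_right [simp]: "smul a 0 = 0" by (auto intro!: fmat_eqI)
lemma smul_sum: "smul a (sum f S) = (\<Sum>x\<in>S. smul a (f x))"
  by (induction S rule: infinite_finite_induct) (auto simp: smul_add)
lemma smul_sum_left: "smul (sum f S) A = (\<Sum>x\<in>S. smul (f x) A)"
  by (induction S rule: infinite_finite_induct) (auto simp: smul_add_left)
lemma smul_const_sum: "(\<Sum>x\<in>S. A) = smul (of_nat (card S)) A"
  by (induction S rule: infinite_finite_induct) (auto simp: smul_add_left)
lemma smul_eq_0_iff: "smul c A = 0 \<longleftrightarrow> c = 0 \<or> A = 0"
proof
  assume *: "smul c A = 0"
  show "c = 0 \<or> A = 0"
  proof (rule disjCI)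
    assume "A \<noteq> 0"
    then obtain i j where ij: "ent A i j \<noteq> 0" using fmat_eqI[of A 0] by auto
    have "c * ent A i j = 0" using * ent_smul[of c A i j] by simp
    then show "c = 0" using ij by simp
  qed
qed auto
lemma smul_cancel: "smul a A = smul b A \<Longrightarrow> A \<noteq> 0 \<Longrightarrow> a = b"
proof -
  assume "smul a A = smul b A" and ne: "A \<noteq> 0"
  then have "smul (a - b) A = 0" by (auto intro!: fmat_eqI simp: algebra_simps dest: arg_cong[of _ _ "\<lambda>X. ent X _ _"])
  then show ?thesis using ne by (simp add: smul_eq_0_iff)
qed

definition tr :: "fmat \<Rightarrow> complex" where
  "tr A = (\<Sum>i | ent A i i \<noteq> 0. ent A i i)"

lemma tr_bounded:
  assumes "bounded N A" shows "tr A = (\<Sum>i<N. ent A i i)"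
proof -
  have "{i. ent A i i \<noteq> 0} \<subseteq> {..<N}" using boundedD[OF assms] by (auto intro: leI)
  then show ?thesis unfolding tr_def by (intro sum.mono_neutral_left) auto
qed

lemma tr_add [simp]: "tr (A + B) = tr A + tr B"
proof -
  obtain N where N: "bounded N A" "bounded N B" using bounded_ex2 by blast
  then show ?thesis by (simp add: tr_bounded[of N] sum.distrib)
qed
lemma tr_zero [simp]: "tr 0 = 0" by (simp add: tr_def)
lemma tr_smul [simp]: "tr (smul c A) = c * tr A"
proof -
  obtain N where "bounded N A" using bounded_ex by blast
  then show ?thesis by (simp add: tr_bounded[of N] sum_distrib_left)
qed
lemma tr_minus [simp]: "tr (- A) = - tr A"
  by (metis add.right_inverse add_eq_0_iff tr_add tr_zero)
lemma tr_diff [simp]: "tr (A - B) = tr A - tr B"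
  by (metis diff_conv_add_uminus tr_add tr_minus)
lemma tr_sum: "tr (sum f S) = (\<Sum>x\<in>S. tr (f x))"
  by (induction S rule: infinite_finite_induct) auto
lemma tr_ident [simp]: "tr (ident n) = of_nat n"
proof -
  have "bounded n (ident n)" by (auto simp: bounded_def ent_ident)
  then show ?thesis by (simp add: tr_bounded ent_ident)
qed
lemma tr_comm: "tr (A * B) = tr (B * A)"
proof -
  obtain N where N: "bounded N A" "bounded N B" using bounded_ex2 by blast
  have "tr (A * B) = (\<Sum>i<N. \<Sum>k<N. ent A i k * ent B k i)"
    by (simp add: tr_bounded[OF bounded_mult[OF N]] ent_mult_bounded[OF disjI1[OF N(1)]])
  also have "\<dots> = (\<Sum>k<N. \<Sum>i<N. ent B k i * ent A i k)" by (subst sum.swap) (simp add: mult.commute)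
  also have "\<dots> = tr (B * A)" by (simp add: tr_bounded[OF bounded_mult[OF N(2,1)]] ent_mult_bounded[OF disjI1[OF N(2)]])
  finally show ?thesis .
qed

lemma bounded_ident: "bounded n (ident n)" by (auto simp: bounded_def ent_ident)

lemma ent_ident_mult: "ent (ident n * A) i j = (if i < n then ent A i j else 0)"
proof -
  have "ent (ident n * A) i j = (\<Sum>k<n. if k = i then ent A k j else 0)"
    unfolding ent_mult_bounded[OF disjI1[OF bounded_ident]] by (rule sum.cong) (auto simp: ent_ident)
  then show ?thesis by simp
qed
lemma ent_mult_ident: "ent (A * ident n) i j = (if j < n then ent A i j else 0)"
proof -
  have "ent (A * ident n) i j = (\<Sum>k<n. if k = j then ent A i k else 0)"
    unfolding ent_mult_bounded[OF disjI2[OF bounded_ident]] by (rule sum.cong) (auto simp: ent_ident)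
  then show ?thesis by simp
qed
lemma ident_ident [simp]: "ident n * ident n = ident n"
  by (rule fmat_eqI) (auto simp: ent_ident_mult ent_ident)

lemma ident_0 [simp]: "ident 0 = 0" by (rule fmat_eqI) (auto simp: ent_ident)
lemma ident_Suc: "ident (Suc k) = ident k + munit k k" by (rule fmat_eqI) (auto simp: ent_ident ent_munit)
lemma ident_inj: "ident n = ident m \<Longrightarrow> n = m"
  using tr_ident[of n] tr_ident[of m] by (metis of_nat_eq_iff)

lemma ent_mult_munit: "ent (A * munit a b) i j = (if j = b then ent A i a else 0)"
proof -
  have b: "bounded (Suc (max a b)) (munit a b)" by (auto simp: bounded_def ent_munit)
  have "ent (A * munit a b) i j = (\<Sum>k<Suc (max a b). if k = a then (if j = b then ent A i k else 0) else 0)"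
    unfolding ent_mult_bounded[OF disjI2[OF b]] by (rule sum.cong) (auto simp: ent_munit)
  then show ?thesis by (simp del: sum.lessThan_Suc add: less_Suc_eq_le)
qed
lemma ent_munit_mult: "ent (munit a b * A) i j = (if i = a then ent A b j else 0)"
proof -
  have b: "bounded (Suc (max a b)) (munit a b)" by (auto simp: bounded_def ent_munit)
  have "ent (munit a b * A) i j = (\<Sum>k<Suc (max a b). if k = b then (if i = a then ent A k j else 0) else 0)"
    unfolding ent_mult_bounded[OF disjI1[OF b]] by (rule sum.cong) (auto simp: ent_munit)
  then show ?thesis by (simp del: sum.lessThan_Suc add: less_Suc_eq_le)
qed
lemma munit_mult: "munit a b * munit c d = (if b = c then munit a d else 0)"
  by (rule fmat_eqI) (auto simp: ent_mult_munit ent_munit)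
lemma tr_munit: "tr (munit a b) = (if a = b then 1 else 0)"
proof -
  have "bounded (Suc (max a b)) (munit a b)" by (auto simp: bounded_def ent_munit)
  then have "tr (munit a b) = (\<Sum>k<Suc (max a b). if k = a then (if a = b then 1 else 0) else 0)"
    by (subst tr_bounded[of "Suc (max a b)"]) (auto simp: ent_munit intro!: sum.cong)
  then show ?thesis by (simp del: sum.lessThan_Suc add: less_Suc_eq_le)
qed

definition shaped :: "nat \<Rightarrow> nat \<Rightarrow> fmat \<Rightarrow> bool" where
  "shaped n m A \<longleftrightarrow> ident n * A = A \<and> A * ident m = A"

lemma shaped_iff: "shaped n m A \<longleftrightarrow> (\<forall>i j. n \<le> i \<or> m \<le> j \<longrightarrow> ent A i j = 0)"
proof
  assume "shaped n m A"
  then have "\<And>i j. ent A i j = ent (ident n * A) i j" "\<And>i j. ent A i j = ent (A * ident m) i j"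
    by (auto simp: shaped_def)
  then show "\<forall>i j. n \<le> i \<or> m \<le> j \<longrightarrow> ent A i j = 0" by (metis ent_mult_ident ent_ident_mult not_le)
next
  assume "\<forall>i j. n \<le> i \<or> m \<le> j \<longrightarrow> ent A i j = 0"
  then show "shaped n m A" unfolding shaped_def
    by (intro conjI fmat_eqI) (auto simp: ent_mult_ident ent_ident_mult)
qed

lemma shaped_ident [simp]: "shaped n n (ident n)" by (simp add: shaped_def)
lemma shaped_left: "shaped n m A \<Longrightarrow> ident n * A = A" by (simp add: shaped_def)
lemma shaped_right: "shaped n m A \<Longrightarrow> A * ident m = A" by (simp add: shaped_def)
lemma shaped_mult [intro]: "shaped n m A \<Longrightarrow> shaped m k B \<Longrightarrow> shaped n k (A * B)"
  unfolding shaped_def by (metis mult.assoc)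
lemma shaped_add [intro]: "shaped n m A \<Longrightarrow> shaped n m B \<Longrightarrow> shaped n m (A + B)" by (simp add: shaped_iff)
lemma shaped_diff [intro]: "shaped n m A \<Longrightarrow> shaped n m B \<Longrightarrow> shaped n m (A - B)" by (simp add: shaped_iff)
lemma shaped_smul [intro]: "shaped n m A \<Longrightarrow> shaped n m (smul c A)" by (simp add: shaped_iff)
lemma shaped_zero [simp]: "shaped n m 0" by (simp add: shaped_iff)
lemma shaped_sum [intro]: "(\<And>x. x \<in> S \<Longrightarrow> shaped n m (f x)) \<Longrightarrow> shaped n m (sum f S)"
  by (simp add: shaped_iff ent_sum)
lemma shaped_munit: "a < n \<Longrightarrow> b < m \<Longrightarrow> shaped n m (munit a b)" by (auto simp: shaped_iff ent_munit)
lemma shaped_mono: "shaped n m A \<Longrightarrow> n \<le> n' \<Longrightarrow> m \<le> m' \<Longrightarrow> shaped n' m' A" by (auto simp: shaped_iff)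

section \<open>Matrices as finitely supported matrices\<close>

lift_definition of_mat :: "complex mat \<Rightarrow> fmat"
  is "\<lambda>A i j. if i < dim_row A \<and> j < dim_col A then A $$ (i, j) else 0"
proof -
  fix A show "\<exists>N. \<forall>i j. N \<le> i \<or> N \<le> j \<longrightarrow> (if i < dim_row A \<and> j < dim_col A then A $$ (i, j) else (0::complex)) = 0"
    by (intro exI[of _ "max (dim_row A) (dim_col A)"]) auto
qed

lemma ent_of_mat: "ent (of_mat A) i j = (if i < dim_row A \<and> j < dim_col A then A $$ (i, j) else 0)"
  by (simp add: of_mat.rep_eq)

definition to_mat :: "nat \<Rightarrow> nat \<Rightarrow> fmat \<Rightarrow> complex mat" where
  "to_mat n m A = mat n m (\<lambda>(i, j). ent A i j)"

lemma to_mat_carrier [simp]: "to_mat n m A \<in> carrier_mat n m" by (simp add: to_mat_def)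
lemma of_mat_to_mat: "shaped n m A \<Longrightarrow> of_mat (to_mat n m A) = A"
  by (intro fmat_eqI) (auto simp: ent_of_mat to_mat_def shaped_iff)
lemma to_mat_of_mat: "A \<in> carrier_mat n m \<Longrightarrow> to_mat n m (of_mat A) = A"
  by (intro eq_matI) (auto simp: ent_of_mat to_mat_def)
lemma of_mat_one [simp]: "of_mat (1\<^sub>m n) = ident n"
  by (intro fmat_eqI) (auto simp: ent_of_mat ent_ident)
lemma of_mat_mult:
  assumes "A \<in> carrier_mat n m" "B \<in> carrier_mat m k" shows "of_mat (A * B) = of_mat A * of_mat B"
proof (rule fmat_eqI)
  fix i j
  have b: "ent (of_mat A * of_mat B) i j = (\<Sum>l<m. ent (of_mat A) i l * ent (of_mat B) l j)"
  proof -
    obtain N where N: "bounded N (of_mat A)" "bounded N (of_mat B)" using bounded_ex2 by blast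
    have z: "l \<ge> m \<Longrightarrow> ent (of_mat A) i l = 0" for l using assms by (auto simp: ent_of_mat)
    have z': "l \<ge> N \<Longrightarrow> ent (of_mat A) i l = 0" for l using N by (auto simp: boundedD)
    have "ent (of_mat A * of_mat B) i j = (\<Sum>l<N. ent (of_mat A) i l * ent (of_mat B) l j)"
      using N by (simp add: ent_mult_bounded)
    also have "\<dots> = (\<Sum>l<max N m. ent (of_mat A) i l * ent (of_mat B) l j)"
      by (rule sum.mono_neutral_left) (use z' in auto)
    also have "\<dots> = (\<Sum>l<m. ent (of_mat A) i l * ent (of_mat B) l j)"
      by (rule sum.mono_neutral_right) (use z in auto)
    finally show ?thesis .
  qed
  show "ent (of_mat (A * B)) i j = ent (of_mat A * of_mat B) i j"
    unfolding b using assms by (auto simp: ent_of_mat scalar_prod_def lessThan_atLeast0 intro!: sum.cong sum.neutral)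
qed
lemma of_mat_inj: "A \<in> carrier_mat n m \<Longrightarrow> B \<in> carrier_mat n m \<Longrightarrow> of_mat A = of_mat B \<Longrightarrow> A = B"
  by (metis to_mat_of_mat)
lemma tr_of_mat: "A \<in> carrier_mat n n \<Longrightarrow> tr (of_mat A) = mat_trace A"
proof -
  assume A: "A \<in> carrier_mat n n"
  then have "bounded n (of_mat A)" by (auto simp: bounded_def ent_of_mat)
  then show ?thesis using A by (auto simp: tr_bounded mat_trace_def ent_of_mat intro!: sum.cong)
qed

text \<open>
  If \<open>n < k\<close>, then \<open>V\<close> and \<open>U\<close> are square of size \<open>k\<close>, so the left inverse is also a right inverse;
  but \<open>U * V\<close> has a zero row.
\<close>

lemma one_sided_inverse_dim:
  assumes V: "shaped k n V" and U: "shaped n k U" and VU: "V * U = ident k"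
  shows "k \<le> n"
proof (rule ccontr)
  assume "\<not> k \<le> n"
  then have nk: "n \<le> k" "n \<noteq> k" by auto
  have V': "shaped k k V" and U': "shaped k k U" using V U nk shaped_mono by blast+
  let ?V = "to_mat k k V" and ?U = "to_mat k k U"
  have "of_mat (?V * ?U) = of_mat (1\<^sub>m k)" using V' U' VU by (simp add: of_mat_mult[of _ k k _ k] of_mat_to_mat)
  then have "?V * ?U = 1\<^sub>m k" by (rule of_mat_inj[of _ k k, rotated 2]) (auto intro: mult_carrier_mat[of _ k k])
  then have "?U * ?V = 1\<^sub>m k" by (rule mat_mult_left_right_inverse[of _ k, rotated 2]) auto
  then have "U * V = ident k" using V' U'
    by (metis of_mat_mult of_mat_one of_mat_to_mat to_mat_carrier)
  then have "ident n * ident k = ident k" using U by (metis mult.assoc shaped_left)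
  moreover have "ident n * ident k = ident n" using nk by (intro fmat_eqI) (auto simp: ent_ident_mult ent_ident)
  ultimately show False using nk ident_inj by auto
qed

section \<open>Representations\<close>

text \<open>
  The condition at \<open>\<one>\<close> puts all values into the corner of \<open>n\<close> by \<open>n\<close> matrices (\<open>rep_shaped\<close>).
\<close>

definition rep :: "('a, 'b) monoid_scheme \<Rightarrow> nat \<Rightarrow> ('a \<Rightarrow> fmat) \<Rightarrow> bool" where
  "rep G n R \<longleftrightarrow> R \<one>\<^bsub>G\<^esub> = ident n \<and>
     (\<forall>g\<in>carrier G. \<forall>h\<in>carrier G. R (g \<otimes>\<^bsub>G\<^esub> h) = R g * R h)"

text \<open>
  Column vectors are the matrices of shape \<open>n\<close> by \<open>1\<close>; in this form matrices act on them by the ring multiplication.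
\<close>

definition col_subspace :: "nat \<Rightarrow> fmat set \<Rightarrow> bool" where
  "col_subspace n W \<longleftrightarrow> (\<forall>w\<in>W. shaped n 1 w) \<and> 0 \<in> W \<and> (\<forall>v\<in>W. \<forall>w\<in>W. v + w \<in> W) \<and>
     (\<forall>c. \<forall>w\<in>W. smul c w \<in> W)"

definition irr_rep :: "('a, 'b) monoid_scheme \<Rightarrow> nat \<Rightarrow> ('a \<Rightarrow> fmat) \<Rightarrow> bool" where
  "irr_rep G n R \<longleftrightarrow> 0 < n \<and> rep G n R \<and>
     (\<forall>W. col_subspace n W \<and> (\<forall>g\<in>carrier G. \<forall>w\<in>W. R g * w \<in> W) \<longrightarrow>
        W = {0} \<or> W = {w. shaped n 1 w})"

definition of_col :: "complex vec \<Rightarrow> fmat" where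
  "of_col v = of_mat (mat (dim_vec v) 1 (\<lambda>(i, j). v $ i))"

definition to_col :: "nat \<Rightarrow> fmat \<Rightarrow> complex vec" where
  "to_col n c = vec n (\<lambda>i. ent c i 0)"

lemma ent_of_col: "ent (of_col v) i j = (if i < dim_vec v \<and> j = 0 then v $ i else 0)"
  by (auto simp: of_col_def ent_of_mat)
lemma shaped_of_col: "v \<in> carrier_vec n \<Longrightarrow> shaped n 1 (of_col v)" by (auto simp: shaped_iff ent_of_col)
lemma to_col_carrier [simp]: "to_col n c \<in> carrier_vec n" by (simp add: to_col_def)
lemma of_col_to_col: "shaped n 1 c \<Longrightarrow> of_col (to_col n c) = c"
  by (rule fmat_eqI) (auto simp: ent_of_col to_col_def shaped_iff)
lemma to_col_of_col: "v \<in> carrier_vec n \<Longrightarrow> to_col n (of_col v) = v"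
  by (auto simp: ent_of_col to_col_def)
lemma of_col_inj: "v \<in> carrier_vec n \<Longrightarrow> w \<in> carrier_vec n \<Longrightarrow> of_col v = of_col w \<Longrightarrow> v = w"
  by (metis to_col_of_col)
lemma of_col_zero: "of_col (0\<^sub>v n) = 0" by (rule fmat_eqI) (auto simp: ent_of_col)
lemma of_col_add: "v \<in> carrier_vec n \<Longrightarrow> w \<in> carrier_vec n \<Longrightarrow> of_col (v + w) = of_col v + of_col w"
  by (rule fmat_eqI) (auto simp: ent_of_col)
lemma of_col_smult: "of_col (c \<cdot>\<^sub>v v) = smul c (of_col v)"
  by (rule fmat_eqI) (auto simp: ent_of_col)
lemma of_col_mult:
  assumes "A \<in> carrier_mat n m" "v \<in> carrier_vec m"
  shows "of_col (A *\<^sub>v v) = of_mat A * of_col v"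
proof -
  have "of_mat A * of_col v = of_mat (A * mat (dim_vec v) 1 (\<lambda>(i, j). v $ i))"
    unfolding of_col_def using assms by (intro of_mat_mult[symmetric, of _ n m _ 1]) auto
  also have "A * mat (dim_vec v) 1 (\<lambda>(i, j). v $ i) = mat (dim_vec (A *\<^sub>v v)) 1 (\<lambda>(i, j). (A *\<^sub>v v) $ i)"
    using assms by (intro eq_matI) (auto simp: scalar_prod_def)
  finally show ?thesis by (simp add: of_col_def)
qed

lemma subspace_module_vec_iff:
  "VectorSpace.subspace class_ring W (module_vec TYPE(complex) n) \<longleftrightarrow>
     W \<subseteq> carrier_vec n \<and> 0\<^sub>v n \<in> W \<and> (\<forall>v\<in>W. \<forall>w\<in>W. v + w \<in> W) \<and> (\<forall>c. \<forall>w\<in>W. c \<cdot>\<^sub>v w \<in> W)"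
proof -
  interpret vec_space "TYPE(complex)" n .
  have m: "Module.module class_ring (module_vec TYPE(complex) n)"
    and v: "vectorspace class_ring (module_vec TYPE(complex) n)"
    using vec_module vec_vs by blast+
  show ?thesis
    unfolding VectorSpace.subspace_def submodule_def module_vec_simps
    using m v by (simp, blast)
qed

lemma GL_carrier: "A \<in> carrier (GL n) \<Longrightarrow> A \<in> carrier_mat n n"
  by (auto simp: GL_def units_of_carrier Units_def ring_mat_def)
lemma GL_mult: "A \<otimes>\<^bsub>GL n\<^esub> B = A * B" by (auto simp: GL_def units_of_mult ring_mat_def)
lemma GL_one: "\<one>\<^bsub>GL n\<^esub> = 1\<^sub>m n" by (auto simp: GL_def units_of_one ring_mat_def)
lemma GL_group: "group (GL n)"
proof -
  interpret r: ring "ring_mat TYPE(complex) n ()" by (rule ring_mat)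
  show ?thesis unfolding GL_def by (rule r.units_group)
qed

lemma rep_of_mat:
  assumes "group G" "\<rho> \<in> hom G (GL n)"
  shows "rep G n (\<lambda>g. of_mat (\<rho> g))"
proof -
  have 1: "\<rho> \<one>\<^bsub>G\<^esub> = 1\<^sub>m n" using hom_one[OF assms(2,1) GL_group] by (simp add: GL_one)
  have 2: "g \<in> carrier G \<Longrightarrow> \<rho> g \<in> carrier_mat n n" for g
    using assms(2) GL_carrier by (auto simp: hom_def)
  show ?thesis using 1 2 assms(2) by (auto simp: rep_def hom_def GL_mult of_mat_mult[of _ n n _ n])
qed

lemma hom_carrier_mat: "\<rho> \<in> hom G (GL n) \<Longrightarrow> g \<in> carrier G \<Longrightarrow> \<rho> g \<in> carrier_mat n n"
  using GL_carrier by (auto simp: hom_def)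

context group
begin

lemma rep_shaped:
  assumes "rep G n R" "g \<in> carrier G" shows "shaped n n (R g)"
proof -
  have "R g = ident n * R g" "R g = R g * ident n"
    using assms l_one[of g] r_one[of g] unfolding rep_def by (metis one_closed)+
  then show ?thesis by (simp add: shaped_def)
qed

lemma rep_mult: "rep G n R \<Longrightarrow> g \<in> carrier G \<Longrightarrow> h \<in> carrier G \<Longrightarrow> R (g \<otimes> h) = R g * R h"
  by (simp add: rep_def)
lemma rep_one: "rep G n R \<Longrightarrow> R \<one> = ident n" by (simp add: rep_def)

lemma hom_to_mat:
  assumes "rep G n R" shows "(\<lambda>g. to_mat n n (R g)) \<in> hom G (GL n)"
proof -
  have m: "to_mat n n (R (g \<otimes> h)) = to_mat n n (R g) * to_mat n n (R h)"
    if "g \<in> carrier G" "h \<in> carrier G" for g h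
    by (rule of_mat_inj[of _ n n])
       (use that assms in \<open>auto simp: of_mat_mult[of _ n n _ n] of_mat_to_mat rep_shaped rep_mult shaped_mult[of n n _ n]
          intro: mult_carrier_mat[of _ n n]\<close>)
  have o: "to_mat n n (R \<one>) = 1\<^sub>m n"
    by (rule of_mat_inj[of _ n n]) (use assms in \<open>auto simp: of_mat_to_mat rep_one\<close>)
  have "to_mat n n (R g) \<in> Units (ring_mat TYPE(complex) n ())" if g: "g \<in> carrier G" for g
    unfolding Units_def using g m[of g "inv g"] m[of "inv g" g] o
    by (auto simp: ring_mat_def intro!: bexI[of _ "to_mat n n (R (inv g))"])
  then show ?thesis using m by (auto simp: hom_def GL_mult GL_def units_of_carrier)
       (simp add: units_of_mult ring_mat_def)
qed

lemma irr_rep_of_irreducible_rep: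
  assumes "irreducible_rep G n \<rho>" shows "irr_rep G n (\<lambda>g. of_mat (\<rho> g))"
  unfolding irr_rep_def
proof (intro conjI allI impI)
  have h: "\<rho> \<in> hom G (GL n)" using assms by (simp add: irreducible_rep_def)
  show "0 < n" using assms by (simp add: irreducible_rep_def)
  show "rep G n (\<lambda>g. of_mat (\<rho> g))" by (rule rep_of_mat[OF is_group h])
  fix W assume W: "col_subspace n W \<and> (\<forall>g\<in>carrier G. \<forall>w\<in>W. of_mat (\<rho> g) * w \<in> W)"
  define W' where "W' = {v \<in> carrier_vec n. of_col v \<in> W}"
  have "VectorSpace.subspace class_ring W' (module_vec TYPE(complex) n)"
    unfolding subspace_module_vec_iff W'_def using W
    by (auto simp: col_subspace_def of_col_zero of_col_add of_col_smult)
  moreover have "\<forall>g \<in> carrier G. \<forall>w \<in> W'. \<rho> g *\<^sub>v w \<in> W'"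
    unfolding W'_def using W hom_carrier_mat[OF h]
    by (auto simp: of_col_mult[of _ n n] intro!: mult_mat_vec_carrier[of _ n n])
  ultimately have "W' = {0\<^sub>v n} \<or> W' = carrier_vec n"
    using assms by (auto simp: irreducible_rep_def)
  moreover have W_eq: "W = of_col ` W'"
  proof (intro equalityI subsetI)
    fix w assume w: "w \<in> W"
    then have "w = of_col (to_col n w)" using W of_col_to_col by (simp add: col_subspace_def)
    moreover have "to_col n w \<in> W'" using w calculation by (simp add: W'_def)
    ultimately show "w \<in> of_col ` W'" by blast
  qed (auto simp: W'_def)
  moreover have "of_col ` carrier_vec n = {w. shaped n 1 w}"
  proof (intro equalityI subsetI)
    fix w assume "w \<in> {w. shaped n 1 w}"
    then have "w = of_col (to_col n w)" by (simp add: of_col_to_col)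
    then show "w \<in> of_col ` carrier_vec n" by (rule image_eqI) simp
  qed (use shaped_of_col in blast)
  ultimately show "W = {0} \<or> W = {w. shaped n 1 w}" by (auto simp: of_col_zero)
qed

lemma irreducible_rep_of_irr_rep:
  assumes "irr_rep G n R" shows "irreducible_rep G n (\<lambda>g. to_mat n n (R g))"
  unfolding irreducible_rep_def
proof (intro conjI allI impI)
  have f: "rep G n R" using assms by (simp add: irr_rep_def)
  show "0 < n" using assms by (simp add: irr_rep_def)
  show "(\<lambda>g. to_mat n n (R g)) \<in> hom G (GL n)" by (rule hom_to_mat[OF f])
  fix W assume W: "VectorSpace.subspace class_ring W (module_vec TYPE(complex) n) \<and>
    (\<forall>g\<in>carrier G. \<forall>w\<in>W. to_mat n n (R g) *\<^sub>v w \<in> W)"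
  then have W1: "W \<subseteq> carrier_vec n" "0\<^sub>v n \<in> W" "\<forall>v\<in>W. \<forall>w\<in>W. v + w \<in> W" "\<forall>c. \<forall>w\<in>W. c \<cdot>\<^sub>v w \<in> W"
    unfolding subspace_module_vec_iff by blast+
  have "col_subspace n (of_col ` W)"
    unfolding col_subspace_def
  proof (intro conjI ballI allI)
    fix w assume "w \<in> of_col ` W" then show "shaped n 1 w" using W1(1) shaped_of_col by blast
  next
    show "0 \<in> of_col ` W" using W1(2) of_col_zero by (metis image_eqI)
  next
    fix v w assume "v \<in> of_col ` W" "w \<in> of_col ` W"
    then show "v + w \<in> of_col ` W" using W1(1,3) of_col_add[of _ n] by (smt (verit) image_iff subsetD)
  next
    fix c w assume "w \<in> of_col ` W" then show "smul c w \<in> of_col ` W"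
      using W1(4) of_col_smult by (smt (verit) image_iff)
  qed
  moreover have "R g * w \<in> of_col ` W" if g: "g \<in> carrier G" and w: "w \<in> of_col ` W" for g w
  proof -
    obtain v where v: "v \<in> W" "w = of_col v" using w by blast
    have "of_col (to_mat n n (R g) *\<^sub>v v) = R g * w"
      using v W1(1) g f by (subst of_col_mult[of _ n n]) (auto simp: of_mat_to_mat rep_shaped)
    then show ?thesis using W v g by (metis image_eqI)
  qed
  ultimately have "of_col ` W = {0} \<or> of_col ` W = {w. shaped n 1 w}"
    using assms unfolding irr_rep_def by blast
  then show "W = {0\<^sub>v n} \<or> W = carrier_vec n"
  proof
    assume *: "of_col ` W = {0}"
    have "w = 0\<^sub>v n" if "w \<in> W" for w
    proof (rule of_col_inj[of _ n])
      have "of_col w \<in> of_col ` W" using that by (rule imageI)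
      then have "of_col w = 0" unfolding * by simp
      then show "of_col w = of_col (0\<^sub>v n)" by (simp add: of_col_zero)
      show "w \<in> carrier_vec n" using W1(1) that by (rule subsetD)
    qed simp
    then show ?thesis using W1(2) by blast
  next
    assume *: "of_col ` W = {w. shaped n 1 w}"
    have "w \<in> W" if w: "w \<in> carrier_vec n" for w
    proof -
      have "of_col w \<in> of_col ` W" using * shaped_of_col[OF w] by simp
      then obtain v where "v \<in> W" "of_col w = of_col v" by blast
      then show ?thesis using of_col_inj w W1(1) by (metis subsetD)
    qed
    then show ?thesis using W1(1) by auto
  qed
qed

end

definition rep_char :: "('a, 'b) monoid_scheme \<Rightarrow> ('a \<Rightarrow> fmat) \<Rightarrow> ('a \<Rightarrow> complex)" where
  "rep_char G R = (\<lambda>g \<in> carrier G. tr (R g))"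

lemma (in group) Irr_iff: "\<chi> \<in> Irr G \<longleftrightarrow> (\<exists>n R. irr_rep G n R \<and> \<chi> = rep_char G R)"
proof
  assume "\<chi> \<in> Irr G"
  then obtain n \<rho> where *: "irreducible_rep G n \<rho>" "\<chi> = character G \<rho>" by (auto simp: Irr_def)
  then have h: "\<rho> \<in> hom G (GL n)" by (simp add: irreducible_rep_def)
  have "\<chi> = rep_char G (\<lambda>g. of_mat (\<rho> g))"
    unfolding * character_def rep_char_def using hom_carrier_mat[OF h]
    by (intro restrict_ext) (simp add: tr_of_mat[of _ n])
  then show "\<exists>n R. irr_rep G n R \<and> \<chi> = rep_char G R" using irr_rep_of_irreducible_rep[OF *(1)] by blast
next
  assume "\<exists>n R. irr_rep G n R \<and> \<chi> = rep_char G R"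
  then obtain n R where *: "irr_rep G n R" "\<chi> = rep_char G R" by blast
  then have "\<chi> = character G (\<lambda>g. to_mat n n (R g))"
    unfolding * character_def rep_char_def
    by (intro restrict_ext) (auto simp: tr_of_mat[symmetric, of _ n] of_mat_to_mat rep_shaped irr_rep_def)
  then show "\<chi> \<in> Irr G" using irreducible_rep_of_irr_rep[OF *(1)] by (auto simp: Irr_def)
qed

section \<open>Schur's lemma and orthogonality\<close>

lemma cols_eqI:
  assumes "shaped n m A" "shaped n m B" "\<And>j. j < m \<Longrightarrow> A * munit j 0 = B * munit j 0" shows "A = B"
proof (rule fmat_eqI)
  fix i j show "ent A i j = ent B i j"
  proof (cases "j < m")
    case True
    then show ?thesis using arg_cong[OF assms(3)[OF True], of "\<lambda>X. ent X i 0"] by (simp add: ent_mult_munit)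
  qed (use assms in \<open>auto simp: shaped_iff\<close>)
qed

lemma shaped_col: "shaped n m A \<Longrightarrow> shaped n 1 (A * munit j 0)"
  by (auto simp: shaped_iff ent_mult_munit)

lemma eigenvalue_ex:
  assumes "shaped n n Y" "0 < n"
  obtains c w where "shaped n 1 w" "w \<noteq> 0" "Y * w = smul c w"
proof -
  let ?Y = "to_mat n n Y"
  have c: "?Y \<in> carrier_mat n n" by simp
  obtain k v where "eigenvector ?Y v k"
    using spectrum_non_empty[OF c assms(2)] by (auto simp: spectrum_def eigenvalue_def)
  then have v: "v \<in> carrier_vec n" "v \<noteq> 0\<^sub>v n" "?Y *\<^sub>v v = k \<cdot>\<^sub>v v" by (auto simp: eigenvector_def to_mat_def)
  have "Y * of_col v = of_col (?Y *\<^sub>v v)" using of_col_mult[OF c v(1)] by (simp only: of_mat_to_mat[OF assms(1)])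
  then have "Y * of_col v = smul k (of_col v)" using v by (simp add: of_col_smult)
  moreover have "of_col v \<noteq> 0" using v of_col_inj[of v n "0\<^sub>v n"] by (auto simp: of_col_zero)
  ultimately show ?thesis using that shaped_of_col v by blast
qed

context group
begin

lemma irr_rep_scalar:
  assumes R: "irr_rep G n R" and Y: "shaped n n Y" and comm: "\<And>g. g \<in> carrier G \<Longrightarrow> R g * Y = Y * R g"
  shows "\<exists>c. Y = smul c (ident n)"
proof -
  have n: "0 < n" and f: "rep G n R" using R by (auto simp: irr_rep_def)
  obtain c w where w: "shaped n 1 w" "w \<noteq> 0" "Y * w = smul c w" using eigenvalue_ex[OF Y n] by blast
  define W where "W = {w. shaped n 1 w \<and> Y * w = smul c w}"
  have "col_subspace n W"
    unfolding col_subspace_def W_def by (auto simp: distrib_left smul_add smul_mult mult.commute)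
  moreover have "R g * w \<in> W" if "g \<in> carrier G" "w \<in> W" for g w
  proof -
    have "Y * (R g * w) = R g * (Y * w)" using comm[OF that(1)] by (metis mult.assoc)
    then show ?thesis using that rep_shaped[OF f] by (auto simp: W_def smul_mult)
  qed
  ultimately have "W = {0} \<or> W = {w. shaped n 1 w}" using R by (auto simp: irr_rep_def)
  moreover have "w \<in> W" using w by (simp add: W_def)
  ultimately have all: "W = {w. shaped n 1 w}" using w(2) by auto
  have "Y = smul c (ident n)"
  proof (rule cols_eqI[of n n])
    fix j assume "j < n"
    then have "munit j 0 \<in> W" using all shaped_munit[of j n 0 1] by auto
    then show "Y * munit j 0 = smul c (ident n) * munit j 0" by (auto simp: W_def smul_mult shaped_left)
  qed (use Y in auto)
  then show ?thesis ..
qed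

text \<open>
  The kernel of \<open>Y\<close> is zero and its range is everything.  Preimages of the unit columns give a right inverse
  \<open>X\<close>, and it is a left inverse because \<open>Y\<close> kills \<open>X * Y - ident m\<close>.
\<close>

lemma irr_rep_intertwiner:
  assumes R: "irr_rep G n R" and S: "irr_rep G m S" and Y: "shaped n m Y" "Y \<noteq> 0"
    and comm: "\<And>g. g \<in> carrier G \<Longrightarrow> R g * Y = Y * S g"
  shows "\<exists>X. shaped m n X \<and> Y * X = ident n \<and> X * Y = ident m"
proof -
  have f: "rep G n R" "rep G m S" using R S by (auto simp: irr_rep_def)
  obtain j where j: "j < m" "Y * munit j 0 \<noteq> 0" using cols_eqI[OF Y(1), of 0] Y(2) by auto
  define K where "K = {x. shaped m 1 x \<and> Y * x = 0}"
  have "col_subspace m K" unfolding col_subspace_def K_def by (auto simp: distrib_left smul_mult)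
  moreover have "S g * w \<in> K" if "g \<in> carrier G" "w \<in> K" for g w
  proof -
    have "Y * (S g * w) = R g * (Y * w)" using comm[OF that(1)] by (metis mult.assoc)
    then show ?thesis using that rep_shaped[OF f(2)] by (auto simp: K_def)
  qed
  ultimately have "K = {0} \<or> K = {w. shaped m 1 w}" using S by (auto simp: irr_rep_def)
  moreover have "munit j 0 \<notin> K" "shaped m 1 (munit j 0)" using j shaped_munit[of j m 0 1] by (auto simp: K_def)
  ultimately have K0: "K = {0}" by auto
  define I where "I = {y. \<exists>x. shaped m 1 x \<and> y = Y * x}"
  have "col_subspace n I" unfolding col_subspace_def
  proof (intro conjI ballI allI)
    show "0 \<in> I" unfolding I_def by (auto intro!: exI[of _ 0])
    fix v w c assume "v \<in> I" "w \<in> I"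
    then obtain x y where "shaped m 1 x" "v = Y * x" "shaped m 1 y" "w = Y * y" by (auto simp: I_def)
    then show "v + w \<in> I" unfolding I_def by (auto intro!: exI[of _ "x + y"] simp: distrib_left)
  next
    fix w c assume "w \<in> I"
    then obtain y where "shaped m 1 y" "w = Y * y" by (auto simp: I_def)
    then show "smul c w \<in> I" unfolding I_def by (auto intro!: exI[of _ "smul c y"] simp: smul_mult)
  qed (use Y in \<open>auto simp: I_def\<close>)
  moreover have "R g * w \<in> I" if g: "g \<in> carrier G" and w: "w \<in> I" for g w
  proof -
    obtain y where y: "shaped m 1 y" "w = Y * y" using w unfolding I_def by blast
    then have "R g * w = Y * (S g * y)" using comm[OF g] by (metis mult.assoc)
    then show ?thesis using rep_shaped[OF f(2) g] y unfolding I_def by blast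
  qed
  ultimately have "I = {0} \<or> I = {w. shaped n 1 w}" using R by (auto simp: irr_rep_def)
  moreover have "Y * munit j 0 \<in> I" using shaped_munit[of j m 0 1] j by (auto simp: I_def)
  ultimately have I: "I = {w. shaped n 1 w}" using j by auto
  have "\<exists>x. shaped m 1 x \<and> munit i 0 = Y * x" if "i < n" for i
  proof -
    have "munit i 0 \<in> I" using I shaped_munit[of i n 0 1] that by auto
    then show ?thesis by (simp add: I_def)
  qed
  then obtain x where x: "\<And>i. i < n \<Longrightarrow> shaped m 1 (x i) \<and> munit i 0 = Y * x i" by metis
  define X where "X = (\<Sum>i<n. x i * munit 0 i)"
  have X: "shaped m n X" unfolding X_def
    using x by (intro shaped_sum) (auto intro!: shaped_mult[of _ 1] shaped_munit)
  have Yx: "Y * x i = munit i 0" if "i < n" for i using x[OF that] by simp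
  have "Y * X = (\<Sum>i<n. munit i i)"
    unfolding X_def sum_distrib_left by (intro sum.cong) (auto simp: mult.assoc[symmetric] munit_mult Yx)
  also have "\<dots> = ident n" by (induction n) (auto simp: ident_Suc)
  finally have YX: "Y * X = ident n" .
  have "X * Y = ident m"
  proof (rule cols_eqI[of m m])
    fix j assume "j < m"
    have "Y * ((X * Y - ident m) * munit j 0) = (Y * X * Y - Y * ident m) * munit j 0"
      by (simp add: algebra_simps)
    also have "\<dots> = 0" using YX Y by (simp add: shaped_left shaped_right)
    finally have z: "Y * ((X * Y - ident m) * munit j 0) = 0" .
    have "shaped m m (X * Y - ident m)" by (intro shaped_diff shaped_mult[OF X Y(1)] shaped_ident)
    then have "(X * Y - ident m) * munit j 0 \<in> K" unfolding K_def using z shaped_col by blast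
    then show "X * Y * munit j 0 = ident m * munit j 0" using K0 by (simp add: algebra_simps)
  qed (use X Y in auto)
  then show ?thesis using X YX by blast
qed

lemma intertwiner_same_trace:
  assumes "rep G n R" "rep G m S" "shaped n m Y" "shaped m n X" "Y * X = ident n" "X * Y = ident m"
    "R g * Y = Y * S g" "g \<in> carrier G"
  shows "tr (R g) = tr (S g)"
proof -
  have "tr (R g) = tr (R g * Y * X)" using rep_shaped[OF assms(1,8)] assms(5) by (simp add: mult.assoc shaped_right)
  also have "\<dots> = tr (Y * (S g * X))" using assms(7) by (simp add: mult.assoc)
  also have "\<dots> = tr (S g * (X * Y))" by (subst tr_comm) (simp add: mult.assoc)
  also have "\<dots> = tr (S g)" using rep_shaped[OF assms(2,8)] assms(6) by (simp add: shaped_right)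
  finally show ?thesis .
qed

definition average :: "('a \<Rightarrow> fmat) \<Rightarrow> ('a \<Rightarrow> fmat) \<Rightarrow> fmat \<Rightarrow> fmat" where
  "average R S X = (\<Sum>g\<in>carrier G. R g * X * S (inv g))"

lemma sum_shift_left:
  assumes "h \<in> carrier G" shows "(\<Sum>g\<in>carrier G. f (h \<otimes> g)) = (\<Sum>g\<in>carrier G. f g)"
  by (rule sum.reindex_bij_witness[of _ "\<lambda>g. inv h \<otimes> g" "\<lambda>g. h \<otimes> g"])
     (use assms in \<open>auto simp: m_assoc[symmetric]\<close>)

lemma average_intertwines:
  assumes R: "rep G n R" and S: "rep G m S" and h: "h \<in> carrier G"
  shows "R h * average R S X = average R S X * S h"
proof -
  have "R h * average R S X = (\<Sum>g\<in>carrier G. R (h \<otimes> g) * X * S (inv (h \<otimes> g) \<otimes> h))"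
    unfolding average_def sum_distrib_left
  proof (rule sum.cong[OF refl])
    fix g assume g: "g \<in> carrier G"
    have "inv (h \<otimes> g) \<otimes> h = inv g" using g h by (simp add: inv_mult_group m_assoc)
    then show "R h * (R g * X * S (inv g)) = R (h \<otimes> g) * X * S (inv (h \<otimes> g) \<otimes> h)"
      using g h by (simp add: rep_mult[OF R] mult.assoc)
  qed
  also have "\<dots> = (\<Sum>g\<in>carrier G. R g * X * S (inv g \<otimes> h))"
    using sum_shift_left[OF h, of "\<lambda>g. R g * X * S (inv g \<otimes> h)"] by simp
  also have "\<dots> = average R S X * S h"
    unfolding average_def sum_distrib_right using h
    by (intro sum.cong) (auto simp: rep_mult[OF S] mult.assoc)
  finally show ?thesis .
qed

lemma shaped_average: "rep G n R \<Longrightarrow> rep G m S \<Longrightarrow> shaped n m X \<Longrightarrow> shaped n m (average R S X)"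
  unfolding average_def by (intro shaped_sum shaped_mult[of n n] shaped_mult[of n m]) (auto simp: rep_shaped)

text \<open>
  The products \<open>R(g)\<^sub>i\<^sub>i * S(g\<inverse>)\<^sub>j\<^sub>j\<close> are the diagonal entries \<open>(i, j)\<close> of \<open>R(g) E\<^sub>i\<^sub>j S(g\<inverse>)\<close>, so the inner
  product of two characters is read off from averaged matrices, which are intertwiners and fall under Schur's lemma.
\<close>

lemma char_product_average:
  assumes "rep G n R" "rep G m S"
  shows "(\<Sum>g\<in>carrier G. tr (R g) * tr (S (inv g))) = (\<Sum>i<n. \<Sum>j<m. ent (average R S (munit i j)) i j)"
proof -
  have e: "tr (R g) * tr (S (inv g)) = (\<Sum>i<n. \<Sum>j<m. ent (R g * munit i j * S (inv g)) i j)"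
    if g: "g \<in> carrier G" for g
  proof -
    have b: "bounded n (R g)" "bounded m (S (inv g))"
      using rep_shaped[OF assms(1) g] rep_shaped[OF assms(2), of "inv g"] g by (auto simp: shaped_iff bounded_def)
    have "ent (R g * munit i j * S (inv g)) i j = ent (R g) i i * ent (S (inv g)) j j" if "j < m" for i j
    proof -
      have "ent (R g * munit i j * S (inv g)) i j = (\<Sum>k<m. if k = j then ent (R g) i i * ent (S (inv g)) j j else 0)"
        unfolding ent_mult_bounded[OF disjI2[OF b(2)]] by (rule sum.cong) (auto simp: ent_mult_munit)
      then show ?thesis using that by simp
    qed
    then show ?thesis by (simp add: tr_bounded[OF b(1)] tr_bounded[OF b(2)] sum_product)
  qed
  have "(\<Sum>g\<in>carrier G. tr (R g) * tr (S (inv g))) =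
      (\<Sum>g\<in>carrier G. \<Sum>i<n. \<Sum>j<m. ent (R g * munit i j * S (inv g)) i j)"
    by (rule sum.cong) (auto simp: e)
  also have "\<dots> = (\<Sum>i<n. \<Sum>g\<in>carrier G. \<Sum>j<m. ent (R g * munit i j * S (inv g)) i j)" by (rule sum.swap)
  also have "\<dots> = (\<Sum>i<n. \<Sum>j<m. \<Sum>g\<in>carrier G. ent (R g * munit i j * S (inv g)) i j)"
    by (intro sum.cong refl sum.swap)
  finally show ?thesis by (simp add: average_def ent_sum)
qed

lemma char_orthogonal:
  assumes R: "irr_rep G n R" and S: "irr_rep G m S" and ne: "\<exists>g\<in>carrier G. tr (R g) \<noteq> tr (S g)"
  shows "(\<Sum>g\<in>carrier G. tr (R g) * tr (S (inv g))) = 0"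
proof -
  have f: "rep G n R" "rep G m S" using R S by (auto simp: irr_rep_def)
  have "average R S X = 0" if X: "shaped n m X" for X
  proof (rule ccontr)
    assume "average R S X \<noteq> 0"
    then obtain Z where "shaped m n Z \<and> average R S X * Z = ident n \<and> Z * average R S X = ident m"
      using irr_rep_intertwiner[OF R S shaped_average[OF f X]] average_intertwines[OF f] by blast
    then show False
      using ne intertwiner_same_trace[OF f shaped_average[OF f X]] average_intertwines[OF f] by blast
  qed
  then show ?thesis by (simp add: char_product_average[OF f] shaped_munit)
qed

text \<open>
  The averages are scalar by Schur's lemma, and the trace of the average of \<open>E\<^sub>i\<^sub>j\<close> determines the scalar.
\<close>

lemma char_norm:
  assumes R: "irr_rep G n R"
  shows "(\<Sum>g\<in>carrier G. tr (R g) * tr (R (inv g))) = of_nat (card (carrier G))"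
proof -
  have f: "rep G n R" and n: "0 < n" using R by (auto simp: irr_rep_def)
  have e: "ent (average R R (munit i j)) i j = (if i = j then of_nat (card (carrier G)) / of_nat n else 0)"
    if "i < n" "j < n" for i j
  proof -
    have s: "shaped n n (munit i j)" using that by (simp add: shaped_munit)
    obtain c where c: "average R R (munit i j) = smul c (ident n)"
      using irr_rep_scalar[OF R shaped_average[OF f f s]] average_intertwines[OF f f] by blast
    have "tr (average R R (munit i j)) = (\<Sum>g\<in>carrier G. tr (munit i j))"
      unfolding average_def tr_sum
    proof (rule sum.cong[OF refl])
      fix g assume g: "g \<in> carrier G"
      have "tr (R g * munit i j * R (inv g)) = tr (R (inv g) * R g * munit i j)"
        by (subst tr_comm) (simp add: mult.assoc)
      also have "R (inv g) * R g = R \<one>" using g by (simp flip: rep_mult[OF f])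
      finally show "tr (R g * munit i j * R (inv g)) = tr (munit i j)"
        using g s by (simp add: rep_one[OF f] shaped_left)
    qed
    then have "c * of_nat n = of_nat (card (carrier G)) * (if i = j then 1 else 0)"
      by (simp add: c tr_munit)
    then have "c = (if i = j then of_nat (card (carrier G)) / of_nat n else 0)"
      using n by (auto simp: field_simps)
    then show ?thesis using that by (auto simp: c ent_ident)
  qed
  have "(\<Sum>g\<in>carrier G. tr (R g) * tr (R (inv g))) =
      (\<Sum>i<n. \<Sum>j<n. if i = j then of_nat (card (carrier G)) / of_nat n else 0)"
    unfolding char_product_average[OF f f] by (intro sum.cong refl) (auto simp: e)
  also have "\<dots> = of_nat (card (carrier G))" using n by simp
  finally show ?thesis .
qed

end

section \<open>Subspaces as ranges of idempotents\<close>

text \<open>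
  Choose \<open>U\<close> with columns in \<open>W\<close> and left inverse \<open>V\<close> with the largest possible number \<open>k\<close> of columns.
  If some \<open>w\<close> in \<open>W\<close> were not fixed by \<open>U * V\<close>, the nonzero difference \<open>w'\<close> could be added to \<open>U\<close> as a
  further column, because a coordinate functional that does not vanish on \<open>w'\<close> and is cut down by \<open>ident n - U * V\<close>
  extends the left inverse.
\<close>

lemma col_subspace_projection:
  assumes W: "col_subspace n W"
  shows "\<exists>k U V. shaped n k U \<and> shaped k n V \<and> V * U = ident k \<and> (\<forall>x. shaped k 1 x \<longrightarrow> U * x \<in> W) \<and>
     (\<forall>w\<in>W. U * (V * w) = w)"
proof -
  define P where "P k \<longleftrightarrow> (\<exists>U V. shaped n k U \<and> shaped k n V \<and> V * U = ident k \<and> (\<forall>x. shaped k 1 x \<longrightarrow> U * x \<in> W))" for k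
  have P0: "P 0" unfolding P_def using W by (intro exI[of _ 0]) (auto simp: col_subspace_def)
  have Pn: "P k \<Longrightarrow> k \<le> n" for k unfolding P_def using one_sided_inverse_dim by blast
  define k where "k = (GREATEST k. P k)"
  have Pk: "P k" unfolding k_def using P0 Pn by (rule GreatestI_nat)
  have "\<not> P (Suc k)" unfolding k_def using Greatest_le_nat[of P "Suc (GREATEST k. P k)" n] Pn by auto
  obtain U V where U: "shaped n k U" and V: "shaped k n V" and VU: "V * U = ident k"
    and UW: "\<And>x. shaped k 1 x \<Longrightarrow> U * x \<in> W" using Pk unfolding P_def by blast
  have "U * (V * w) = w" if w: "w \<in> W" for w
  proof (rule ccontr)
    assume ne: "U * (V * w) \<noteq> w"
    have ws: "shaped n 1 w" using w W by (auto simp: col_subspace_def)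
    define w' where "w' = w + smul (-1) (U * (V * w))"
    have w'W: "w' \<in> W"
    proof -
      have "U * (V * w) \<in> W" by (rule UW) (use V ws in blast)
      then show ?thesis unfolding w'_def using W w unfolding col_subspace_def by blast
    qed
    have w'_eq: "w' = w - U * (V * w)" unfolding w'_def by (rule fmat_eqI) simp
    then have "w' \<noteq> 0" using ne by auto
    moreover have w's: "shaped n 1 w'" using w'W W by (auto simp: col_subspace_def)
    ultimately obtain i where i: "ent w' i 0 \<noteq> 0" "i < n"
      using cols_eqI[of n 1 w' 0] fmat_eqI[of w' 0] by (metis ent_zero less_one not_le shaped_iff)
    have "V * w' = V * w - (V * U) * (V * w)" by (simp add: w'_eq algebra_simps)
    then have Vw': "V * w' = 0" using V VU by (simp add: mult.assoc[symmetric] shaped_left)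
    define c where "c = w' * munit 0 k"
    define r where "r = smul (1 / ent w' i 0) (munit k i * (ident n - U * V))"
    have smul: "shaped n (Suc k) c" unfolding c_def using w's shaped_munit[of 0 1 k "Suc k"] by auto
    have rs: "shaped (Suc k) n r" unfolding r_def using i
      by (intro shaped_smul shaped_mult[of "Suc k" n _ n] shaped_munit shaped_diff shaped_ident shaped_mult[OF U V]) auto
    have "(ident n - U * V) * U = U - U * (V * U)" using U by (simp add: algebra_simps shaped_left)
    then have rU: "r * U = 0" unfolding r_def using U VU by (simp add: smul_mult mult.assoc shaped_right)
    have Vc: "V * c = 0" unfolding c_def using Vw' by (simp add: mult.assoc[symmetric])
    have "(ident n - U * V) * w' = w'" using w's Vw' by (simp add: algebra_simps shaped_left)
    then have "r * c = smul (1 / ent w' i 0) (munit k i * w' * munit 0 k)"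
      unfolding r_def c_def by (simp add: smul_mult mult.assoc) (simp add: mult.assoc[symmetric])
    also have "munit k i * w' * munit 0 k = smul (ent w' i 0) (munit k k)"
      by (rule fmat_eqI) (auto simp: ent_mult_munit ent_munit_mult ent_munit)
    finally have rc: "r * c = munit k k" using i by simp
    have "P (Suc k)" unfolding P_def
    proof (intro exI conjI allI impI)
      show "shaped n (Suc k) (U + c)" using U smul shaped_mono[OF U, of n "Suc k"] by auto
      show "shaped (Suc k) n (V + r)" using V rs shaped_mono[OF V, of "Suc k" n] by auto
      show "(V + r) * (U + c) = ident (Suc k)"
        by (simp add: algebra_simps rU Vc rc VU ident_Suc)
      fix x assume x: "shaped (Suc k) 1 x"
      have "U * x = U * (ident k * x)" using U by (simp add: mult.assoc[symmetric] shaped_right)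
      moreover have "shaped k 1 (ident k * x)" using x by (auto simp: shaped_iff ent_ident_mult)
      ultimately have "U * x \<in> W" using UW by metis
      moreover have "c * x = smul (ent x k 0) w'"
      proof -
        have "munit 0 k * x = smul (ent x k 0) (ident 1)" using x
          by (intro fmat_eqI) (auto simp: ent_munit_mult ent_ident shaped_iff)
        then show ?thesis unfolding c_def using w's by (simp add: mult.assoc smul_mult shaped_right)
      qed
      ultimately show "(U + c) * x \<in> W" using W w'W unfolding col_subspace_def distrib_right by metis
    qed
    then show False using \<open>\<not> P (Suc k)\<close> by simp
  qed
  then show ?thesis using U V VU UW by blast
qed

text \<open>
  The projection \<open>U * V\<^sub>0\<close> onto the range of \<open>E\<close> need not be \<open>E\<close>, but \<open>U * (V\<^sub>0 * E)\<close> is.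
\<close>

lemma idempotent_factor:
  assumes E: "shaped n n E" "E * E = E"
  shows "\<exists>k U V. shaped n k U \<and> shaped k n V \<and> V * U = ident k \<and> U * V = E"
proof -
  define W where "W = {x. shaped n 1 x \<and> E * x = x}"
  have "col_subspace n W" unfolding col_subspace_def W_def by (auto simp: distrib_left smul_mult)
  then obtain k U V where U: "shaped n k U" and V: "shaped k n V" and VU: "V * U = ident k"
    and UW: "\<And>x. shaped k 1 x \<Longrightarrow> U * x \<in> W" and WU: "\<And>w. w \<in> W \<Longrightarrow> U * (V * w) = w"
    using col_subspace_projection by meson
  have EU: "E * U = U"
  proof (rule cols_eqI[of n k])
    fix j assume "j < k"
    then have "U * munit j 0 \<in> W" by (intro UW shaped_munit) auto
    then show "E * U * munit j 0 = U * munit j 0" by (simp add: W_def mult.assoc)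
  qed (use E U in auto)
  have UVE: "U * V * E = E"
  proof (rule cols_eqI[of n n])
    fix j assume "j < n"
    have "E * munit j 0 \<in> W" using E shaped_col[OF E(1), of j] by (simp add: W_def mult.assoc[symmetric])
    then show "U * V * E * munit j 0 = E * munit j 0" using WU by (simp add: mult.assoc)
  qed (use E U V in auto)
  have "V * E * U = ident k" using EU VU by (simp add: mult.assoc)
  moreover have "U * (V * E) = E" using UVE by (simp add: mult.assoc)
  ultimately show ?thesis using U V E(1) shaped_mult by blast
qed

lemma idempotent_tr_zero:
  assumes "shaped n n E" "E * E = E" "tr E = 0" shows "E = 0"
proof -
  obtain k U V where *: "shaped n k U" "shaped k n V" "V * U = ident k" "U * V = E"
    using idempotent_factor[OF assms(1,2)] by blast
  have "tr E = of_nat k" using * tr_comm[of U V] by simp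
  then have "k = 0" using assms by simp
  then have "U = U * 0" using shaped_right[OF *(1)] by simp
  then show ?thesis using * by simp
qed

section \<open>Decomposition of characters\<close>

text \<open>
  An invariant subspace is the range of an idempotent \<open>E\<close> with \<open>R(g) E = E R(g) E\<close>.  Factoring \<open>E\<close> and
  \<open>ident n - E\<close> gives the subrepresentation \<open>A\<close> and the quotient \<open>D\<close>, and the trace of a block triangular matrix
  is the sum of the traces of its diagonal blocks.
\<close>

lemma (in group) rep_decompose:
  assumes "rep G n R"
  shows "\<exists>L. (\<forall>(m, S)\<in>set L. irr_rep G m S) \<and> (\<forall>g\<in>carrier G. tr (R g) = (\<Sum>(m, S)\<leftarrow>L. tr (S g)))"
  using assms
proof (induction n arbitrary: R rule: less_induct)
  case (less n R)
  note f = less.prems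
  consider "n = 0" | "irr_rep G n R" | "0 < n" "\<not> irr_rep G n R" by blast
  then show ?case
  proof cases
    case 1
    have "R g = 0" if "g \<in> carrier G" for g using shaped_left[OF rep_shaped[OF f that]] 1 by simp
    then show ?thesis by (intro exI[of _ "[]"]) auto
  next
    case 2
    then show ?thesis by (intro exI[of _ "[(n, R)]"]) auto
  next
    case 3
    then obtain W where W: "col_subspace n W" and inv: "\<And>g w. g \<in> carrier G \<Longrightarrow> w \<in> W \<Longrightarrow> R g * w \<in> W"
      and W0: "W \<noteq> {0}" and W1: "W \<noteq> {w. shaped n 1 w}" using f unfolding irr_rep_def by blast
    obtain k U V where U: "shaped n k U" and V: "shaped k n V" and VU: "V * U = ident k"
      and UW: "\<And>x. shaped k 1 x \<Longrightarrow> U * x \<in> W" and WU: "\<And>w. w \<in> W \<Longrightarrow> U * (V * w) = w"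
      using col_subspace_projection[OF W] by meson
    define E where "E = U * V"
    have E: "shaped n n E" "E * E = E" using U V VU
       apply (auto simp: E_def) by (metis mult.assoc shaped_right)
    have EU: "E * U = U" using U VU by (simp add: E_def mult.assoc shaped_right)
    have VE: "V * E = V" using V VU by (simp add: E_def mult.assoc[symmetric] shaped_left)
    have EW: "w \<in> W \<Longrightarrow> E * w = w" for w using WU by (simp add: E_def mult.assoc)
    have ERU: "E * (R g * U) = R g * U" if g: "g \<in> carrier G" for g
    proof (rule cols_eqI[of n k])
      fix j assume "j < k"
      then have "U * munit j 0 \<in> W" by (intro UW shaped_munit) auto
      then have "R g * (U * munit j 0) \<in> W" using inv g by blast
      from EW[OF this] show "E * (R g * U) * munit j 0 = R g * U * munit j 0" by (simp add: mult.assoc)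
    qed (use E U rep_shaped[OF f g] in auto)
    define F where "F = ident n - E"
    have F: "shaped n n F" "F * F = F" "E * F = 0" "F * E = 0" "E + F = ident n" unfolding F_def using E
      by (auto simp: algebra_simps shaped_left shaped_right)
    obtain l U' V' where U': "shaped n l U'" and V': "shaped l n V'" and VU': "V' * U' = ident l" and UV': "U' * V' = F"
      using idempotent_factor[OF F(1,2)] by blast
    have FU': "F * U' = U'" using U' VU' by (simp add: UV'[symmetric] mult.assoc shaped_right)
    have VF': "V' * F = V'" using V' VU' by (simp add: UV'[symmetric] mult.assoc[symmetric] shaped_left)
    have "(of_nat n :: complex) = tr (U * V) + tr (U' * V')" using F(5) UV' tr_ident[of n] tr_add[of E F]
      by (simp add: E_def)
    also have "\<dots> = of_nat k + of_nat l" using VU VU' tr_comm[of U V] tr_comm[of U' V'] by simp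
    finally have nkl: "n = k + l" by (metis of_nat_add of_nat_eq_iff)
    have "k \<noteq> 0"
    proof
      assume "k = 0"
      then have "w = 0" if "w \<in> W" for w using WU[OF that] shaped_right[OF U] by (metis ident_0 mult_zero_left mult_zero_right)
      then show False using W0 W by (auto simp: col_subspace_def)
    qed
    have "l \<noteq> 0"
    proof
      assume "l = 0"
      then have "F = 0" using UV' shaped_right[OF U'] by (metis ident_0 mult_zero_left mult_zero_right)
      then have E1: "E = ident n" using F(5) by simp
      have "w \<in> W" if w: "shaped n 1 w" for w
      proof -
        have "U * (V * w) \<in> W" by (rule UW) (use V w in blast)
        then show ?thesis using E1 shaped_left[OF w] by (metis E_def mult.assoc)
      qed
      then show False using W1 W by (auto simp: col_subspace_def)
    qed
    define A where "A g = V * R g * U" for g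
    define D where "D g = V' * R g * U'" for g
    have Rm: "R (g \<otimes> h) = R g * R h" if "g \<in> carrier G" "h \<in> carrier G" for g h
      using rep_mult[OF f that] .
    have fA: "rep G k A" unfolding rep_def
    proof (intro conjI ballI)
      show "A \<one> = ident k" using V VU by (simp add: A_def rep_one[OF f] shaped_right)
      fix g h assume gh: "g \<in> carrier G" "h \<in> carrier G"
      have "A g * A h = V * R g * (E * (R h * U))" by (simp add: A_def E_def mult.assoc)
      then show "A (g \<otimes> h) = A g * A h" using ERU gh by (simp add: A_def Rm mult.assoc)
    qed
    have fD: "rep G l D" unfolding rep_def
    proof (intro conjI ballI)
      show "D \<one> = ident l" using V' VU' by (simp add: D_def rep_one[OF f] shaped_right)
      fix g h assume gh: "g \<in> carrier G" "h \<in> carrier G"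
      have "V' * (R g * E) = V' * F * (E * (R g * U)) * V"
        by (simp add: VF' ERU gh) (simp add: E_def mult.assoc)
      also have "\<dots> = V' * (F * E) * (R g * U * V)" by (simp add: mult.assoc)
      finally have z: "V' * (R g * E) = 0" by (simp add: F)
      have "D (g \<otimes> h) = V' * R g * ((E + F) * R h) * U'"
        using shaped_left[OF rep_shaped[OF f gh(2)]] gh by (simp add: F(5) D_def Rm mult.assoc)
      also have "\<dots> = V' * (R g * E) * R h * U' + V' * R g * F * R h * U'"
        by (simp only: distrib_left distrib_right mult.assoc)
      also have "\<dots> = D g * D h" by (simp add: z) (simp add: D_def UV'[symmetric] mult.assoc)
      finally show "D (g \<otimes> h) = D g * D h" .
    qed
    have kn: "k < n" "l < n" using nkl \<open>k \<noteq> 0\<close> \<open>l \<noteq> 0\<close> by auto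
    obtain L1 where L1: "\<forall>(m, S)\<in>set L1. irr_rep G m S"
      "\<forall>g\<in>carrier G. tr (A g) = (\<Sum>(m, S)\<leftarrow>L1. tr (S g))"
      using less.IH[OF kn(1) fA] by blast
    obtain L2 where L2: "\<forall>(m, S)\<in>set L2. irr_rep G m S"
      "\<forall>g\<in>carrier G. tr (D g) = (\<Sum>(m, S)\<leftarrow>L2. tr (S g))"
      using less.IH[OF kn(2) fD] by blast
    have "tr (R g) = tr (A g) + tr (D g)" if g: "g \<in> carrier G" for g
    proof -
      have "R g = R g * U * V + R g * U' * V'"
        using shaped_right[OF rep_shaped[OF f g]] F(5) UV' by (metis E_def distrib_left mult.assoc)
      then have "tr (R g) = tr (R g * U * V) + tr (R g * U' * V')" by (metis tr_add)
      then show ?thesis unfolding A_def D_def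
        using tr_comm[of "R g * U" V] tr_comm[of "R g * U'" V'] by (simp add: mult.assoc)
    qed
    then show ?thesis using L1 L2 by (intro exI[of _ "L1 @ L2"]) auto
  qed
qed

section \<open>Fixed points of p-groups and coset transversals\<close>

text \<open>
  By the orbit-stabilizer theorem an orbit that is not a fixed point has size divisible by \<open>p\<close>.
\<close>

lemma p_group_fixed_points:
  fixes K :: "('a, 'b) monoid_scheme" and act :: "'a \<Rightarrow> 'c \<Rightarrow> 'c"
  assumes K: "group K" and p: "prime p" and ord: "Coset.order K = p ^ m" and fin: "finite X"
    and closed: "\<And>k x. k \<in> carrier K \<Longrightarrow> x \<in> X \<Longrightarrow> act k x \<in> X"
    and one: "\<And>x. x \<in> X \<Longrightarrow> act \<one>\<^bsub>K\<^esub> x = x"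
    and mult: "\<And>k l x. k \<in> carrier K \<Longrightarrow> l \<in> carrier K \<Longrightarrow> x \<in> X \<Longrightarrow> act (k \<otimes>\<^bsub>K\<^esub> l) x = act k (act l x)"
  shows "[card {x \<in> X. \<forall>k\<in>carrier K. act k x = x} = card X] (mod p)"
proof -
  interpret K: group K by fact
  define \<phi> where "\<phi> k = restrict (act k) X" for k
  have bij: "bij_betw (act k) X X" if k: "k \<in> carrier K" for k
  proof (rule bij_betw_byWitness[of _ "act (inv\<^bsub>K\<^esub> k)"])
    show "\<forall>a\<in>X. act (inv\<^bsub>K\<^esub> k) (act k a) = a" "\<forall>a\<in>X. act k (act (inv\<^bsub>K\<^esub> k) a) = a"
      using k one mult[of "inv\<^bsub>K\<^esub> k" k] mult[of k "inv\<^bsub>K\<^esub> k"] by auto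
  qed (use closed k in auto)
  have "\<phi> \<in> hom K (BijGroup X)"
    unfolding hom_def BijGroup_def Bij_def \<phi>_def
    using bij closed mult
    by (auto simp: compose_def cong: bij_betw_cong)
  then interpret A: group_action K X \<phi>
    by (simp add: group_action_def group_hom_def group_hom_axioms_def K group_BijGroup)
  define Fix where "Fix = {x \<in> X. \<forall>k\<in>carrier K. act k x = x}"
  have conj_orbit: "orbit K \<phi> x = (\<lambda>k. act k x) ` carrier K" if "x \<in> X" for x
    using that by (auto simp: orbit_def \<phi>_def)
  have div: "card (orbit K \<phi> x) = 1 \<or> p dvd card (orbit K \<phi> x)" if "x \<in> X" for x
  proof -
    have "card (orbit K \<phi> x) dvd p ^ m" using A.orbit_stabilizer_theorem[OF that] ord by (metis dvd_triv_left)
    then obtain i where "card (orbit K \<phi> x) = p ^ i" using p divides_primepow_nat by blast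
    then show ?thesis by (cases i) auto
  qed
  have fix_iff: "x \<in> Fix \<longleftrightarrow> orbit K \<phi> x = {x}" if "x \<in> X" for x
  proof
    assume "x \<in> Fix"
    then have "(\<lambda>k. act k x) ` carrier K = (\<lambda>k. x) ` carrier K" by (intro image_cong) (auto simp: Fix_def)
    then show "orbit K \<phi> x = {x}" unfolding conj_orbit[OF that] using K.one_closed by auto
  next
    assume "orbit K \<phi> x = {x}"
    then have "act k x \<in> {x}" if "k \<in> carrier K" for k
      using that unfolding conj_orbit[OF \<open>x \<in> X\<close>] by blast
    then show "x \<in> Fix" using that by (simp add: Fix_def)
  qed
  have single: "card (orbit K \<phi> x) = 1 \<longleftrightarrow> x \<in> Fix" if x: "x \<in> X" for x
  proof
    assume "card (orbit K \<phi> x) = 1"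
    then obtain y where y: "orbit K \<phi> x = {y}" by (auto simp: card_1_singleton_iff)
    have "x \<in> orbit K \<phi> x" using x one[OF x] unfolding conj_orbit[OF x] by (metis K.one_closed image_eqI)
    then show "x \<in> Fix" using y fix_iff[OF x] by auto
  qed (use fix_iff[OF x] in auto)
  have cX: "card X = (\<Sum>O'\<in>orbits K X \<phi>. card O')"
    using A.disjoint_sum[OF fin, of "\<lambda>_. 1::nat"] by simp
  have fo: "finite (orbits K X \<phi>)" using fin by (simp add: orbits_def)
  define S1 where "S1 = {O' \<in> orbits K X \<phi>. card O' = 1}"
  have "S1 = (\<lambda>x. {x}) ` Fix"
  proof (intro equalityI subsetI)
    fix O' assume "O' \<in> S1"
    then obtain x where x: "x \<in> X" "O' = orbit K \<phi> x" "card O' = 1" by (auto simp: S1_def orbits_def)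
    then show "O' \<in> (\<lambda>x. {x}) ` Fix" using single fix_iff by blast
  next
    fix O' assume "O' \<in> (\<lambda>x. {x}) ` Fix"
    then obtain x where x: "x \<in> Fix" "O' = {x}" by auto
    then have "x \<in> X" by (simp add: Fix_def)
    then show "O' \<in> S1" using x fix_iff[of x] unfolding S1_def orbits_def by auto
  qed
  then have cF: "card S1 = card Fix" by (simp add: card_image)
  have "card X = (\<Sum>O'\<in>S1. card O') + (\<Sum>O'\<in>orbits K X \<phi> - S1. card O')"
    unfolding cX using sum.subset_diff[of S1 "orbits K X \<phi>" card] fo by (simp add: S1_def)
  also have "(\<Sum>O'\<in>S1. card O') = card Fix" using cF by (simp add: S1_def)
  finally have "card X = card Fix + (\<Sum>O'\<in>orbits K X \<phi> - S1. card O')" .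
  moreover have "p dvd (\<Sum>O'\<in>orbits K X \<phi> - S1. card O')"
    by (rule dvd_sum) (use div in \<open>auto simp: S1_def orbits_def\<close>)
  ultimately show ?thesis unfolding Fix_def[symmetric]
    by (auto simp: cong_def elim!: dvdE)
qed

context group
begin

text \<open>
  Each left coset of \<open>H\<close> that meets \<open>S\<close> contains exactly one element of \<open>T\<close>.  The set \<open>S\<close> is
  a parameter because transversals in subgroups are needed as well.
\<close>

definition transversal :: "'a set \<Rightarrow> 'a set \<Rightarrow> 'a set \<Rightarrow> bool" where
  "transversal S H T \<longleftrightarrow> T \<subseteq> S \<and> (\<forall>g\<in>S. \<exists>!t. t \<in> T \<and> inv t \<otimes> g \<in> H)"

definition coset_rep :: "'a set \<Rightarrow> 'a set \<Rightarrow> 'a \<Rightarrow> 'a" where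
  "coset_rep H T g = (THE t. t \<in> T \<and> inv t \<otimes> g \<in> H)"

lemma coset_rep:
  assumes "transversal S H T" "g \<in> S" shows "coset_rep H T g \<in> T" "inv (coset_rep H T g) \<otimes> g \<in> H"
proof -
  have "\<exists>!t. t \<in> T \<and> inv t \<otimes> g \<in> H" using assms by (auto simp: transversal_def)
  from theI'[OF this] show "coset_rep H T g \<in> T" "inv (coset_rep H T g) \<otimes> g \<in> H" by (auto simp: coset_rep_def)
qed

lemma coset_rep_eqI:
  assumes "transversal S H T" "g \<in> S" "t \<in> T" "inv t \<otimes> g \<in> H" shows "coset_rep H T g = t"
  using assms coset_rep[OF assms(1,2)] unfolding transversal_def by blast

lemma transversal_ex:
  assumes H: "subgroup H G" and S: "subgroup S G" and HS: "H \<subseteq> S"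
  shows "\<exists>T. transversal S H T"
proof -
  have car: "\<And>x. x \<in> S \<Longrightarrow> x \<in> carrier G" "\<And>x. x \<in> H \<Longrightarrow> x \<in> carrier G"
    using subgroup.subset[OF S] subgroup.subset[OF H] by auto
  define C where "C g = {x \<in> S. inv x \<otimes> g \<in> H}" for g
  define r where "r g = (SOME x. x \<in> C g)" for g
  have r: "r g \<in> C g" if "g \<in> S" for g
  proof -
    have "g \<in> C g" using that car(1) subgroup.one_closed[OF H] by (simp add: C_def)
    then show ?thesis unfolding r_def by (rule someI)
  qed
  have C_eq: "C g = C g'" if g: "g \<in> S" "g' \<in> S" "inv g \<otimes> g' \<in> H" for g g'
  proof -
    have "inv x \<otimes> g' = (inv x \<otimes> g) \<otimes> (inv g \<otimes> g')" "inv x \<otimes> g = (inv x \<otimes> g') \<otimes> inv (inv g \<otimes> g')" if "x \<in> S" for x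
    proof -
      have c: "x \<in> carrier G" "g \<in> carrier G" "g' \<in> carrier G" using car(1) g that by auto
      have "g \<otimes> (inv g \<otimes> g') = g'" "g' \<otimes> (inv g' \<otimes> g) = g" using c by (simp_all add: m_assoc[symmetric])
      then show "inv x \<otimes> g' = (inv x \<otimes> g) \<otimes> (inv g \<otimes> g')" "inv x \<otimes> g = (inv x \<otimes> g') \<otimes> inv (inv g \<otimes> g')"
        using c by (simp_all add: m_assoc inv_mult_group)
    qed
    then show ?thesis unfolding C_def using g subgroup.m_closed[OF H] subgroup.m_inv_closed[OF H]
      by (metis (no_types, lifting))
  qed
  have "transversal S H (r ` S)" unfolding transversal_def
  proof (intro conjI ballI)
    show "r ` S \<subseteq> S" using r by (auto simp: C_def)
    fix g assume g: "g \<in> S"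
    show "\<exists>!t. t \<in> r ` S \<and> inv t \<otimes> g \<in> H"
    proof (rule ex1I[of _ "r g"])
      show "r g \<in> r ` S \<and> inv (r g) \<otimes> g \<in> H" using r[OF g] g by (simp add: C_def)
      fix t assume t: "t \<in> r ` S \<and> inv t \<otimes> g \<in> H"
      then obtain g' where g': "g' \<in> S" "t = r g'" by auto
      then have tS: "t \<in> S" "inv t \<otimes> g' \<in> H" using r[OF g'(1)] by (auto simp: C_def)
      have "C t = C g" using C_eq[OF tS(1) g] t by blast
      moreover have "C t = C g'" using C_eq[OF tS(1) g'(1) tS(2)] .
      ultimately show "t = r g" unfolding g' r_def by simp
    qed
  qed
  then show ?thesis by blast
qed

lemma transversal_card:
  assumes H: "subgroup H G" and S: "subgroup S G" and HS: "H \<subseteq> S" and T: "transversal S H T"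
  shows "card S = card T * card H"
proof -
  have car: "\<And>x. x \<in> S \<Longrightarrow> x \<in> carrier G" "\<And>x. x \<in> H \<Longrightarrow> x \<in> carrier G"
    using subgroup.subset[OF S] subgroup.subset[OF H] by auto
  have TS: "T \<subseteq> S" using T by (simp add: transversal_def)
  have "bij_betw (\<lambda>(t, h). t \<otimes> h) (T \<times> H) S"
  proof (rule bij_betwI[of _ _ _ "\<lambda>g. (coset_rep H T g, inv (coset_rep H T g) \<otimes> g)"])
    show "(\<lambda>(t, h). t \<otimes> h) \<in> T \<times> H \<rightarrow> S" using TS HS subgroup.m_closed[OF S] by auto
    show "(\<lambda>g. (coset_rep H T g, inv (coset_rep H T g) \<otimes> g)) \<in> S \<rightarrow> T \<times> H" using coset_rep[OF T] by auto
    fix x assume x: "x \<in> T \<times> H"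
    then obtain t h where th: "x = (t, h)" "t \<in> T" "h \<in> H" by auto
    have "inv t \<otimes> (t \<otimes> h) = h" using th TS car by (simp add: subsetD m_assoc[symmetric])
    moreover have "t \<otimes> h \<in> S" using th TS HS subgroup.m_closed[OF S] by blast
    ultimately have "coset_rep H T (t \<otimes> h) = t" using coset_rep_eqI[OF T] th by simp
    then show "(\<lambda>g. (coset_rep H T g, inv (coset_rep H T g) \<otimes> g)) ((\<lambda>(t, h). t \<otimes> h) x) = x"
      using \<open>inv t \<otimes> (t \<otimes> h) = h\<close> th by simp
  next
    fix g assume g: "g \<in> S"
    have "coset_rep H T g \<in> carrier G" using coset_rep(1)[OF T g] TS car by blast
    then show "(\<lambda>(t, h). t \<otimes> h) (coset_rep H T g, inv (coset_rep H T g) \<otimes> g) = g"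
      using g car by (simp add: m_assoc[symmetric])
  qed
  from bij_betw_same_card[OF this] show ?thesis by (simp add: card_cartesian_product)
qed

lemma transversal_trans:
  assumes S: "subgroup S G" and H: "subgroup H G" and K: "subgroup K G" and HS: "H \<subseteq> S" "K \<subseteq> H"
    and T: "transversal S H T" and T': "transversal H K T'"
  shows "transversal S K ((\<lambda>(t, u). t \<otimes> u) ` (T \<times> T'))" and "inj_on (\<lambda>(t, u). t \<otimes> u) (T \<times> T')"
proof -
  have car: "\<And>x. x \<in> S \<Longrightarrow> x \<in> carrier G" "\<And>x. x \<in> H \<Longrightarrow> x \<in> carrier G"
    using subgroup.subset[OF S] subgroup.subset[OF H] by auto
  have sub: "T \<subseteq> S" "T' \<subseteq> H" using T T' by (auto simp: transversal_def)
  have c: "\<And>t. t \<in> T \<Longrightarrow> t \<in> carrier G" "\<And>t. t \<in> T' \<Longrightarrow> t \<in> carrier G" using sub car by auto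
  have u: "t = coset_rep H T g \<and> u = coset_rep K T' (inv t \<otimes> g)"
    if "t \<in> T" "u \<in> T'" "g \<in> S" "inv (t \<otimes> u) \<otimes> g \<in> K" for t u g
  proof -
    have e: "inv (t \<otimes> u) \<otimes> g = inv u \<otimes> (inv t \<otimes> g)"
      using that c car by (simp add: inv_mult_group m_assoc)
    have e2: "inv t \<otimes> g = u \<otimes> (inv u \<otimes> (inv t \<otimes> g))" using that c car by (simp add: m_assoc[symmetric])
    have "u \<otimes> (inv u \<otimes> (inv t \<otimes> g)) \<in> H"
      using that(2,4) sub HS(2) unfolding e by (intro subgroup.m_closed[OF H, of u]) blast+
    then have h: "inv t \<otimes> g \<in> H" using e2 by simp
    then have "t = coset_rep H T g" using coset_rep_eqI[OF T that(3,1)] by simp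
    moreover have "u = coset_rep K T' (inv t \<otimes> g)" using coset_rep_eqI[OF T' h that(2)] that(4) e by simp
    ultimately show ?thesis by simp
  qed
  show "inj_on (\<lambda>(t, u). t \<otimes> u) (T \<times> T')"
  proof (rule inj_onI)
    fix x y assume xy: "x \<in> T \<times> T'" "y \<in> T \<times> T'" "(\<lambda>(t, u). t \<otimes> u) x = (\<lambda>(t, u). t \<otimes> u) y"
    obtain t u t' u' where tu: "x = (t, u)" "y = (t', u')" by (metis surj_pair)
    define g where "g = t \<otimes> u"
    have m: "t \<in> T" "u \<in> T'" "t' \<in> T" "u' \<in> T'" "t' \<otimes> u' = g" using xy tu by (auto simp: g_def)
    have gS: "g \<in> S" unfolding g_def using m sub HS subgroup.m_closed[OF S] by blast
    have "inv (t \<otimes> u) \<otimes> g \<in> K" "inv (t' \<otimes> u') \<otimes> g \<in> K"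
      using m gS car subgroup.one_closed[OF K] by (simp_all add: g_def[symmetric])
    then show "x = y" using u[OF m(1,2) gS] u[OF m(3,4) gS] tu by auto
  qed
  show "transversal S K ((\<lambda>(t, u). t \<otimes> u) ` (T \<times> T'))" unfolding transversal_def
  proof (intro conjI ballI)
    show "(\<lambda>(t, u). t \<otimes> u) ` (T \<times> T') \<subseteq> S"
      using sub HS subgroup.m_closed[OF S] by (auto simp: subset_iff)
    fix g assume g: "g \<in> S"
    define t where "t = coset_rep H T g"
    define v where "v = coset_rep K T' (inv t \<otimes> g)"
    have t: "t \<in> T" "inv t \<otimes> g \<in> H" using coset_rep[OF T g] by (auto simp: t_def)
    have v: "v \<in> T'" "inv v \<otimes> (inv t \<otimes> g) \<in> K" using coset_rep[OF T' t(2)] by (auto simp: v_def)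
    show "\<exists>!w. w \<in> (\<lambda>(t, u). t \<otimes> u) ` (T \<times> T') \<and> inv w \<otimes> g \<in> K"
    proof (rule ex1I[of _ "t \<otimes> v"])
      have "inv (t \<otimes> v) \<otimes> g = inv v \<otimes> (inv t \<otimes> g)" using t v c g car by (simp add: inv_mult_group m_assoc)
      then show "t \<otimes> v \<in> (\<lambda>(t, u). t \<otimes> u) ` (T \<times> T') \<and> inv (t \<otimes> v) \<otimes> g \<in> K" using t v by auto
      fix w assume "w \<in> (\<lambda>(t, u). t \<otimes> u) ` (T \<times> T') \<and> inv w \<otimes> g \<in> K"
      then obtain t' u' where "t' \<in> T" "u' \<in> T'" "w = t' \<otimes> u'" "inv (t' \<otimes> u') \<otimes> g \<in> K" by auto
      then show "w = t \<otimes> v" using u[of t' u' g] g by (simp add: t_def v_def)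
    qed
  qed
qed

section \<open>Induced representations\<close>

definition lin_char :: "'a set \<Rightarrow> ('a \<Rightarrow> complex) \<Rightarrow> bool" where
  "lin_char H \<mu> \<longleftrightarrow> \<mu> \<one> = 1 \<and> (\<forall>x\<in>H. \<forall>y\<in>H. \<mu> (x \<otimes> y) = \<mu> x * \<mu> y)"

definition zero_ext :: "'a set \<Rightarrow> ('a \<Rightarrow> complex) \<Rightarrow> 'a \<Rightarrow> complex" where
  "zero_ext H \<mu> y = (if y \<in> H then \<mu> y else 0)"

definition ind_char :: "'a set \<Rightarrow> 'a set \<Rightarrow> ('a \<Rightarrow> complex) \<Rightarrow> 'a \<Rightarrow> complex" where
  "ind_char H T \<mu> g = (\<Sum>t\<in>T. zero_ext H \<mu> (inv t \<otimes> g \<otimes> t))"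

lemma zero_ext_mult_right:
  assumes "subgroup H G" "lin_char H \<mu>" "x \<in> carrier G" "y \<in> H"
  shows "zero_ext H \<mu> (x \<otimes> y) = zero_ext H \<mu> x * \<mu> y"
proof -
  have "x \<otimes> y \<in> H \<longleftrightarrow> x \<in> H"
  proof
    assume "x \<otimes> y \<in> H"
    then have "(x \<otimes> y) \<otimes> inv y \<in> H"
      using subgroup.m_closed[OF assms(1)] subgroup.m_inv_closed[OF assms(1,4)] by simp
    then show "x \<in> H" using assms subgroup.mem_carrier[OF assms(1,4)] by (simp add: m_assoc)
  next
    assume "x \<in> H" then show "x \<otimes> y \<in> H" using subgroup.m_closed[OF assms(1)] assms(4) by simp
  qed
  moreover have "x \<in> H \<Longrightarrow> \<mu> (x \<otimes> y) = \<mu> x * \<mu> y" using assms(2,4) by (simp add: lin_char_def)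
  ultimately show ?thesis unfolding zero_ext_def by (cases "x \<in> H") simp_all
qed

text \<open>
  The entry \<open>(s, t)\<close> of the matrix of \<open>g\<close>, with rows and columns indexed by the transversal, is the value of the linear
  character, extended by \<open>0\<close>, at \<open>s\<inverse> g t\<close>.  Each column has one nonzero entry, so a matrix product has
  at most one nonzero summand in each entry.
\<close>

lemma induced_rep:
  assumes H: "subgroup H G" and T: "transversal (carrier G) H T" and finT: "finite T" and l: "lin_char H \<mu>"
  shows "\<exists>R. rep G (card T) R \<and> (\<forall>g\<in>carrier G. tr (R g) = ind_char H T \<mu> g)"
proof -
  define r where "r = card T"
  obtain f where f: "bij_betw f {..<r} T"
    using ex_bij_betw_nat_finite[OF finT] by (auto simp: r_def lessThan_atLeast0)
  have fT: "f i \<in> T" if "i < r" for i using f that by (auto simp: bij_betw_def)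
  have Tc: "T \<subseteq> carrier G" using T by (simp add: transversal_def)
  have fc: "f i \<in> carrier G" if "i < r" for i using fT[OF that] Tc by blast
  define R where "R g = (\<Sum>i<r. \<Sum>j<r. smul (zero_ext H \<mu> (inv (f i) \<otimes> g \<otimes> f j)) (munit i j))" for g
  have ent: "ent (R g) i j = (if i < r \<and> j < r then zero_ext H \<mu> (inv (f i) \<otimes> g \<otimes> f j) else 0)" for g i j
  proof -
    have "ent (R g) i j = (\<Sum>i'<r. \<Sum>j'<r. if j' = j then (if i' = i then zero_ext H \<mu> (inv (f i) \<otimes> g \<otimes> f j) else 0) else 0)"
      unfolding R_def ent_sum by (intro sum.cong refl) (auto simp: ent_munit)
    then show ?thesis by (cases "j < r"; cases "i < r") simp_all
  qed
  have b: "bounded r (R g)" for g by (auto simp: bounded_def ent)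
  have tr: "tr (R g) = ind_char H T \<mu> g" for g
  proof -
    have "tr (R g) = (\<Sum>i<r. zero_ext H \<mu> (inv (f i) \<otimes> g \<otimes> f i))" by (simp add: tr_bounded[OF b] ent)
    also have "\<dots> = ind_char H T \<mu> g" unfolding ind_char_def
      by (rule sum.reindex_bij_betw[OF f, of "\<lambda>t. zero_ext H \<mu> (inv t \<otimes> g \<otimes> t)"])
    finally show ?thesis .
  qed
  have "rep G r R" unfolding rep_def
  proof (intro conjI ballI)
    show "R \<one> = ident r"
    proof (rule fmat_eqI)
      fix i j
      have "inv (f i) \<otimes> \<one> \<otimes> f j \<in> H \<longleftrightarrow> i = j" if "i < r" "j < r"
      proof
        assume "inv (f i) \<otimes> \<one> \<otimes> f j \<in> H"
        then have "coset_rep H T (f j) = f i" using that fT fc by (intro coset_rep_eqI[OF T]) auto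
        moreover have "coset_rep H T (f j) = f j" using that fT fc subgroup.one_closed[OF H] by (intro coset_rep_eqI[OF T]) auto
        ultimately show "i = j" using f that by (auto simp: bij_betw_def inj_on_def)
      qed (use fc that subgroup.one_closed[OF H] in auto)
      then show "ent (R \<one>) i j = ent (ident r) i j" using l fc by (auto simp: ent ent_ident zero_ext_def lin_char_def)
    qed
    fix g h assume gh: "g \<in> carrier G" "h \<in> carrier G"
    show "R (g \<otimes> h) = R g * R h"
    proof (rule fmat_eqI)
      fix i k
      show "ent (R (g \<otimes> h)) i k = ent (R g * R h) i k"
      proof (cases "i < r \<and> k < r")
        case False
        then show ?thesis unfolding ent_mult_bounded[OF disjI1[OF b]] by (auto simp: ent)
      next
        case True
        define x where "x = h \<otimes> f k"
        have x: "x \<in> carrier G" using gh fc True by (simp add: x_def)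
        obtain j0 where j0: "j0 < r" "f j0 = coset_rep H T x"
          using coset_rep(1)[OF T x] f by (auto simp: bij_betw_def)
        then have j0H: "inv (f j0) \<otimes> x \<in> H" using coset_rep(2)[OF T x] by simp
        have z: "zero_ext H \<mu> (inv (f j) \<otimes> h \<otimes> f k) = 0" if "j < r" "j \<noteq> j0" for j
        proof -
          have "inv (f j) \<otimes> x \<notin> H"
          proof
            assume "inv (f j) \<otimes> x \<in> H"
            then have "f j = f j0" using coset_rep_eqI[OF T x fT[OF that(1)]] j0(2) by metis
            then show False using f that j0 by (auto simp: bij_betw_def inj_on_def)
          qed
          then show ?thesis using fc that True gh by (simp add: x_def zero_ext_def m_assoc)
        qed
        have "ent (R g * R h) i k = (\<Sum>j<r. zero_ext H \<mu> (inv (f i) \<otimes> g \<otimes> f j) * zero_ext H \<mu> (inv (f j) \<otimes> h \<otimes> f k))"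
          unfolding ent_mult_bounded[OF disjI1[OF b]] using True by (simp add: ent)
        also have "\<dots> = zero_ext H \<mu> (inv (f i) \<otimes> g \<otimes> f j0) * zero_ext H \<mu> (inv (f j0) \<otimes> h \<otimes> f k)"
          using j0 z by (subst sum.remove[of _ j0]) (auto intro!: sum.neutral)
        also have "inv (f j0) \<otimes> h \<otimes> f k = inv (f j0) \<otimes> x" using fc j0(1) True gh by (simp add: x_def m_assoc)
        also have "zero_ext H \<mu> (inv (f j0) \<otimes> x) = \<mu> (inv (f j0) \<otimes> x)" using j0H by (simp add: zero_ext_def)
        also have "zero_ext H \<mu> (inv (f i) \<otimes> g \<otimes> f j0) * \<mu> (inv (f j0) \<otimes> x)
            = zero_ext H \<mu> ((inv (f i) \<otimes> g \<otimes> f j0) \<otimes> (inv (f j0) \<otimes> x))"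
          using fc j0(1) True gh j0H by (intro zero_ext_mult_right[OF H l, symmetric]) auto
        also have "(inv (f i) \<otimes> g \<otimes> f j0) \<otimes> (inv (f j0) \<otimes> x) = inv (f i) \<otimes> (g \<otimes> h) \<otimes> f k"
        proof -
          have "f j0 \<otimes> (inv (f j0) \<otimes> x) = x" using fc j0(1) x by (simp add: m_assoc[symmetric])
          then show ?thesis using fc j0(1) True gh x by (simp add: m_assoc) (simp add: x_def)
        qed
        finally show ?thesis using True by (simp add: ent)
      qed
    qed
  qed
  then show ?thesis using tr by (auto simp: r_def)
qed

end

section \<open>Monomiality of p-groups\<close>

lemma sum_root_of_unity:
  fixes z :: complex
  assumes "z ^ N = 1" shows "(\<Sum>s<N. z ^ s) = (if z = 1 then of_nat N else 0)"
proof (cases "z = 1")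
  case False
  have "(1 - z) * (\<Sum>s<N. z ^ s) = 1 - z ^ N" by (rule one_diff_power_eq[symmetric])
  then show ?thesis using assms False by simp
qed simp

text \<open>
  The trace of an idempotent is its rank.  Rank one shows up here in the form that the corner \<open>E M E\<close> is one-dimensional;
  comparing an entry and the trace of \<open>E E\<^sub>i\<^sub>j E\<close> gives the value.
\<close>

lemma idempotent_one_dim_tr:
  assumes E: "shaped n n E" "E * E = E" "E \<noteq> 0"
    and one: "\<And>A. shaped n n A \<Longrightarrow> \<exists>c. E * A * E = smul c E"
  shows "tr E = 1"
proof -
  obtain j i where ji: "ent E j i \<noteq> 0" using E(3) fmat_eqI[of E 0] by auto
  then have lt: "j < n" "i < n" using E(1) by (auto simp: shaped_iff not_le[symmetric])
  obtain c where c: "E * munit i j * E = smul c E" using one[OF shaped_munit[OF lt(2,1)]] by blast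
  obtain N where N: "bounded N E" using bounded_ex by blast
  have jN: "j < N" using boundedD[OF N, of j i] ji by (auto simp: not_le[symmetric])
  have "ent (E * munit i j * E) j i = (\<Sum>k<N. if k = j then ent E j i * ent E j i else 0)"
    unfolding ent_mult_bounded[OF disjI2[OF N]] by (rule sum.cong) (auto simp: ent_mult_munit)
  then have "ent (E * munit i j * E) j i = ent E j i * ent E j i" using jN by simp
  then have "c * ent E j i = ent E j i * ent E j i" by (simp only: c ent_smul)
  then have cE: "c = ent E j i" using ji by auto
  have "c * tr E = tr (E * munit i j * E)" using c by simp
  also have "\<dots> = tr (munit i j * (E * E))" by (subst mult.assoc, subst tr_comm) (simp add: mult.assoc)
  also have "\<dots> = tr (munit i j * E)" by (simp add: E(2))
  also have "\<dots> = c"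
  proof -
    have "bounded (max N (Suc i)) (munit i j * E)"
      using boundedD[OF N] by (auto simp: bounded_def ent_munit_mult)
    then have "tr (munit i j * E) = (\<Sum>k<max N (Suc i). ent (munit i j * E) k k)" by (rule tr_bounded)
    also have "\<dots> = (\<Sum>k<max N (Suc i). if k = i then ent E j i else 0)"
      by (rule sum.cong) (auto simp: ent_munit_mult)
    finally have "tr (munit i j * E) = (\<Sum>k<max N (Suc i). if k = i then ent E j i else 0)" .
    then show ?thesis by (simp add: cE)
  qed
  finally show ?thesis using cE ji by simp
qed

locale fin_group = group G for G (structure) +
  assumes fin: "finite (carrier G)"
begin

text \<open>
  A system of imprimitivity in terms of a projection: the space is the direct sum of the translates \<open>t V\<close>, for \<open>t \<in> T\<close>,
  of the range \<open>V\<close> of \<open>E\<close>, and \<open>H\<close> is the stabilizer of \<open>V\<close>.  The condition \<open>E * R x * E = 0\<close> says that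
  the translate by \<open>x\<close> has no component in \<open>V\<close>.
\<close>
definition imprimitivity :: "nat \<Rightarrow> ('a \<Rightarrow> fmat) \<Rightarrow> 'a set \<Rightarrow> 'a set \<Rightarrow> fmat \<Rightarrow> bool" where
  "imprimitivity n R H T E \<longleftrightarrow> subgroup H G \<and> transversal (carrier G) H T \<and> shaped n n E \<and> E \<noteq> 0 \<and> E * E = E \<and>
     (\<forall>h\<in>H. R h * E = E * R h) \<and> (\<forall>x\<in>carrier G - H. E * R x * E = 0) \<and>
     (\<Sum>t\<in>T. R t * E * R (inv t)) = ident n"

text \<open>
  Schur's lemma descends to the block: summing the conjugates of \<open>X\<close> over the transversal yields a
  matrix that commutes with the whole group and hence is scalar; cutting it down by \<open>E\<close> gives back \<open>X\<close>.
\<close>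

lemma imprimitivity_schur:
  assumes R: "irr_rep G n R" and I: "imprimitivity n R H T E"
    and X: "E * X = X" "X * E = X" "\<And>h. h \<in> H \<Longrightarrow> R h * X = X * R h"
  shows "\<exists>c. X = smul c E"
proof -
  have f: "rep G n R" using R by (simp add: irr_rep_def)
  have H: "subgroup H G" and T: "transversal (carrier G) H T" and E: "shaped n n E" "E * E = E"
    and EH: "\<And>h. h \<in> H \<Longrightarrow> R h * E = E * R h" and Ex: "\<And>x. x \<in> carrier G - H \<Longrightarrow> E * R x * E = 0"
    using I by (auto simp: imprimitivity_def)
  have Tc: "\<And>t. t \<in> T \<Longrightarrow> t \<in> carrier G" using T by (auto simp: transversal_def)
  have Hc: "\<And>t. t \<in> H \<Longrightarrow> t \<in> carrier G" using subgroup.subset[OF H] by auto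
  have finT: "finite T" using Tc fin by (metis finite_subset subsetI)
  have Xs: "shaped n n X"
    using E X by (metis shaped_def mult.assoc)
  define Y where "Y = (\<Sum>t\<in>T. R t * X * R (inv t))"
  have Ys: "shaped n n Y" unfolding Y_def using Tc rep_shaped[OF f] Xs by (intro shaped_sum shaped_mult[of n n _ n]) auto
  have comm: "R g * Y = Y * R g" if g: "g \<in> carrier G" for g
  proof -
    define \<pi> where "\<pi> g t = coset_rep H T (g \<otimes> t)" for g t
    have \<pi>: "\<pi> g t \<in> T" "inv (\<pi> g t) \<otimes> (g \<otimes> t) \<in> H" if "g \<in> carrier G" "t \<in> T" for g t
      using coset_rep[OF T, of "g \<otimes> t"] that Tc by (auto simp: \<pi>_def)
    have inv: "\<pi> (inv g) (\<pi> g t) = t" if "g \<in> carrier G" "t \<in> T" for g t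
    proof -
      have c: "g \<in> carrier G" "t \<in> carrier G" "\<pi> g t \<in> carrier G" using that \<pi>(1) Tc by auto
      have "inv (inv (\<pi> g t) \<otimes> (g \<otimes> t)) \<in> H" using \<pi>(2)[OF that] subgroup.m_inv_closed[OF H] by blast
      moreover have "inv (inv (\<pi> g t) \<otimes> (g \<otimes> t)) = inv t \<otimes> (inv g \<otimes> \<pi> g t)"
        using c by (simp add: inv_mult_group m_assoc)
      ultimately show ?thesis using c that by (subst \<pi>_def) (intro coset_rep_eqI[OF T], auto)
    qed
    have step: "R g * (R t * X * R (inv t)) = R (\<pi> g t) * X * R (inv (\<pi> g t)) * R g" if t: "t \<in> T" for t
    proof -
      define u where "u = \<pi> g t"
      define h where "h = inv u \<otimes> (g \<otimes> t)"
      have h: "h \<in> H" using \<pi>(2)[OF g t] by (simp add: h_def u_def)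
      have c: "t \<in> carrier G" "u \<in> carrier G" "h \<in> carrier G" using t \<pi>(1)[OF g t] Tc h Hc by (auto simp: u_def)
      have 1: "g \<otimes> t = u \<otimes> h" using c g by (simp add: h_def m_assoc[symmetric])
      have "h \<otimes> inv t = inv u \<otimes> (g \<otimes> (t \<otimes> inv t))" using c g unfolding h_def by (simp only: m_assoc inv_closed m_closed)
      then have 2: "h \<otimes> inv t = inv u \<otimes> g" using c g by simp
      have "R g * (R t * X * R (inv t)) = R (g \<otimes> t) * X * R (inv t)"
        using c g by (simp add: rep_mult[OF f] mult.assoc)
      also have "\<dots> = R u * (R h * X) * R (inv t)" using c unfolding 1 by (simp add: rep_mult[OF f] mult.assoc)
      also have "\<dots> = R u * X * R (h \<otimes> inv t)" using c by (simp add: X(3)[OF h] rep_mult[OF f] mult.assoc)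
      also have "\<dots> = R u * X * R (inv u) * R g" using c g unfolding 2 by (simp add: rep_mult[OF f] mult.assoc)
      finally show ?thesis by (simp add: u_def)
    qed
    have "R g * Y = (\<Sum>t\<in>T. R (\<pi> g t) * X * R (inv (\<pi> g t)) * R g)"
      unfolding Y_def sum_distrib_left by (rule sum.cong) (auto simp: step)
    also have "\<dots> = (\<Sum>t\<in>T. R t * X * R (inv t) * R g)"
    proof (rule sum.reindex_bij_witness[of _ "\<pi> (inv g)" "\<pi> g"])
      fix t assume t: "t \<in> T"
      show "\<pi> (inv g) (\<pi> g t) = t" using inv[OF g t] .
      show "\<pi> g (\<pi> (inv g) t) = t" using inv[of "inv g" t] g t by simp
      show "\<pi> g t \<in> T" "\<pi> (inv g) t \<in> T" using \<pi>(1) g t by auto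
    qed simp
    finally show ?thesis by (simp add: Y_def sum_distrib_right)
  qed
  obtain c where c: "Y = smul c (ident n)" using irr_rep_scalar[OF R Ys comm] by blast
  define t0 where "t0 = coset_rep H T \<one>"
  have t0: "t0 \<in> T" "inv t0 \<otimes> \<one> \<in> H" using coset_rep[OF T, of \<one>] by (auto simp: t0_def)
  then have t0H: "inv t0 \<in> H" "t0 \<in> H" using Tc[OF t0(1)] subgroup.m_inv_closed[OF H, of "inv t0"] by auto
  have z: "E * (R t * X * R (inv t)) * E = 0" if t: "t \<in> T - {t0}" for t
  proof -
    have "t \<notin> H"
    proof
      assume "t \<in> H"
      then have "inv t \<otimes> \<one> \<in> H" using subgroup.m_inv_closed[OF H] Tc t by auto
      then have "t0 = t" using t coset_rep_eqI[OF T] by (auto simp: t0_def)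
      then show False using t by auto
    qed
    then have "E * R t * E = 0" using Ex Tc t by auto
    moreover have "E * (R t * X * R (inv t)) * E = (E * R t * E) * X * R (inv t) * E"
      using X(1) by (simp add: mult.assoc)
    ultimately show ?thesis by simp
  qed
  have "E * Y * E = (\<Sum>t\<in>T. E * (R t * X * R (inv t)) * E)"
    by (simp add: Y_def sum_distrib_left sum_distrib_right)
  also have "\<dots> = E * (R t0 * X * R (inv t0)) * E"
    using t0(1) finT z by (subst sum.remove[of _ t0]) auto
  also have "\<dots> = E * X * (R t0 * R (inv t0)) * E"
    by (simp add: X(3)[OF t0H(2)] mult.assoc)
  also have "R t0 * R (inv t0) = ident n"
    using Tc[OF t0(1)] by (simp flip: rep_mult[OF f] rep_one[OF f])
  also have "E * X * ident n * E = X" using X Xs by (simp add: shaped_right)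
  finally have "E * Y * E = X" .
  moreover have "E * Y * E = smul c E" unfolding c using E by (simp add: smul_mult shaped_right)
  ultimately show ?thesis by metis
qed

lemma subgroup_order:
  assumes "subgroup H G" "prime p" "Coset.order G = p ^ m"
  shows "\<exists>i. card H = p ^ i"
proof -
  have "card H dvd p ^ m" using lagrange[OF assms(1)] assms(3) by (metis dvd_triv_right)
  then show ?thesis using assms(2) divides_primepow_nat by blast
qed

lemma subgroup_fin: "subgroup H G \<Longrightarrow> finite H"
  using subgroup.subset fin finite_subset by metis

text \<open>
  The quotient \<open>H/Z\<close> is a nontrivial p-group, so it has a nontrivial central element: \<open>H\<close> acts by conjugation on the
  cosets of \<open>Z\<close>, represented by a transversal, the coset of \<open>\<one>\<close> is fixed, and the number of fixed
  points is divisible by \<open>p\<close>.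
\<close>

lemma central_mod_normal:
  assumes p: "prime p" "Coset.order G = p ^ m" and H: "subgroup H G" and Z: "subgroup Z G" "Z \<subset> H"
    and norm: "\<And>h z. h \<in> H \<Longrightarrow> z \<in> Z \<Longrightarrow> h \<otimes> z \<otimes> inv h \<in> Z"
  shows "\<exists>a\<in>H - Z. \<forall>h\<in>H. inv a \<otimes> (h \<otimes> a \<otimes> inv h) \<in> Z"
proof -
  have car: "\<And>x. x \<in> H \<Longrightarrow> x \<in> carrier G" "\<And>x. x \<in> Z \<Longrightarrow> x \<in> carrier G"
    using subgroup.subset[OF H] subgroup.subset[OF Z(1)] by auto
  have ZH: "Z \<subseteq> H" using Z by auto
  obtain T where T: "transversal H Z T" using transversal_ex[OF Z(1) H ZH] by blast
  have TH: "T \<subseteq> H" using T by (simp add: transversal_def)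
  have finT: "finite T" using TH subgroup_fin[OF H] finite_subset by blast
  have mH: "\<And>x y. x \<in> H \<Longrightarrow> y \<in> H \<Longrightarrow> x \<otimes> y \<in> H" "\<And>x. x \<in> H \<Longrightarrow> inv x \<in> H" "\<one> \<in> H"
    using subgroup.m_closed[OF H] subgroup.m_inv_closed[OF H] subgroup.one_closed[OF H] by auto
  have pT: "p dvd card T"
  proof -
    obtain i j where ij: "card H = p ^ i" "card Z = p ^ j" using subgroup_order[OF H p] subgroup_order[OF Z(1) p] by blast
    have *: "card H = card T * card Z" by (rule transversal_card[OF Z(1) H ZH T])
    have "card T dvd p ^ i" using * ij by (metis dvd_triv_left)
    then obtain k where k: "card T = p ^ k" using p divides_primepow_nat by blast
    have "card Z < card H" using Z(2) subgroup_fin[OF H] psubset_card_mono by blast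
    then have "k \<noteq> 0" using * k by (cases k) auto
    then show ?thesis using k by simp
  qed
  define act where "act h t = coset_rep Z T (h \<otimes> t \<otimes> inv h)" for h t
  have act: "act h t \<in> T" "inv (act h t) \<otimes> (h \<otimes> t \<otimes> inv h) \<in> Z" if "h \<in> H" "t \<in> T" for h t
    using coset_rep[OF T, of "h \<otimes> t \<otimes> inv h"] that TH mH by (auto simp: act_def)
  have "[card {x \<in> T. \<forall>k\<in>carrier (G\<lparr>carrier := H\<rparr>). act k x = x} = card T] (mod p)"
  proof (rule p_group_fixed_points[OF _ p(1)])
    show "group (G\<lparr>carrier := H\<rparr>)" using subgroup_imp_group[OF H] .
    show "Coset.order (G\<lparr>carrier := H\<rparr>) = p ^ (SOME i. card H = p ^ i)"
      using someI_ex[OF subgroup_order[OF H p]] by (simp add: Coset.order_def)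
    show "finite T" by fact
    fix k x assume kx: "k \<in> carrier (G\<lparr>carrier := H\<rparr>)" "x \<in> T"
    then show "act k x \<in> T" using act by simp
  next
    fix x assume x: "x \<in> T"
    then have "x \<in> carrier G" "x \<in> H" using TH car by auto
    then show "act \<one>\<^bsub>G\<lparr>carrier := H\<rparr>\<^esub> x = x" unfolding act_def using x subgroup.one_closed[OF Z(1)]
      by (intro coset_rep_eqI[OF T]) auto
  next
    fix k l x assume "k \<in> carrier (G\<lparr>carrier := H\<rparr>)" "l \<in> carrier (G\<lparr>carrier := H\<rparr>)" and x: "x \<in> T"
    then have kl: "k \<in> H" "l \<in> H" by auto
    define y where "y = act l x"
    define w where "w = act k y"
    define z where "z = inv y \<otimes> (l \<otimes> x \<otimes> inv l)"
    have y: "y \<in> T" "z \<in> Z" using act[OF kl(2) x] by (auto simp: y_def z_def)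
    have w: "w \<in> T" "inv w \<otimes> (k \<otimes> y \<otimes> inv k) \<in> Z" using act[OF kl(1) y(1)] by (auto simp: w_def)
    have c: "k \<in> carrier G" "l \<in> carrier G" "x \<in> carrier G" "y \<in> carrier G" "w \<in> carrier G" "z \<in> carrier G"
      using kl x y w car TH by auto
    have e: "l \<otimes> x \<otimes> inv l = y \<otimes> z" using c by (simp add: z_def m_assoc[symmetric])
    have "(k \<otimes> l) \<otimes> x \<otimes> inv (k \<otimes> l) = k \<otimes> (l \<otimes> x \<otimes> inv l) \<otimes> inv k"
      using c by (simp add: inv_mult_group m_assoc)
    also have "\<dots> = k \<otimes> y \<otimes> (inv k \<otimes> k) \<otimes> z \<otimes> inv k" unfolding e using c by (simp add: m_assoc)
    also have "\<dots> = (k \<otimes> y \<otimes> inv k) \<otimes> (k \<otimes> z \<otimes> inv k)" using c by (simp only: m_assoc inv_closed m_closed)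
    finally have "inv w \<otimes> ((k \<otimes> l) \<otimes> x \<otimes> inv (k \<otimes> l)) = (inv w \<otimes> (k \<otimes> y \<otimes> inv k)) \<otimes> (k \<otimes> z \<otimes> inv k)"
      using c by (simp only: m_assoc inv_closed m_closed)
    also have "\<dots> \<in> Z" using w(2) norm[OF kl(1) y(2)] subgroup.m_closed[OF Z(1)] by blast
    finally have "act (k \<otimes> l) x = w" unfolding act_def using kl x TH mH w
      by (intro coset_rep_eqI[OF T]) auto
    then show "act (k \<otimes>\<^bsub>G\<lparr>carrier := H\<rparr>\<^esub> l) x = act k (act l x)" by (simp add: w_def y_def)
  qed
  then have "p dvd card {x \<in> T. \<forall>k\<in>H. act k x = x}" using pT by (auto simp: cong_dvd_iff)
  moreover define t0 where "t0 = coset_rep Z T \<one>"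
  have t0: "t0 \<in> T" "inv t0 \<otimes> \<one> \<in> Z" using coset_rep[OF T, of \<one>] mH by (auto simp: t0_def)
  have t0Z: "t0 \<in> Z"
    using t0 TH car subgroup.m_inv_closed[OF Z(1), of "inv t0"] by (auto simp: subsetD)
  have ft0: "act k t0 = t0" if k: "k \<in> H" for k
  proof -
    have "inv t0 \<otimes> (k \<otimes> t0 \<otimes> inv k) \<in> Z"
      using norm[OF k t0Z] t0Z subgroup.m_closed[OF Z(1)] subgroup.m_inv_closed[OF Z(1)] by blast
    then show ?thesis unfolding act_def using t0(1) k TH mH by (intro coset_rep_eqI[OF T]) auto
  qed
  ultimately have "\<exists>a\<in>{x \<in> T. \<forall>k\<in>H. act k x = x}. a \<noteq> t0"
  proof -
    assume d: "p dvd card {x \<in> T. \<forall>k\<in>H. act k x = x}"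
    show ?thesis
    proof (rule ccontr)
      assume "\<not> ?thesis"
      then have "{x \<in> T. \<forall>k\<in>H. act k x = x} = {t0}" using t0 ft0 by auto
      then show False using d p(1) by simp
    qed
  qed
  then obtain a where a: "a \<in> T" "\<And>k. k \<in> H \<Longrightarrow> act k a = a" "a \<noteq> t0" by auto
  have "a \<notin> Z"
  proof
    assume "a \<in> Z"
    then have "inv a \<otimes> \<one> \<in> Z" using car subgroup.m_inv_closed[OF Z(1)] by simp
    then have "t0 = a" unfolding t0_def using a(1) mH by (intro coset_rep_eqI[OF T]) auto
    then show False using a(3) by simp
  qed
  moreover have "inv a \<otimes> (h \<otimes> a \<otimes> inv h) \<in> Z" if "h \<in> H" for h
    using act(2)[OF that a(1)] a(2)[OF that] by simp
  ultimately show ?thesis using a(1) TH by blast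
qed

end

lemma primitive_root_ex:
  assumes "0 < N"
  obtains \<zeta> :: complex where "\<zeta> ^ N = 1" "\<And>s. \<zeta> ^ s = 1 \<longleftrightarrow> N dvd s"
    "{z::complex. z ^ N = 1} = (\<lambda>j. \<zeta> ^ j) ` {..<N}"
proof -
  define \<zeta> where "\<zeta> = cis (2 * pi / real N)"
  have pow: "\<zeta> ^ k = cis (2 * pi * real k / real N)" for k
    by (simp add: \<zeta>_def DeMoivre mult_ac)
  have bij: "bij_betw (\<lambda>k. \<zeta> ^ k) {..<N} {z::complex. z ^ N = 1}"
    unfolding pow by (rule bij_betw_roots_unity[OF assms])
  have 1: "\<zeta> ^ N = 1" using assms by (simp add: pow)
  have "N dvd s" if "\<zeta> ^ s = 1" for s
  proof -
    have "\<zeta> ^ s = \<zeta> ^ (N * (s div N) + s mod N)" by simp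
    also have "\<dots> = \<zeta> ^ (s mod N)" unfolding power_add power_mult using 1 by simp
    finally have "\<zeta> ^ (s mod N) = \<zeta> ^ 0" using that by simp
    then have "s mod N = 0" using bij assms by (auto simp: bij_betw_def inj_on_def)
    then show ?thesis by auto
  qed
  moreover have "\<zeta> ^ s = 1" if "N dvd s" for s using that 1 by (auto simp: power_mult elim!: dvdE)
  ultimately have 2: "\<And>s. \<zeta> ^ s = 1 \<longleftrightarrow> N dvd s" by blast
  have 3: "{z::complex. z ^ N = 1} = (\<lambda>j. \<zeta> ^ j) ` {..<N}" using bij_betw_imp_surj_on[OF bij] by simp
  show ?thesis by (rule that[OF 1 2 3])
qed

context fin_group
begin

text \<open>
  If \<open>H\<close> does not act by scalars on the block, take \<open>a\<close> in \<open>H\<close> that is not scalar on the block but central modulo the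
  scalars.  Then \<open>R h * R a = c h * R a * R h\<close> on the block, for a linear character \<open>c\<close> of \<open>H\<close>.  It is not
  trivial, since otherwise \<open>R a\<close> would be scalar by \<open>imprimitivity_schur\<close>.  Let \<open>P \<mu>\<close> be the
  projection onto the eigenspace of \<open>R a\<close> for \<open>\<mu>\<close>, inside the block.  Elements \<open>h\<close> of \<open>H\<close> permute the eigenspaces by
  \<open>\<mu> \<mapsto> \<mu> / c h\<close>.  So an eigenspace is a block for the kernel \<open>K\<close> of \<open>c\<close>, and its translates fill the old block
  by \<open>imprimitivity_schur\<close> again.
\<close>

lemma imprimitivity_split:
  assumes p: "prime p" "Coset.order G = p ^ m"
    and R: "irr_rep G n R" and I: "imprimitivity n R H T E" and h0: "h0 \<in> H" "\<nexists>c. R h0 * E = smul c E"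
  shows "\<exists>K T' E'. imprimitivity n R K T' E' \<and> K \<subset> H"
proof -
  have f: "rep G n R" using R by (simp add: irr_rep_def)
  have H: "subgroup H G" and T: "transversal (carrier G) H T" and E: "shaped n n E" "E * E = E" "E \<noteq> 0"
    and EH: "\<And>h. h \<in> H \<Longrightarrow> R h * E = E * R h" and Ex: "\<And>x. x \<in> carrier G - H \<Longrightarrow> E * R x * E = 0"
    and ET: "(\<Sum>t\<in>T. R t * E * R (inv t)) = ident n"
    using I by (auto simp: imprimitivity_def)
  have Hc: "\<And>t. t \<in> H \<Longrightarrow> t \<in> carrier G" using subgroup.subset[OF H] by auto
  have Tc: "\<And>t. t \<in> T \<Longrightarrow> t \<in> carrier G" using T by (auto simp: transversal_def)
  have mH: "\<And>x y. x \<in> H \<Longrightarrow> y \<in> H \<Longrightarrow> x \<otimes> y \<in> H" "\<And>x. x \<in> H \<Longrightarrow> inv x \<in> H" "\<one> \<in> H"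
    using subgroup.m_closed[OF H] subgroup.m_inv_closed[OF H] subgroup.one_closed[OF H] by auto
  have Rm: "R (g \<otimes> h) = R g * R h" if "g \<in> H" "h \<in> H" for g h
    using rep_mult[OF f] that Hc by simp
  have Rinv: "R (inv g) * R g = ident n" "R g * R (inv g) = ident n" if "g \<in> carrier G" for g
    using that by (simp_all flip: rep_mult[OF f] rep_one[OF f])
  have ne: "R g * E \<noteq> 0" if "g \<in> carrier G" for g
  proof
    assume "R g * E = 0"
    then have "R (inv g) * R g * E = 0" by (simp add: mult.assoc)
    then show False using Rinv[OF that] E by (simp add: shaped_left)
  qed
  define Z where "Z = {h \<in> H. \<exists>c. R h * E = smul c E}"
  have Zsub: "subgroup Z G"
  proof (rule subgroupI)
    show "Z \<subseteq> carrier G" using Hc by (auto simp: Z_def)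
    have "R \<one> * E = smul 1 E" using E by (simp add: rep_one[OF f] shaped_left)
    then have "\<one> \<in> Z" using mH(3) unfolding Z_def by blast
    then show "Z \<noteq> {}" by blast
    fix x assume x: "x \<in> Z"
    then obtain c where c: "x \<in> H" "R x * E = smul c E" by (auto simp: Z_def)
    then have "c \<noteq> 0" using ne[of x] Hc by auto
    have "E = R (inv x) * R x * E" using Rinv(1)[of x] c(1) Hc E(1) by (simp add: shaped_left)
    then have "E = R (inv x) * (R x * E)" by (simp only: mult.assoc)
    then have "E = smul c (R (inv x) * E)" using c by (simp add: smul_mult)
    then have "smul (1 / c) E = R (inv x) * E" using \<open>c \<noteq> 0\<close> by (metis smul_smul smul_one nonzero_divide_eq_eq)
    then show "inv x \<in> Z" using c mH unfolding Z_def by (metis (mono_tags, lifting) mem_Collect_eq)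
    fix y assume "y \<in> Z"
    then obtain d where d: "y \<in> H" "R y * E = smul d E" by (auto simp: Z_def)
    have "R (x \<otimes> y) * E = smul (d * c) E" using c d by (simp add: Rm mult.assoc smul_mult)
    then show "x \<otimes> y \<in> Z" using c d mH by (auto simp: Z_def)
  qed
  have Znorm: "h \<otimes> z \<otimes> inv h \<in> Z" if h: "h \<in> H" and z: "z \<in> Z" for h z
  proof -
    obtain c where c: "z \<in> H" "R z * E = smul c E" using z by (auto simp: Z_def)
    have "R (h \<otimes> z \<otimes> inv h) = R h * R z * R (inv h)" using h c(1) mH by (simp add: Rm)
    then have "R (h \<otimes> z \<otimes> inv h) * E = R h * (R z * E) * R (inv h)"
      using EH[OF mH(2)[OF h]] by (simp only: mult.assoc)
    also have "\<dots> = smul c (R h * E * R (inv h))" by (simp only: c(2) smul_mult)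
    also have "\<dots> = smul c (E * (R h * R (inv h)))" by (simp only: EH[OF h] mult.assoc)
    finally have "R (h \<otimes> z \<otimes> inv h) * E = smul c E" using Rinv[of h] h Hc E by (simp add: shaped_right)
    then show ?thesis using h c mH by (auto simp: Z_def)
  qed
  have "h0 \<notin> Z" using h0(2) by (simp add: Z_def)
  moreover have "Z \<subseteq> H" by (auto simp: Z_def)
  ultimately have "Z \<subset> H" using h0(1) by blast
  then obtain a where a: "a \<in> H" "a \<notin> Z" "\<And>h. h \<in> H \<Longrightarrow> inv a \<otimes> (h \<otimes> a \<otimes> inv h) \<in> Z"
    using central_mod_normal[OF p H Zsub _ Znorm] by blast
  have "\<exists>c. R h * (R a * E) = smul c (R a * E * R h)" if h: "h \<in> H" for h
  proof -
    define z where "z = inv a \<otimes> (h \<otimes> a \<otimes> inv h)"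
    have "z \<in> Z" using a(3)[OF h] by (simp add: z_def)
    then obtain c where c: "z \<in> H" "R z * E = smul c E" by (auto simp: Z_def)
    have "h \<otimes> a = a \<otimes> (z \<otimes> h)"
    proof -
      have "a \<otimes> (z \<otimes> h) = (a \<otimes> inv a) \<otimes> (h \<otimes> a) \<otimes> (inv h \<otimes> h)"
        unfolding z_def using a(1) h Hc by (simp only: m_assoc inv_closed m_closed)
      then show ?thesis using a(1) h Hc by simp
    qed
    then have "R h * R a = R a * (R z * R h)" using a h c mH by (simp flip: Rm)
    then have "R h * (R a * E) = R a * (R z * E) * R h" using EH[OF h] by (metis mult.assoc)
    then show ?thesis by (auto simp: c smul_mult mult.assoc)
  qed
  then obtain c where c: "\<And>h. h \<in> H \<Longrightarrow> R h * (R a * E) = smul (c h) (R a * E * R h)" by metis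
  have aE0: "R a * E * R h \<noteq> 0" if h: "h \<in> H" for h
  proof -
    have "R (a \<otimes> h) * E = R a * E * R h" using Rm[OF a(1) h] EH[OF h] by (simp only: mult.assoc)
    then show ?thesis using ne[of "a \<otimes> h"] Hc[OF mH(1)[OF a(1) h]] by simp
  qed
  have aEs: "shaped n n (R a * E)" using rep_shaped[OF f Hc[OF a(1)]] E(1) by blast
  have c_mult: "c (h \<otimes> k) = c h * c k" if "h \<in> H" "k \<in> H" for h k
  proof -
    have "smul (c (h \<otimes> k)) (R a * E * R (h \<otimes> k)) = R h * (R k * (R a * E))"
      using c[of "h \<otimes> k"] that mH by (simp add: Rm mult.assoc)
    also have "\<dots> = smul (c k) (R h * (R a * E) * R k)" using c[of k] that by (simp add: smul_mult mult.assoc)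
    also have "\<dots> = smul (c h * c k) (R a * E * R (h \<otimes> k))"
      using c[of h] that by (simp add: smul_mult Rm mult.assoc mult.commute)
    finally show ?thesis using smul_cancel aE0 that mH by blast
  qed
  have c_one: "c \<one> = 1"
  proof -
    have "smul (c \<one>) (R a * E * R \<one>) = smul 1 (R a * E * R \<one>)"
      using c[OF mH(3)] by (simp add: rep_one[OF f] shaped_right[OF aEs] shaped_left[OF aEs])
    then show ?thesis using smul_cancel aE0 mH by blast
  qed
  define N where "N = card (carrier G)"
  have N_pos: "0 < N" unfolding N_def using fin by (auto simp: card_gt_0_iff)
  have powN: "x [^] N = \<one>" if "x \<in> carrier G" for x
    using pow_order_eq_1[OF that] by (simp add: N_def Coset.order_def)
  have powH: "x [^] s \<in> H" if "x \<in> H" for x and s :: nat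
    using that mH by (induction s) auto
  have c_root: "c h ^ N = 1" if "h \<in> H" for h
  proof -
    have "c (h [^] s) = c h ^ s" for s :: nat
      using that powH by (induction s) (auto simp: c_one c_mult)
    then show ?thesis using powN[of h] that Hc c_one by metis
  qed
  have c0: "c h \<noteq> 0" if "h \<in> H" for h using c_root[OF that] N_pos by (auto simp: zero_power)
  define A where "A s = R (a [^] s) * E" for s :: nat
  have Acomm: "R h * A s = smul (c h ^ s) (A s * R h)" if h: "h \<in> H" for h s
  proof (induction s)
    case 0
    show ?case using EH[OF h] by (simp add: A_def rep_one[OF f] shaped_left[OF E(1)])
  next
    case (Suc s)
    have as: "a [^] s \<in> H" "a [^] Suc s = a \<otimes> a [^] s"
      using powH a Hc nat_pow_Suc2[of a s] by auto
    have A': "A (Suc s) = R a * E * R (a [^] s)"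
      unfolding A_def as(2) Rm[OF a(1) as(1)] by (simp only: mult.assoc EH[OF as(1)])
    have "R h * A (Suc s) = smul (c h) (R a * E * R h * R (a [^] s))"
      unfolding A' using c[OF h] by (metis smul_mult_left mult.assoc)
    also have "R a * E * R h * R (a [^] s) = R a * (R h * A s)"
      unfolding A_def EH[OF as(1)] mult.assoc[symmetric] by (simp only: mult.assoc EH[OF h, unfolded mult.assoc])
    also have "smul (c h) (R a * (R h * A s)) = smul (c h ^ Suc s) (R a * A s * R h)"
      unfolding Suc.IH by (simp add: smul_mult mult.assoc)
    also have "R a * A s = A (Suc s)" using as a by (simp add: A_def Rm mult.assoc)
    finally show ?case .
  qed
  \<comment> \<open>As \<open>R a\<close> has order dividing \<open>N\<close>, this is the projection onto its eigenspace for \<open>\<mu>\<close> inside the block.\<close>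
  define P where "P \<mu> = smul (1 / of_nat N) (\<Sum>s<N. smul (inverse \<mu> ^ s) (A s))" for \<mu>
  have AE: "A s * E = A s" "E * A s = A s" for s
  proof -
    show "A s * E = A s" by (simp add: A_def mult.assoc E(2))
    have "E * A s = (E * R (a [^] s)) * E" by (simp add: A_def mult.assoc)
    also have "\<dots> = R (a [^] s) * (E * E)" by (simp only: EH[OF powH[OF a(1)], symmetric] mult.assoc)
    finally show "E * A s = A s" by (simp add: A_def E(2))
  qed
  have PE: "P \<mu> * E = P \<mu>" "E * P \<mu> = P \<mu>" for \<mu>
    by (simp_all add: P_def smul_mult sum_distrib_left sum_distrib_right AE)
  have Ps: "shaped n n (P \<mu>)" for \<mu> using PE E by (metis shaped_def mult.assoc)
  have Pcomm: "R h * P \<mu> = P (\<mu> / c h) * R h" if h: "h \<in> H" for h \<mu>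
    unfolding P_def using h
    by (simp add: smul_mult sum_distrib_left sum_distrib_right Acomm power_mult_distrib[symmetric] mult.commute
        field_class.field_divide_inverse)
  have Reig: "R a * P \<mu> = smul \<mu> (P \<mu>)" if \<mu>: "\<mu> ^ N = 1" for \<mu>
  proof -
    have \<mu>0: "\<mu> \<noteq> 0" using \<mu> N_pos by (auto simp: zero_power)
    define F where "F s = smul (inverse \<mu> ^ s) (A s)" for s
    have RA: "R a * A s = A (Suc s)" for s
      using powH[OF a(1)] a Hc nat_pow_Suc2[of a s] by (simp add: A_def mult.assoc[symmetric] flip: Rm)
    have "R a * F s = smul \<mu> (F (Suc s))" for s using \<mu>0 by (simp add: F_def smul_mult RA mult.assoc[symmetric])
    then have "R a * (\<Sum>s<N. F s) = smul \<mu> (\<Sum>s<N. F (Suc s))" by (simp add: sum_distrib_left smul_sum)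
    moreover have "(\<Sum>s<N. F (Suc s)) = (\<Sum>s<N. F s)"
    proof -
      have "F N = F 0" using powN[of a] a Hc \<mu> by (simp add: F_def A_def power_inverse)
      then show ?thesis using sum.lessThan_Suc_shift[of F N] by simp
    qed
    ultimately show ?thesis by (simp add: P_def F_def[symmetric] smul_mult mult.commute)
  qed
  have Aeig: "A s * P \<mu> = smul (\<mu> ^ s) (P \<mu>)" if \<mu>: "\<mu> ^ N = 1" for \<mu> s
  proof (induction s)
    case 0
    show ?case using E PE by (simp add: A_def rep_one[OF f] shaped_left)
  next
    case (Suc s)
    have "A (Suc s) = R a * A s"
      using powH[OF a(1)] a Hc nat_pow_Suc2[of a s] by (simp add: A_def mult.assoc[symmetric] flip: Rm)
    then show ?case using Suc Reig[OF \<mu>] by (simp add: mult.assoc smul_mult mult.commute)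
  qed
  have PP: "P \<nu> * P \<mu> = (if \<nu> = \<mu> then P \<mu> else 0)" if \<mu>: "\<mu> ^ N = 1" and \<nu>: "\<nu> ^ N = 1" for \<mu> \<nu>
  proof -
    have n0: "\<nu> \<noteq> 0" "\<mu> \<noteq> 0" using \<nu> \<mu> N_pos by (auto simp: zero_power)
    have "P \<nu> * P \<mu> = smul (1 / of_nat N) (\<Sum>s<N. smul (inverse \<nu> ^ s * \<mu> ^ s) (P \<mu>))"
      by (simp add: P_def[of \<nu>] smul_mult sum_distrib_right Aeig[OF \<mu>])
    also have "\<dots> = smul (1 / of_nat N * (\<Sum>s<N. (\<mu> / \<nu>) ^ s)) (P \<mu>)"
      by (simp add: smul_sum_left[symmetric] power_divide power_inverse field_simps)
    also have "(\<Sum>s<N. (\<mu> / \<nu>) ^ s) = (if \<mu> / \<nu> = 1 then of_nat N else 0)"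
      by (rule sum_root_of_unity) (use \<mu> \<nu> in \<open>simp add: power_divide\<close>)
    finally show ?thesis using n0 N_pos by auto
  qed
  obtain \<zeta> :: complex where \<zeta>: "\<zeta> ^ N = 1" "\<And>s. \<zeta> ^ s = 1 \<longleftrightarrow> N dvd s" using primitive_root_ex[OF N_pos] by metis
  have "(\<Sum>j<N. P (\<zeta> ^ j)) = E"
  proof -
    have "(\<Sum>j<N. P (\<zeta> ^ j)) = smul (1 / of_nat N) (\<Sum>s<N. \<Sum>j<N. smul (inverse (\<zeta> ^ j) ^ s) (A s))"
      by (simp add: P_def smul_sum[symmetric]) (subst sum.swap, simp)
    also have "(\<Sum>s<N. \<Sum>j<N. smul (inverse (\<zeta> ^ j) ^ s) (A s)) = (\<Sum>s<N. if s = 0 then smul (of_nat N) (A s) else 0)"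
    proof (rule sum.cong[OF refl])
      fix s assume s: "s \<in> {..<N}"
      have "(\<Sum>j<N. smul (inverse (\<zeta> ^ j) ^ s) (A s)) = smul (\<Sum>j<N. (inverse \<zeta> ^ s) ^ j) (A s)"
        by (simp add: smul_sum_left power_inverse power_mult[symmetric] mult.commute)
      also have "(\<Sum>j<N. (inverse \<zeta> ^ s) ^ j) = (if inverse \<zeta> ^ s = 1 then of_nat N else 0)"
        by (rule sum_root_of_unity) (metis \<zeta>(1) inverse_1 mult.commute power_inverse power_mult power_one)
      also have "inverse \<zeta> ^ s = 1 \<longleftrightarrow> s = 0"
        using \<zeta>(2)[of s] s by (auto simp: power_inverse dvd_imp_le dest: dvd_imp_le)
      finally show "(\<Sum>j<N. smul (inverse (\<zeta> ^ j) ^ s) (A s)) = (if s = 0 then smul (of_nat N) (A s) else 0)" by auto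
    qed
    also have "\<dots> = smul (of_nat N) (A 0)" using N_pos by simp
    finally show ?thesis using N_pos E by (simp add: A_def rep_one[OF f] shaped_left)
  qed
  then have "\<exists>j<N. P (\<zeta> ^ j) \<noteq> 0" using E(3) by (metis lessThan_iff sum.neutral)
  then obtain \<mu> where \<mu>: "\<mu> ^ N = 1" "P \<mu> \<noteq> 0"
    using \<zeta>(1) by (metis mult.commute power_mult power_one)
  have \<mu>0: "\<mu> \<noteq> 0" using \<mu> N_pos by (auto simp: zero_power)
  define K where "K = {h \<in> H. c h = 1}"
  have KH: "K \<subseteq> H" by (auto simp: K_def)
  have c_inv: "c (inv h) = inverse (c h)" if "h \<in> H" for h
    using c_mult[of "inv h" h] that mH Hc c_one c0[OF that] by (simp add: field_simps)
  have Ksub: "subgroup K G"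
    by (rule subgroupI) (use Hc mH c_one c_mult c_inv in \<open>auto simp: K_def\<close>)
  have "K \<noteq> H"
  proof
    assume "K = H"
    then have c1: "\<And>h. h \<in> H \<Longrightarrow> c h = 1" by (auto simp: K_def)
    have "\<exists>d. R a * E = smul d E"
    proof (rule imprimitivity_schur[OF R I])
      show "E * (R a * E) = R a * E" by (metis EH[OF a(1)] E(2) mult.assoc)
      show "R a * E * E = R a * E" by (simp add: mult.assoc E(2))
      show "R h * (R a * E) = R a * E * R h" if "h \<in> H" for h using c[OF that] c1[OF that] by simp
    qed
    then show False using a by (auto simp: Z_def)
  qed
  then have KH': "K \<subset> H" using KH by auto
  obtain T' where T': "transversal H K T'" using transversal_ex[OF Ksub H KH] by blast
  have T'H: "\<And>t. t \<in> T' \<Longrightarrow> t \<in> H" using T' by (auto simp: transversal_def)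
  have finT: "finite T" "finite T'" using Tc T'H fin subgroup_fin[OF H] by (meson finite_subset subsetI)+
  define V where "V = (\<lambda>h. \<mu> / c h) ` H"
  have V_root: "\<nu> ^ N = 1" if "\<nu> \<in> V" for \<nu>
    using that \<mu> c_root by (auto simp: V_def power_divide)
  have finV: "finite V" using subgroup_fin[OF H] by (simp add: V_def)
  have bijV: "bij_betw (\<lambda>t. \<mu> / c t) T' V"
  proof (rule bij_betw_imageI)
    show "inj_on (\<lambda>t. \<mu> / c t) T'"
    proof (rule inj_onI)
      fix t u assume tu: "t \<in> T'" "u \<in> T'" "\<mu> / c t = \<mu> / c u"
      then have h: "t \<in> H" "u \<in> H" using T'H by auto
      then have "c t = c u" using tu \<mu>0 c0 by (simp add: field_simps)
      then have "inv t \<otimes> u \<in> K" using h mH c_mult c_inv c0 by (simp add: K_def)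
      then have "coset_rep K T' u = t" using coset_rep_eqI[OF T' h(2) tu(1)] by simp
      moreover have "coset_rep K T' u = u" using coset_rep_eqI[OF T' h(2) tu(2)] h Hc subgroup.one_closed[OF Ksub] by simp
      ultimately show "t = u" by simp
    qed
    show "(\<lambda>t. \<mu> / c t) ` T' = V"
    proof
      show "V \<subseteq> (\<lambda>t. \<mu> / c t) ` T'"
      proof
        fix \<nu> assume "\<nu> \<in> V"
        then obtain h where h: "h \<in> H" "\<nu> = \<mu> / c h" by (auto simp: V_def)
        define u where "u = coset_rep K T' h"
        have u: "u \<in> T'" "inv u \<otimes> h \<in> K" using coset_rep[OF T' h(1)] by (auto simp: u_def)
        then have "inverse (c u) * c h = 1" using T'H[OF u(1)] h(1) mH c_mult[of "inv u" h] c_inv[of u]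
          by (simp add: K_def)
        then have "c h = c u" using c0[OF T'H[OF u(1)]] by (simp add: field_simps)
        then show "\<nu> \<in> (\<lambda>t. \<mu> / c t) ` T'" using u h by auto
      qed
    qed (auto simp: V_def T'H)
  qed
  define S where "S = (\<Sum>\<nu>\<in>V. P \<nu>)"
  have ST': "(\<Sum>t\<in>T'. R t * P \<mu> * R (inv t)) = S"
  proof -
    have "(\<Sum>t\<in>T'. R t * P \<mu> * R (inv t)) = (\<Sum>t\<in>T'. P (\<mu> / c t))"
    proof (rule sum.cong[OF refl])
      fix t assume "t \<in> T'"
      then have t: "t \<in> H" using T'H by auto
      have "R t * P \<mu> * R (inv t) = P (\<mu> / c t) * (R t * R (inv t))" by (simp add: Pcomm[OF t] mult.assoc)
      then show "R t * P \<mu> * R (inv t) = P (\<mu> / c t)" using Rinv Hc t by (simp add: shaped_right[OF Ps])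
    qed
    then show ?thesis unfolding S_def using sum.reindex_bij_betw[OF bijV, of P] by simp
  qed
  \<comment> \<open>The set of eigenvalues \<open>V\<close> is permuted by \<open>\<nu> \<mapsto> \<nu> / c h\<close>, so \<open>S\<close> commutes with the action of \<open>H\<close>.\<close>
  have "\<exists>d. S = smul d E"
  proof (rule imprimitivity_schur[OF R I])
    show "E * S = S" "S * E = S" by (simp_all add: S_def sum_distrib_left sum_distrib_right PE)
    fix h assume h: "h \<in> H"
    have "R h * S = (\<Sum>\<nu>\<in>V. P (\<nu> / c h)) * R h"
      by (simp add: S_def sum_distrib_left sum_distrib_right Pcomm[OF h])
    also have "(\<Sum>\<nu>\<in>V. P (\<nu> / c h)) = (\<Sum>\<nu>\<in>V. P \<nu>)"
    proof (rule sum.reindex_bij_witness[of _ "\<lambda>\<nu>. \<nu> * c h" "\<lambda>\<nu>. \<nu> / c h"])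
      fix \<nu> assume "\<nu> \<in> V"
      then obtain k where k: "k \<in> H" "\<nu> = \<mu> / c k" by (auto simp: V_def)
      have "\<nu> / c h = \<mu> / c (k \<otimes> h)" "\<nu> * c h = \<mu> / c (k \<otimes> inv h)"
        using k h mH by (simp_all add: c_mult c_inv field_simps)
      then show "\<nu> / c h \<in> V" "\<nu> * c h \<in> V" using k h mH by (auto simp: V_def)
    qed (use c0[OF h] in auto)
    finally show "R h * S = S * R h" by (simp add: S_def)
  qed
  then obtain d where d: "S = smul d E" by blast
  have "\<mu> = \<mu> / c \<one>" by (simp add: c_one)
  then have "\<mu> \<in> V" unfolding V_def using mH(3) by (rule image_eqI)
  moreover have "S * P \<mu> = (\<Sum>\<nu>\<in>V. if \<nu> = \<mu> then P \<mu> else 0)"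
    unfolding S_def sum_distrib_right by (rule sum.cong[OF refl]) (rule PP[OF \<mu>(1) V_root])
  ultimately have "S * P \<mu> = P \<mu>" using finV by simp
  then have "smul d (P \<mu>) = smul 1 (P \<mu>)" by (simp add: d smul_mult PE)
  then have "d = 1" using smul_cancel \<mu>(2) by blast
  then have SE: "S = E" using d by simp
  define T'' where "T'' = (\<lambda>(t, u). t \<otimes> u) ` (T \<times> T')"
  have T'': "transversal (carrier G) K T''" "inj_on (\<lambda>(t, u). t \<otimes> u) (T \<times> T')"
    using transversal_trans[OF subgroup_self H Ksub _ KH T T'] Hc by (auto simp: T''_def)
  have "imprimitivity n R K T'' (P \<mu>)" unfolding imprimitivity_def
  proof (intro conjI ballI)
    show "subgroup K G" "transversal (carrier G) K T''" "shaped n n (P \<mu>)" "P \<mu> \<noteq> 0" by fact+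
    show "P \<mu> * P \<mu> = P \<mu>" using PP[OF \<mu>(1) \<mu>(1)] by simp
    show "R h * P \<mu> = P \<mu> * R h" if "h \<in> K" for h using Pcomm[of h \<mu>] that by (auto simp: K_def)
    show "P \<mu> * R x * P \<mu> = 0" if x: "x \<in> carrier G - K" for x
    proof (cases "x \<in> H")
      case True
      then have "c x \<noteq> 1" using x by (simp add: K_def)
      then have ne: "\<mu> / c x \<noteq> \<mu>" using \<mu>0 c0[OF True] by (simp add: field_simps)
      have "P \<mu> * P (\<mu> / c x) = 0"
        using PP[OF _ \<mu>(1), of "\<mu> / c x"] \<mu>(1) c_root[OF True] ne by (auto simp: power_divide)
      then show ?thesis by (simp add: mult.assoc Pcomm[OF True]) (simp add: mult.assoc[symmetric])
    next
      case False
      have "P \<mu> * R x * P \<mu> = P \<mu> * (E * R x * E) * P \<mu>" using PE[of \<mu>] by (metis mult.assoc)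
      then show ?thesis using Ex False x by simp
    qed
    have "(\<Sum>t\<in>T''. R t * P \<mu> * R (inv t)) = (\<Sum>(t, u)\<in>T \<times> T'. R (t \<otimes> u) * P \<mu> * R (inv (t \<otimes> u)))"
      unfolding T''_def by (subst sum.reindex[OF T''(2)]) (simp add: case_prod_unfold)
    also have "\<dots> = (\<Sum>t\<in>T. \<Sum>u\<in>T'. R (t \<otimes> u) * P \<mu> * R (inv (t \<otimes> u)))"
      by (simp add: sum.cartesian_product)
    also have "\<dots> = (\<Sum>t\<in>T. \<Sum>u\<in>T'. R t * (R u * P \<mu> * R (inv u)) * R (inv t))"
      using Tc T'H Hc by (intro sum.cong refl) (simp add: rep_mult[OF f] inv_mult_group mult.assoc)
    also have "\<dots> = (\<Sum>t\<in>T. R t * S * R (inv t))"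
      unfolding ST'[symmetric] by (simp add: sum_distrib_left sum_distrib_right)
    also have "\<dots> = ident n" using ET SE by simp
    finally show "(\<Sum>t\<in>T''. R t * P \<mu> * R (inv t)) = ident n" .
  qed
  then show ?thesis using KH' by blast
qed

text \<open>
  In a system of imprimitivity with \<open>H\<close> of least order, \<open>H\<close> acts on the block by scalars \<open>\<mu> h\<close>.  Then every matrix of
  the corner \<open>E M E\<close> commutes with \<open>H\<close>, so the corner is one-dimensional and \<open>E\<close> has trace one.  Expanding
  \<open>R g\<close> along the sum of the conjugates of \<open>E\<close> gives the formula for the induced character.
\<close>

theorem p_group_monomial:
  assumes p: "prime p" "Coset.order G = p ^ m" and R: "irr_rep G n R"
  shows "\<exists>H T \<mu>. subgroup H G \<and> transversal (carrier G) H T \<and> lin_char H \<mu> \<and> card T = n \<and>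
    (\<forall>g\<in>carrier G. tr (R g) = ind_char H T \<mu> g)"
proof -
  have f: "rep G n R" and n: "0 < n" using R by (auto simp: irr_rep_def)
  have "ident n \<noteq> 0"
  proof
    assume "ident n = 0"
    then have "tr (ident n) = 0" by (simp only: tr_zero)
    then show False using n by simp
  qed
  moreover have "transversal (carrier G) (carrier G) {\<one>}" by (auto simp: transversal_def)
  moreover have "R g * ident n = R g" "ident n * R g = R g" if "g \<in> carrier G" for g
    using rep_shaped[OF f that] by (auto simp: shaped_def)
  ultimately have I0: "imprimitivity n R (carrier G) {\<one>} (ident n)"
    using f by (auto simp: imprimitivity_def subgroup_self rep_one)
  define Q where "Q H \<longleftrightarrow> (\<exists>T E. imprimitivity n R H T E)" for H
  obtain H where H: "Q H" "\<And>K. Q K \<Longrightarrow> card H \<le> card K"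
    using ex_has_least_nat[of Q "carrier G" card] I0 by (auto simp: Q_def)
  obtain T E where I: "imprimitivity n R H T E" using H(1) by (auto simp: Q_def)
  have scal: "\<exists>c. R h * E = smul c E" if h: "h \<in> H" for h
  proof (rule ccontr)
    assume "\<not> ?thesis"
    then obtain K T' E' where K: "imprimitivity n R K T' E'" "K \<subset> H" using imprimitivity_split[OF p R I h] by blast
    have "card K < card H" using K(2) I subgroup_fin psubset_card_mono unfolding imprimitivity_def by blast
    then show False using H(2)[of K] K(1) by (auto simp: Q_def)
  qed
  then obtain \<mu> where \<mu>: "\<And>h. h \<in> H \<Longrightarrow> R h * E = smul (\<mu> h) E" by metis
  have Hs: "subgroup H G" and T: "transversal (carrier G) H T" and E: "shaped n n E" "E * E = E" "E \<noteq> 0"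
    and EH: "\<And>h. h \<in> H \<Longrightarrow> R h * E = E * R h" and Ex: "\<And>x. x \<in> carrier G - H \<Longrightarrow> E * R x * E = 0"
    and ET: "(\<Sum>t\<in>T. R t * E * R (inv t)) = ident n"
    using I by (auto simp: imprimitivity_def)
  have Hc: "\<And>t. t \<in> H \<Longrightarrow> t \<in> carrier G" using subgroup.subset[OF Hs] by auto
  have Tc: "\<And>t. t \<in> T \<Longrightarrow> t \<in> carrier G" using T by (auto simp: transversal_def)
  have "\<exists>c. E * A * E = smul c E" if A: "shaped n n A" for A
  proof (rule imprimitivity_schur[OF R I])
    show "E * (E * A * E) = E * A * E" "E * A * E * E = E * A * E" using E(2) by (simp_all add: mult.assoc[symmetric]) (simp add: mult.assoc E)
    fix h assume h: "h \<in> H"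
    have "R h * (E * A * E) = smul (\<mu> h) (E * A * E)" using \<mu>[OF h] by (simp add: mult.assoc[symmetric] smul_mult)
    moreover have "E * A * E * R h = smul (\<mu> h) (E * A * E)"
      using \<mu>[OF h] EH[OF h] by (simp add: mult.assoc smul_mult)
    ultimately show "R h * (E * A * E) = E * A * E * R h" by simp
  qed
  then have trE: "tr E = 1" by (rule idempotent_one_dim_tr[OF E])
  have lin: "lin_char H \<mu>" unfolding lin_char_def
  proof (intro conjI ballI)
    have "smul (\<mu> \<one>) E = smul 1 E" using \<mu>[of \<one>] subgroup.one_closed[OF Hs] E by (simp add: rep_one[OF f] shaped_left)
    then show "\<mu> \<one> = 1" using smul_cancel E(3) by blast
    fix x y assume xy: "x \<in> H" "y \<in> H"
    have "smul (\<mu> (x \<otimes> y)) E = R x * (R y * E)"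
      using \<mu>[of "x \<otimes> y"] xy subgroup.m_closed[OF Hs] Hc by (simp add: rep_mult[OF f] mult.assoc)
    also have "\<dots> = smul (\<mu> x * \<mu> y) E" using \<mu> xy by (simp add: smul_mult mult.commute)
    finally show "\<mu> (x \<otimes> y) = \<mu> x * \<mu> y" using smul_cancel E(3) by blast
  qed
  have char: "tr (R g) = ind_char H T \<mu> g" if g: "g \<in> carrier G" for g
  proof -
    have "tr (R g) = tr (\<Sum>t\<in>T. R g * (R t * E * R (inv t)))"
      using ET rep_shaped[OF f g] by (simp add: sum_distrib_left[symmetric] shaped_right)
    also have "\<dots> = (\<Sum>t\<in>T. zero_ext H \<mu> (inv t \<otimes> g \<otimes> t))" unfolding tr_sum
    proof (rule sum.cong[OF refl])
      fix t assume "t \<in> T"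
      then have t: "t \<in> carrier G" using Tc by auto
      have "tr (R g * (R t * E * R (inv t))) = tr (R g * R t * E * (E * R (inv t)))"
        using E(2) by (simp add: mult.assoc) (metis mult.assoc)
      also have "\<dots> = tr (E * R (inv t) * (R g * R t * E))" by (rule tr_comm)
      also have "\<dots> = tr (E * R (inv t \<otimes> g \<otimes> t) * E)" using t g by (simp add: rep_mult[OF f] mult.assoc)
      also have "\<dots> = zero_ext H \<mu> (inv t \<otimes> g \<otimes> t)"
        using Ex[of "inv t \<otimes> g \<otimes> t"] \<mu>[of "inv t \<otimes> g \<otimes> t"] t g E(2) trE
        by (auto simp: zero_ext_def mult.assoc smul_mult)
      finally show "tr (R g * (R t * E * R (inv t))) = zero_ext H \<mu> (inv t \<otimes> g \<otimes> t)" .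
    qed
    finally show ?thesis by (simp add: ind_char_def)
  qed
  have "(of_nat n :: complex) = of_nat (card T)"
  proof -
    have "ind_char H T \<mu> \<one> = (\<Sum>t\<in>T. 1)" unfolding ind_char_def
      using Tc subgroup.one_closed[OF Hs] lin by (intro sum.cong) (auto simp: zero_ext_def lin_char_def)
    then show ?thesis using char[of \<one>] by (simp add: rep_one[OF f])
  qed
  then have "card T = n" by (metis of_nat_eq_iff)
  then show ?thesis using Hs T lin char by blast
qed

end

section \<open>Power sums of roots of unity\<close>

text \<open>
  The sum over the residues prime to \<open>p\<close> is the sum over all residues minus the sum over the multiples of \<open>p\<close>.
\<close>

lemma sum_unit_powers:
  fixes z :: complex
  assumes p: "prime p" and N: "N = p ^ Suc k" and z: "z ^ N = 1"
  shows "(\<Sum>m | m < N \<and> \<not> p dvd m. z ^ m) =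
    (if z = 1 then of_nat N else 0) - (if z ^ p = 1 then of_nat (p ^ k) else 0)"
proof -
  have p0: "0 < p" using p by (simp add: prime_gt_0_nat)
  have "(\<Sum>m<N. z ^ m) = (\<Sum>m | m < N \<and> \<not> p dvd m. z ^ m) + (\<Sum>m | m < N \<and> p dvd m. z ^ m)"
    by (subst sum.union_disjoint[symmetric]) (auto intro!: sum.cong)
  moreover have "(\<Sum>m | m < N \<and> p dvd m. z ^ m) = (\<Sum>j<p ^ k. (z ^ p) ^ j)"
    by (rule sum.reindex_bij_witness[of _ "\<lambda>j. p * j" "\<lambda>m. m div p"])
       (use p0 in \<open>auto simp: N power_mult elim!: dvdE\<close>)
  moreover have "(\<Sum>j<p ^ k. (z ^ p) ^ j) = (if z ^ p = 1 then of_nat (p ^ k) else 0)"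
    by (rule sum_root_of_unity) (use z in \<open>simp add: N power_mult[symmetric]\<close>)
  ultimately show ?thesis using sum_root_of_unity[OF z] by simp
qed

text \<open>
  The polynomials stay over the complex numbers so that they can be evaluated at roots of unity.
\<close>

definition int_poly :: "complex poly \<Rightarrow> bool" where
  "int_poly h \<longleftrightarrow> (\<forall>i. Polynomial.coeff h i \<in> \<int>)"

lemma int_poly_add: "int_poly f \<Longrightarrow> int_poly g \<Longrightarrow> int_poly (f + g)" by (simp add: int_poly_def)
lemma int_poly_mult: "int_poly f \<Longrightarrow> int_poly g \<Longrightarrow> int_poly (f * g)"
  by (auto simp: int_poly_def coeff_mult intro!: Ints_sum)
lemma int_poly_one: "int_poly 1" by (auto simp: int_poly_def coeff_1)
lemma int_poly_zero: "int_poly 0" by (auto simp: int_poly_def)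
lemma int_poly_power: "int_poly f \<Longrightarrow> int_poly (f ^ n)"
  by (induction n) (auto simp: int_poly_one int_poly_mult)
lemma int_poly_of_nat: "int_poly (of_nat n)"
  by (induction n) (auto simp: int_poly_zero int_poly_one int_poly_add)
lemma int_poly_sum: "(\<And>x. x \<in> S \<Longrightarrow> int_poly (f x)) \<Longrightarrow> int_poly (sum f S)"
  by (induction S rule: infinite_finite_induct) (auto simp: int_poly_zero int_poly_add)
lemma int_poly_monom: "int_poly (Polynomial.monom 1 n)" by (auto simp: int_poly_def)

lemma freshman_dream:
  assumes q: "prime q" and u: "int_poly u" and v: "int_poly v"
  shows "\<exists>h. int_poly h \<and> (u + v) ^ q = u ^ q + v ^ q + of_nat q * h"
proof -
  define h where "h = (\<Sum>k\<in>{1..<q}. of_nat ((q choose k) div q) * u ^ k * v ^ (q - k))"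
  have q1: "1 < q" using q prime_gt_1_nat by auto
  have "(u + v) ^ q = (\<Sum>k\<le>q. of_nat (q choose k) * u ^ k * v ^ (q - k))" by (rule binomial_ring)
  also have "{..q} = insert 0 (insert q {1..<q})" using q1 by auto
  also have "(\<Sum>k\<in>insert 0 (insert q {1..<q}). of_nat (q choose k) * u ^ k * v ^ (q - k))
      = v ^ q + (u ^ q + (\<Sum>k\<in>{1..<q}. of_nat (q choose k) * u ^ k * v ^ (q - k)))"
    using q1 by simp
  also have "(\<Sum>k\<in>{1..<q}. of_nat (q choose k) * u ^ k * v ^ (q - k)) = of_nat q * h"
    unfolding h_def sum_distrib_left
  proof (rule sum.cong[OF refl])
    fix k assume k: "k \<in> {1..<q}"
    then have "q dvd (q choose k)" using q by (intro dvd_choose_prime) auto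
    then have "of_nat (q choose k) = (of_nat q * of_nat ((q choose k) div q) :: complex poly)"
      by (metis dvd_mult_div_cancel of_nat_mult)
    then show "of_nat (q choose k) * u ^ k * v ^ (q - k) =
        of_nat q * (of_nat ((q choose k) div q) * u ^ k * v ^ (q - k))" by (simp add: mult.assoc)
  qed
  finally have "(u + v) ^ q = u ^ q + v ^ q + of_nat q * h" by (simp add: algebra_simps)
  moreover have "int_poly h" unfolding h_def using u v
    by (intro int_poly_sum int_poly_mult int_poly_power int_poly_of_nat)
  ultimately show ?thesis by blast
qed

lemma freshman_dream_list:
  assumes q: "prime q"
  shows "\<exists>h. int_poly h \<and> (\<Sum>a\<leftarrow>as. Polynomial.monom 1 a) ^ q = (\<Sum>a\<leftarrow>as. Polynomial.monom 1 (q * a)) + of_nat q * h"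
proof (induction as)
  case Nil
  then show ?case using q prime_gt_0_nat[OF q] by (intro exI[of _ 0]) (simp add: int_poly_zero zero_power)
next
  case (Cons a as)
  then obtain h1 where h1: "int_poly h1"
    "(\<Sum>a\<leftarrow>as. Polynomial.monom 1 a) ^ q = (\<Sum>a\<leftarrow>as. Polynomial.monom 1 (q * a)) + of_nat q * h1" by blast
  have "int_poly (\<Sum>a\<leftarrow>as. Polynomial.monom 1 a)"
    by (induction as) (auto simp: int_poly_zero int_poly_add int_poly_monom)
  then obtain h2 where h2: "int_poly h2" "(Polynomial.monom 1 a + (\<Sum>a\<leftarrow>as. Polynomial.monom 1 a)) ^ q
      = Polynomial.monom 1 a ^ q + (\<Sum>a\<leftarrow>as. Polynomial.monom 1 a) ^ q + of_nat q * h2"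
    using freshman_dream[OF q int_poly_monom] by blast
  have "(Polynomial.monom 1 a :: complex poly) ^ q = Polynomial.monom 1 (q * a)" by (simp add: monom_power mult.commute)
  then have "(\<Sum>a\<leftarrow>a # as. Polynomial.monom 1 a) ^ q = (\<Sum>a\<leftarrow>a # as. Polynomial.monom 1 (q * a)) + of_nat q * (h1 + h2)"
    using h1 h2 by (simp add: algebra_simps)
  then show ?case using h1 h2 int_poly_add by blast
qed

lemma sum_int_poly_unit_roots:
  fixes \<zeta> :: complex
  assumes p: "prime p" and N: "N = p ^ Suc k" and z: "\<zeta> ^ N = 1" and h: "int_poly h"
  shows "(\<Sum>m | m < N \<and> \<not> p dvd m. poly h (\<zeta> ^ m)) \<in> \<int>"
proof -
  have "(\<Sum>m | m < N \<and> \<not> p dvd m. poly h (\<zeta> ^ m)) =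
      (\<Sum>m | m < N \<and> \<not> p dvd m. \<Sum>i\<le>Polynomial.degree h. Polynomial.coeff h i * (\<zeta> ^ i) ^ m)"
    by (simp add: poly_altdef power_mult[symmetric] mult.commute)
  also have "\<dots> = (\<Sum>i\<le>Polynomial.degree h. Polynomial.coeff h i * (\<Sum>m | m < N \<and> \<not> p dvd m. (\<zeta> ^ i) ^ m))"
    by (subst sum.swap) (simp add: sum_distrib_left)
  also have "\<dots> \<in> \<int>"
  proof (rule Ints_sum, rule Ints_mult)
    fix i
    show "Polynomial.coeff h i \<in> \<int>" using h by (simp add: int_poly_def)
    have "(\<zeta> ^ i) ^ N = 1" using z by (metis mult.commute power_mult power_one)
    then show "(\<Sum>m | m < N \<and> \<not> p dvd m. (\<zeta> ^ i) ^ m) \<in> \<int>"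
      unfolding sum_unit_powers[OF p N \<open>(\<zeta> ^ i) ^ N = 1\<close>] by auto
  qed
  finally show ?thesis .
qed

lemma fermat_int:
  assumes q: "prime q" and d: "\<not> int q dvd d" shows "[d ^ (q - 1) = 1] (mod int q)"
proof -
  define a where "a = nat (d mod int q)"
  have q0: "0 < q" using q prime_gt_0_nat by auto
  have a: "int a = d mod int q" using q0 by (simp add: a_def)
  have "\<not> q dvd a" using d a by (metis dvd_mod_iff dvd_refl int_dvd_int_iff)
  from fermat_theorem[OF q this] have "[int (a ^ (q - 1)) = int 1] (mod int q)" by (simp only: cong_int_iff)
  moreover have "[d ^ (q - 1) = int a ^ (q - 1)] (mod int q)"
    by (rule cong_pow) (simp add: a cong_def)
  ultimately show ?thesis by (simp) (metis cong_trans)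
qed

text \<open>
  By Fermat's little theorem the sum is congruent to the number of terms that are prime to \<open>q\<close>, which is smaller than \<open>q\<close>.
\<close>

lemma all_divisible_of_power_sum:
  assumes q: "prime q" and fin: "finite S" and small: "card S < q"
    and dvd: "int q dvd (\<Sum>x\<in>S. d x ^ (q - 1))"
  shows "\<forall>x\<in>S. int q dvd d x"
proof -
  define B where "B = {x \<in> S. \<not> int q dvd d x}"
  have q1: "q - 1 \<noteq> 0" using q prime_gt_1_nat[OF q] by auto
  have "[(\<Sum>x\<in>S. d x ^ (q - 1)) = (\<Sum>x\<in>S. if x \<in> B then 1 else 0)] (mod int q)"
  proof (rule cong_sum)
    fix x assume "x \<in> S"
    show "[d x ^ (q - 1) = (if x \<in> B then 1 else 0)] (mod int q)"
    proof (cases "x \<in> B")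
      case True then show ?thesis using fermat_int[OF q] by (simp add: B_def)
    next
      case False
      then have "int q dvd d x" using \<open>x \<in> S\<close> by (simp add: B_def)
      then have "int q dvd d x ^ (q - 1)" using q1 by (meson dvd_power dvd_trans gr0I)
      then show ?thesis using False by (simp add: cong_0_iff)
    qed
  qed
  moreover have "(\<Sum>x\<in>S. if x \<in> B then 1 else 0) = int (card B)"
    using fin by (simp add: sum.If_cases B_def Int_def Collect_conj_eq[symmetric] cong: conj_cong)
  ultimately have "[int (card B) = 0] (mod int q)" using dvd
    by (metis cong_0_iff cong_sym cong_trans)
  then have "q dvd card B" by (simp add: cong_0_iff)
  moreover have "card B \<le> card S" using fin by (simp add: B_def card_mono)
  ultimately have "card B = 0" using small by (meson dvd_imp_le gr0I le_less_trans not_le)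
  then show ?thesis using fin by (auto simp: B_def)
qed

lemma norm_root_of_unity:
  fixes e :: complex assumes "e ^ N = 1" "0 < N" shows "norm e = 1"
proof -
  have "norm e ^ N = 1" using assms(1) by (metis norm_one norm_power)
  then show ?thesis using assms(2) power_eq_iff_eq_base[of N "norm e" 1] by simp
qed

lemma norm_sum_roots_le:
  fixes es :: "complex list" assumes "\<forall>e\<in>set es. norm e \<le> 1" shows "norm (\<Sum>e\<leftarrow>es. e) \<le> length es"
  using assms by (induction es) (auto intro: order_trans[OF norm_triangle_ineq])

text \<open>
  Write \<open>f s\<close> for the sum of the \<open>s\<close>-th powers.  As a polynomial identity, \<open>f(s) ^ q - f(q s) = q h(\<zeta> ^ s)\<close> with
  an integral polynomial \<open>h\<close>.  The left-hand sides are integers \<open>d s\<close>, but \<open>h(\<zeta> ^ s)\<close> is only known to be an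
  algebraic integer.  Summing the powers \<open>d(s) ^ (q - 1)\<close> over all units \<open>s\<close> makes the right-hand side an
  integral multiple of \<open>q\<close>, and \<open>all_divisible_of_power_sum\<close> shows that \<open>q\<close> divides every \<open>d s\<close>.  Hence
  \<open>f q\<close> is congruent to \<open>f(1) ^ q\<close> and so to \<open>f 1\<close> modulo \<open>q\<close>, and both are too small to differ by a nonzero multiple of \<open>q\<close>.
\<close>

lemma power_sum_large_prime:
  fixes es :: "complex list"
  assumes p: "prime p" and N: "N = p ^ Suc k" and es: "\<forall>e\<in>set es. e ^ N = 1"
    and int: "\<And>s. \<not> p dvd s \<Longrightarrow> (\<Sum>e\<leftarrow>es. e ^ s) \<in> \<int>"
    and q: "prime q" "q \<noteq> p" "N < q" "2 * length es < q"
  shows "(\<Sum>e\<leftarrow>es. e ^ q) = (\<Sum>e\<leftarrow>es. e)"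
proof -
  define f where "f s = (\<Sum>e\<leftarrow>es. e ^ s)" for s
  have p_gt_1: "1 < p" using p prime_gt_1_nat by auto
  have N_pos: "0 < N" using p_gt_1 by (simp add: N)
  have N1: "1 < N" unfolding N using p_gt_1 by (metis one_less_power zero_less_Suc)
  obtain \<zeta> :: complex where \<zeta>: "\<zeta> ^ N = 1" "{z. z ^ N = 1} = (\<lambda>j. \<zeta> ^ j) ` {..<N}"
    using primitive_root_ex[OF N_pos] by metis
  have "\<exists>as. es = map (\<lambda>a. \<zeta> ^ a) as"
  proof -
    have "\<forall>e\<in>set es. \<exists>a. e = \<zeta> ^ a" using es \<zeta>(2) by blast
    then show ?thesis by (induction es) (auto, metis list.simps(9))
  qed
  then obtain as where as: "es = map (\<lambda>a. \<zeta> ^ a) as" by blast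
  define u :: "complex poly" where "u = (\<Sum>a\<leftarrow>as. Polynomial.monom 1 a)"
  have f_poly: "f s = poly u (\<zeta> ^ s)" for s
    unfolding f_def u_def as by (induction as) (auto simp: poly_monom power_mult[symmetric] mult.commute)
  obtain h where h: "int_poly h" "u ^ q = (\<Sum>a\<leftarrow>as. Polynomial.monom 1 (q * a)) + of_nat q * h"
    using freshman_dream_list[OF q(1), of as] unfolding u_def by blast
  have D: "f s ^ q - f (q * s) = of_nat q * poly h (\<zeta> ^ s)" for s
  proof -
    have "f (q * s) = poly (\<Sum>a\<leftarrow>as. Polynomial.monom 1 (q * a)) (\<zeta> ^ s)"
      unfolding f_def as by (induction as) (auto simp: poly_monom power_mult[symmetric] ac_simps)
    moreover have "f s ^ q = poly (u ^ q) (\<zeta> ^ s)" by (simp add: f_poly)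
    ultimately show ?thesis unfolding h(2) by simp
  qed
  define U where "U = {m. m < N \<and> \<not> p dvd m}"
  have finU: "finite U" and cU: "card U < q"
  proof -
    have "U \<subseteq> {..<N}" by (auto simp: U_def)
    then show "finite U" "card U < q" using finite_subset card_mono[of "{..<N}" U] q(3) by auto
  qed
  have pq: "\<not> p dvd q" using p q(1,2) primes_dvd_imp_eq by metis
  have "\<exists>d. f s ^ q - f (q * s) = of_int d" if "\<not> p dvd s" for s
  proof -
    have "\<not> p dvd q * s" using that pq p by (simp add: prime_dvd_mult_iff)
    then have "f s ^ q - f (q * s) \<in> \<int>" using int[OF that] int[of "q * s"] unfolding f_def by (intro Ints_diff Ints_power)
    then show ?thesis by (auto elim: Ints_cases)
  qed
  then obtain d where d: "\<And>s. \<not> p dvd s \<Longrightarrow> f s ^ q - f (q * s) = of_int (d s)" by metis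
  have "of_int (\<Sum>s\<in>U. d s ^ (q - 1)) = (\<Sum>s\<in>U. (of_nat q * poly h (\<zeta> ^ s)) ^ (q - 1))"
    unfolding of_int_sum by (rule sum.cong) (auto simp: U_def d[symmetric] D)
  also have "\<dots> = of_nat q ^ (q - 1) * (\<Sum>s\<in>U. poly (h ^ (q - 1)) (\<zeta> ^ s))"
    by (simp add: power_mult_distrib sum_distrib_left)
  finally have e: "of_int (\<Sum>s\<in>U. d s ^ (q - 1)) = (of_nat q ^ (q - 1) * (\<Sum>s\<in>U. poly (h ^ (q - 1)) (\<zeta> ^ s)) :: complex)" .
  have "(\<Sum>s\<in>U. poly (h ^ (q - 1)) (\<zeta> ^ s)) \<in> \<int>"
    unfolding U_def by (rule sum_int_poly_unit_roots[OF p N \<zeta>(1) int_poly_power[OF h(1)]])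
  then obtain i where "(\<Sum>s\<in>U. poly (h ^ (q - 1)) (\<zeta> ^ s)) = of_int i" by (auto elim: Ints_cases)
  then have "of_int (\<Sum>s\<in>U. d s ^ (q - 1)) = (of_int (int q ^ (q - 1) * i) :: complex)" using e by simp
  then have "(\<Sum>s\<in>U. d s ^ (q - 1)) = int q ^ (q - 1) * i" by (simp only: of_int_eq_iff)
  moreover have "int q dvd int q ^ (q - 1)" using prime_gt_1_nat[OF q(1)] by (simp add: dvd_power)
  ultimately have "int q dvd (\<Sum>s\<in>U. d s ^ (q - 1))" by simp
  then have "\<forall>s\<in>U. int q dvd d s" by (rule all_divisible_of_power_sum[OF q(1) finU cU])
  moreover have p1': "\<not> p dvd 1" using p_gt_1 by simp
  ultimately have d1: "int q dvd d 1" using N1 by (auto simp: U_def)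
  obtain a b where a: "f 1 = of_int a" and b: "f q = of_int b"
    using int[OF p1'] int[OF pq] unfolding f_def[symmetric] by (auto elim!: Ints_cases)
  have "(of_int (a ^ q - b) :: complex) = of_int (d 1)" using d[OF p1'] a b by simp
  then have d1e: "d 1 = a ^ q - b" by (simp only: of_int_eq_iff)
  have "[a ^ q = a] (mod int q)"
  proof (cases "int q dvd a")
    case True
    then have "int q dvd a ^ q" using prime_gt_0_nat[OF q(1)] by (meson dvd_power dvd_trans)
    then show ?thesis using True by (metis cong_0_iff cong_sym cong_trans)
  next
    case False
    have "a ^ q = a ^ (q - 1) * a" using prime_gt_0_nat[OF q(1)] by (metis power_minus_mult)
    then show ?thesis using cong_mult[OF fermat_int[OF q(1) False] cong_refl[of a]] by simp
  qed
  moreover have "[a ^ q = b] (mod int q)" using d1 d1e by (simp add: cong_iff_dvd_diff)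
  ultimately have "int q dvd a - b" by (metis cong_iff_dvd_diff cong_sym cong_trans)
  moreover have "\<bar>a\<bar> \<le> length es"
  proof -
    have "norm (f 1) \<le> length es" unfolding f_def using norm_sum_roots_le[of es] es norm_root_of_unity[OF _ N_pos] by auto
    then show ?thesis unfolding a by (simp add: norm_of_int)
  qed
  moreover have "\<bar>b\<bar> \<le> length es"
  proof -
    have "norm (f q) \<le> length es" unfolding f_def
      using norm_sum_roots_le[of "map (\<lambda>e. e ^ q) es"] es norm_root_of_unity[OF _ N_pos] by (auto simp: norm_power)
    then show ?thesis unfolding b by (simp add: norm_of_int)
  qed
  moreover have "int (2 * length es) < int q" using q(4) by (simp only: of_nat_less_iff)
  ultimately have "\<bar>a - b\<bar> < \<bar>int q\<bar>" "int q dvd a - b" by auto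
  then have "a - b = 0" using dvd_imp_le_int[of "a - b" "int q"] by linarith
  then show ?thesis using a b by (simp add: f_def)
qed

text \<open>
  Take for \<open>c\<close> the product of the primes up to \<open>B\<close> that do not divide \<open>m\<close>; then a small prime divides exactly one of \<open>m\<close> and \<open>N * c\<close>.
\<close>

lemma exists_rough_representative:
  fixes p N m k B :: nat
  assumes p: "prime p" and N: "N = p ^ Suc k" and m: "\<not> p dvd m"
  shows "\<exists>c. \<forall>q. prime q \<longrightarrow> q dvd m + N * c \<longrightarrow> B < q \<and> q \<noteq> p"
proof -
  define Q where "Q = (\<Prod>l | prime l \<and> l \<le> B \<and> \<not> l dvd m. l)"
  have fin: "finite {l. prime l \<and> l \<le> B \<and> \<not> l dvd m}"
    by (rule finite_subset[of _ "{..B}"]) auto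
  have "B < q \<and> q \<noteq> p" if q: "prime q" "q dvd m + N * Q" for q
  proof -
    have "q \<noteq> p" using q(2) m N by (auto simp: dvd_add_left_iff)
    moreover have "B < q"
    proof (rule ccontr)
      assume B: "\<not> B < q"
      show False
      proof (cases "q dvd m")
        case True
        then have "q dvd N * Q" using q(2) by (simp add: dvd_add_right_iff)
        then consider "q dvd p" | "q dvd Q" using q(1) unfolding N by (metis prime_dvd_mult_iff prime_dvd_power)
        then show False
        proof cases
          case 1 then show False using q(1) p \<open>q \<noteq> p\<close> primes_dvd_imp_eq by blast
        next
          case 2
          then obtain l where "prime l" "\<not> l dvd m" "q dvd l" using q(1) fin
            by (auto simp: Q_def prime_dvd_prod_iff)
          then show False using primes_dvd_imp_eq[OF q(1)] True by blast
        qed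
      next
        case False
        then have "q dvd Q" unfolding Q_def using q(1) B fin by (intro dvd_prodI) auto
        then show False using q(2) False by (metis dvd_add_left_iff dvd_mult)
      qed
    qed
    ultimately show ?thesis by simp
  qed
  then show ?thesis by blast
qed

text \<open>
  This is the Galois invariance of rational sums of roots of unity.  The exponent \<open>m\<close> matters only modulo \<open>N\<close>, and its
  residue class contains a product of large primes; these are handled one at a time by \<open>power_sum_large_prime\<close>.
\<close>

theorem power_sum_integral_invariant:
  fixes es :: "complex list"
  assumes p: "prime p" and N: "N = p ^ Suc k" and es: "\<forall>e\<in>set es. e ^ N = 1"
    and int: "\<And>s. \<not> p dvd s \<Longrightarrow> (\<Sum>e\<leftarrow>es. e ^ s) \<in> \<int>" and m: "\<not> p dvd m"
  shows "(\<Sum>e\<leftarrow>es. e ^ m) = (\<Sum>e\<leftarrow>es. e)"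
proof -
  define B where "B = max N (2 * length es)"
  define f where "f s = (\<Sum>e\<leftarrow>es. e ^ s)" for s
  have step: "f (s * q) = f s" if q: "prime q" "B < q" "q \<noteq> p" and s: "\<not> p dvd s" for q s
  proof -
    have "(\<Sum>e\<leftarrow>map (\<lambda>e. e ^ s) es. e ^ q) = (\<Sum>e\<leftarrow>map (\<lambda>e. e ^ s) es. e)"
    proof (rule power_sum_large_prime[OF p N])
      show "\<forall>e\<in>set (map (\<lambda>e. e ^ s) es). e ^ N = 1"
        using es by (auto simp: power_mult[symmetric] mult.commute[of s]) (simp add: power_mult)
      fix t assume "\<not> p dvd t"
      then have "\<not> p dvd s * t" using s p by (simp add: prime_dvd_mult_iff)
      from int[OF this] show "(\<Sum>e\<leftarrow>map (\<lambda>e. e ^ s) es. e ^ t) \<in> \<int>" by (simp add: o_def power_mult[symmetric])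
    qed (use q in \<open>auto simp: B_def\<close>)
    then show ?thesis by (simp add: f_def o_def power_mult[symmetric])
  qed
  have rough: "f n = f 1" if "n \<noteq> 0" "\<And>q. prime q \<Longrightarrow> q dvd n \<Longrightarrow> B < q \<and> q \<noteq> p" for n
    using that
  proof (induction n rule: prime_divisors_induct)
    case (factor q n)
    have n: "\<not> p dvd n" using factor.prems(2)[OF p] by auto
    have "f n = f 1" using factor by auto
    moreover have "f (n * q) = f n" using factor n by (intro step) auto
    ultimately show ?case by (simp add: mult.commute)
  qed auto
  obtain c where c: "\<forall>q. prime q \<longrightarrow> q dvd m + N * c \<longrightarrow> B < q \<and> q \<noteq> p"
    using exists_rough_representative[OF p N m] by blast
  have "m \<noteq> 0" using m by (metis dvd_0_right)
  then have "f (m + N * c) = f 1" using c by (intro rough) auto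
  moreover have "f (m + N * c) = f m" unfolding f_def using es
    by (intro arg_cong[of _ _ sum_list] map_cong) (auto simp: power_add power_mult)
  ultimately show ?thesis by (simp add: f_def)
qed

section \<open>Characters of finite groups\<close>

lemma sum_eq_card_imp_all_one:
  fixes a :: "'c \<Rightarrow> complex"
  assumes fin: "finite T" and le: "\<And>t. t \<in> T \<Longrightarrow> norm (a t) \<le> 1" and eq: "(\<Sum>t\<in>T. a t) = of_nat (card T)"
  shows "\<forall>t\<in>T. a t = 1"
proof -
  have Re_le: "Re (a t) \<le> 1" if "t \<in> T" for t using complex_Re_le_cmod[of "a t"] le[OF that] by linarith
  have "(\<Sum>t\<in>T. 1 - Re (a t)) = 0" using arg_cong[OF eq, of Re] by (simp add: sum_subtractf)
  then have Re1: "Re (a t) = 1" if "t \<in> T" for t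
    using that Re_le sum_nonneg_eq_0_iff[of T "\<lambda>t. 1 - Re (a t)"] fin by auto
  have "Im (a t) = 0" if "t \<in> T" for t
  proof -
    have "(Re (a t))\<^sup>2 + (Im (a t))\<^sup>2 \<le> 1" using le[OF that] cmod_power2[of "a t"]
      by (metis abs_norm_cancel abs_square_le_1)
    then show ?thesis using Re1[OF that] by simp
  qed
  then show ?thesis using Re1 by (auto intro: complex_eqI)
qed

context fin_group
begin

lemma char_decompose:
  assumes "rep G n R"
  shows "\<exists>L. set L \<subseteq> Irr G \<and> (\<forall>g\<in>carrier G. tr (R g) = (\<Sum>\<chi>\<leftarrow>L. \<chi> g))"
proof -
  obtain L where L: "\<forall>(m, S)\<in>set L. irr_rep G m S" "\<forall>g\<in>carrier G. tr (R g) = (\<Sum>(m, S)\<leftarrow>L. tr (S g))"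
    using rep_decompose[OF assms] by blast
  have "set (map (\<lambda>(m, S). rep_char G S) L) \<subseteq> Irr G" using L(1) by (force simp: Irr_iff)
  moreover have "tr (R g) = (\<Sum>\<chi>\<leftarrow>map (\<lambda>(m, S). rep_char G S) L. \<chi> g)" if g: "g \<in> carrier G" for g
    using L(2) g by (auto simp: rep_char_def o_def case_prod_unfold)
  ultimately show ?thesis by blast
qed

text \<open>
  The usual inner product of characters times the order of the group; on characters, taking the inverse
  of the argument is complex conjugation.
\<close>

definition pairing :: "('a \<Rightarrow> complex) \<Rightarrow> ('a \<Rightarrow> complex) \<Rightarrow> complex" where
  "pairing \<phi> \<psi> = (\<Sum>g\<in>carrier G. \<phi> g * \<psi> (inv g))"

lemma pairing_Irr:
  assumes "\<chi> \<in> Irr G" "\<psi> \<in> Irr G"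
  shows "pairing \<chi> \<psi> = (if \<chi> = \<psi> then of_nat (card (carrier G)) else 0)"
proof -
  obtain n R m S where RS: "irr_rep G n R" "\<chi> = rep_char G R" "irr_rep G m S" "\<psi> = rep_char G S"
    using assms by (auto simp: Irr_iff)
  have c: "pairing \<chi> \<psi> = (\<Sum>g\<in>carrier G. tr (R g) * tr (S (inv g)))"
    unfolding pairing_def RS by (rule sum.cong) (auto simp: rep_char_def)
  show ?thesis
  proof (cases "\<chi> = \<psi>")
    case True
    have "tr (S (inv g)) = tr (R (inv g))" if "g \<in> carrier G" for g
    proof -
      have "rep_char G R (inv g) = rep_char G S (inv g)" using True RS by simp
      then show ?thesis using that by (simp add: rep_char_def)
    qed
    then have "pairing \<chi> \<psi> = (\<Sum>g\<in>carrier G. tr (R g) * tr (R (inv g)))" unfolding c by (intro sum.cong) auto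
    then show ?thesis using True char_norm[OF RS(1)] by simp
  next
    case False
    then have "\<exists>g\<in>carrier G. tr (R g) \<noteq> tr (S g)" unfolding RS rep_char_def by (metis restrict_ext)
    then show ?thesis using False char_orthogonal[OF RS(1,3)] c by simp
  qed
qed

lemma pairing_sum_list:
  assumes "set L \<subseteq> Irr G" "\<psi> \<in> Irr G" "\<And>g. g \<in> carrier G \<Longrightarrow> \<theta> g = (\<Sum>\<chi>\<leftarrow>L. \<chi> g)"
  shows "pairing \<theta> \<psi> = of_nat (card (carrier G)) * of_nat (count_list L \<psi>)"
proof -
  have "pairing \<theta> \<psi> = (\<Sum>g\<in>carrier G. (\<Sum>\<chi>\<leftarrow>L. \<chi> g) * \<psi> (inv g))"
    unfolding pairing_def using assms(3) by (intro sum.cong) auto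
  also have "\<dots> = of_nat (card (carrier G)) * of_nat (count_list L \<psi>)" using assms(1)
  proof (induction L)
    case (Cons \<chi> L)
    have "(\<Sum>g\<in>carrier G. (\<Sum>\<chi>\<leftarrow>\<chi> # L. \<chi> g) * \<psi> (inv g)) =
        pairing \<chi> \<psi> + (\<Sum>g\<in>carrier G. (\<Sum>\<chi>\<leftarrow>L. \<chi> g) * \<psi> (inv g))"
      by (simp add: pairing_def distrib_right sum.distrib)
    then show ?case using Cons pairing_Irr[of \<chi> \<psi>] assms(2) by (auto simp: algebra_simps)
  qed simp
  finally show ?thesis .
qed

lemma pairing_self_sum_list:
  assumes "set L \<subseteq> Irr G" "\<And>g. g \<in> carrier G \<Longrightarrow> \<theta> g = (\<Sum>\<chi>\<leftarrow>L. \<chi> g)"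
  shows "pairing \<theta> \<theta> = of_nat (card (carrier G)) * of_nat (\<Sum>\<chi>\<leftarrow>L. count_list L \<chi>)"
proof -
  have "pairing \<theta> \<theta> = (\<Sum>g\<in>carrier G. \<theta> g * (\<Sum>\<chi>\<leftarrow>L. \<chi> (inv g)))"
    unfolding pairing_def using assms(2) by (intro sum.cong) auto
  also have "\<dots> = (\<Sum>\<chi>\<leftarrow>L. pairing \<theta> \<chi>)"
    by (induction L) (auto simp: pairing_def distrib_left sum.distrib)
  also have "\<dots> = (\<Sum>\<chi>\<leftarrow>L. of_nat (card (carrier G)) * of_nat (count_list L \<chi>))"
    using assms pairing_sum_list[of L _ \<theta>] by (intro arg_cong[of _ _ sum_list] map_cong) auto
  also have "\<dots> = of_nat (card (carrier G)) * of_nat (\<Sum>\<chi>\<leftarrow>L. count_list L \<chi>)"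
  proof -
    have "(\<Sum>\<chi>\<leftarrow>M. (c::complex) * of_nat (count_list L \<chi>)) = c * of_nat (\<Sum>\<chi>\<leftarrow>M. count_list L \<chi>)" for c M
      by (induction M) (auto simp: algebra_simps)
    then show ?thesis .
  qed
  finally show ?thesis .
qed

lemma Irr_degree:
  assumes "\<chi> \<in> Irr G" shows "\<chi> \<one> = of_nat (char_degree G \<chi>)" "0 < char_degree G \<chi>"
proof -
  obtain n R where R: "irr_rep G n R" "\<chi> = rep_char G R" using assms by (auto simp: Irr_iff)
  then have "R \<one> = ident n" unfolding irr_rep_def by (blast intro: rep_one)
  then have "\<chi> \<one> = of_nat n" by (simp add: R(2) rep_char_def)
  moreover from this have "char_degree G \<chi> = n" unfolding char_degree_def by (intro the_equality) auto
  ultimately show "\<chi> \<one> = of_nat (char_degree G \<chi>)" "0 < char_degree G \<chi>" using R by (auto simp: irr_rep_def)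
qed

lemma card_carrier_pos: "0 < card (carrier G)" using fin by (auto simp: card_gt_0_iff)

text \<open>
  The norm of a sum of irreducible characters is at least the number of its summands.
\<close>

lemma norm_one_Irr:
  assumes f: "rep G n R" and n: "0 < n"
    and norm: "(\<Sum>g\<in>carrier G. tr (R g) * tr (R (inv g))) = of_nat (card (carrier G))"
  shows "rep_char G R \<in> Irr G"
proof -
  obtain L where L: "set L \<subseteq> Irr G" "\<And>g. g \<in> carrier G \<Longrightarrow> tr (R g) = (\<Sum>\<chi>\<leftarrow>L. \<chi> g)"
    using char_decompose[OF f] by blast
  define \<theta> where "\<theta> g = tr (R g)" for g
  have "pairing \<theta> \<theta> = of_nat (card (carrier G))" using norm by (simp add: pairing_def \<theta>_def)
  then have "of_nat (card (carrier G)) * (of_nat (\<Sum>\<chi>\<leftarrow>L. count_list L \<chi>) :: complex) = of_nat (card (carrier G)) * 1"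
    using pairing_self_sum_list[OF L(1), of \<theta>] L(2) by (simp add: \<theta>_def)
  then have "(of_nat (\<Sum>\<chi>\<leftarrow>L. count_list L \<chi>) :: complex) = 1" using card_carrier_pos by simp
  then have one: "(\<Sum>\<chi>\<leftarrow>L. count_list L \<chi>) = 1" by (metis of_nat_1 of_nat_eq_iff)
  have "length L \<le> (\<Sum>\<chi>\<leftarrow>L. count_list L \<chi>)"
  proof -
    have "(\<Sum>\<chi>\<leftarrow>L. 1) \<le> (\<Sum>\<chi>\<leftarrow>L. count_list L \<chi>)"
      by (rule sum_list_mono) (metis Suc_leI count_list_0_iff One_nat_def gr0I)
    then show ?thesis by (simp add: sum_list_triv)
  qed
  then have "length L \<le> 1" using one by simp
  moreover have "L \<noteq> []" using L(2)[of \<one>] n f by (auto simp: rep_one)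
  ultimately obtain \<chi> where "L = [\<chi>]" by (cases L) auto
  then have "\<chi> \<in> Irr G" "\<And>g. g \<in> carrier G \<Longrightarrow> tr (R g) = \<chi> g" using L by auto
  then have "rep_char G R = \<chi>"
    unfolding rep_char_def by (auto simp: Irr_iff rep_char_def)
  then show ?thesis using \<open>\<chi> \<in> Irr G\<close> by simp
qed

text \<open>
  The projection \<open>E\<close> onto the fixed space of \<open>g\<close> has trace \<open>n\<close>, so the complementary idempotent has trace \<open>0\<close> and vanishes.
\<close>
lemma rep_trivial_of_trace:
  assumes f: "rep G n R" and g: "g \<in> carrier G" and t: "\<And>s::nat. tr (R (g [^] s)) = of_nat n"
  shows "R g = ident n"
proof -
  define N where "N = card (carrier G)"
  have N_pos: "0 < N" using card_carrier_pos by (simp add: N_def)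
  have gN: "g [^] N = \<one>" using pow_order_eq_1[OF g] by (simp add: N_def Coset.order_def)
  define E where "E = smul (1 / of_nat N) (\<Sum>s<N. R (g [^] s))"
  have RE: "R g * E = E"
  proof -
    have gs: "R g * R (g [^] s) = R (g [^] Suc s)" for s :: nat
      using g nat_pow_Suc2[OF g, of s] by (simp flip: rep_mult[OF f])
    have "R g * (\<Sum>s<N. R (g [^] s)) = (\<Sum>s<N. R (g [^] Suc s))"
      by (simp only: sum_distrib_left gs)
    also have "\<dots> = (\<Sum>s<N. R (g [^] s))"
      using sum.lessThan_Suc_shift[of "\<lambda>s. R (g [^] s)" N] gN by simp
    finally show ?thesis by (simp add: E_def smul_mult)
  qed
  have Es: "shaped n n E" unfolding E_def using rep_shaped[OF f] g by (intro shaped_smul shaped_sum) auto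
  have RsE: "R (g [^] s) * E = E" for s :: nat
  proof (induction s)
    case 0 show ?case using Es by (simp add: rep_one[OF f] shaped_left)
  next
    case (Suc s)
    then show ?case using RE g by (simp add: rep_mult[OF f] mult.assoc)
  qed
  have EE: "E * E = E"
  proof -
    have "E * E = smul (1 / of_nat N) (\<Sum>s<N. R (g [^] s)) * E" by (simp only: E_def)
    also have "\<dots> = smul (1 / of_nat N) (\<Sum>s<N. R (g [^] s) * E)"
      by (simp only: smul_mult sum_distrib_right)
    also have "\<dots> = smul (1 / of_nat N) (smul (of_nat N) E)" by (simp add: RsE smul_const_sum)
    finally show ?thesis using N_pos by simp
  qed
  have trE: "tr E = of_nat n" using N_pos by (simp add: E_def tr_sum t)
  have "ident n - E = 0"
  proof (rule idempotent_tr_zero[of n])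
    show "(ident n - E) * (ident n - E) = ident n - E" using EE Es by (simp add: algebra_simps shaped_left shaped_right)
  qed (use Es trE in auto)
  then have "E = ident n" by simp
  then show ?thesis using RE rep_shaped[OF f g] by (simp add: shaped_right)
qed

lemma conj_pow:
  assumes "t \<in> carrier G" "g \<in> carrier G"
  shows "(inv t \<otimes> g \<otimes> t) [^] (s::nat) = inv t \<otimes> g [^] s \<otimes> t"
proof (induction s)
  case (Suc s)
  have "(inv t \<otimes> g [^] s \<otimes> t) \<otimes> (inv t \<otimes> g \<otimes> t) = inv t \<otimes> g [^] s \<otimes> (t \<otimes> inv t) \<otimes> g \<otimes> t"
    using assms by (simp only: m_assoc m_closed inv_closed nat_pow_closed)
  then show ?case using Suc assms by (simp add: m_assoc)
qed (use assms in auto)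

lemma lin_char_pow:
  assumes "subgroup H G" "lin_char H \<mu>" "y \<in> H" shows "y [^] (s::nat) \<in> H" "\<mu> (y [^] s) = \<mu> y ^ s"
proof -
  have *: "y [^] s \<in> H \<and> \<mu> (y [^] s) = \<mu> y ^ s"
    using assms subgroup.one_closed[OF assms(1)] subgroup.m_closed[OF assms(1)]
    by (induction s) (auto simp: lin_char_def)
  then show "y [^] (s::nat) \<in> H" "\<mu> (y [^] s) = \<mu> y ^ s" by auto
qed

lemma central_scalar:
  assumes R: "irr_rep G n R" and z: "z \<in> center G"
  shows "\<exists>\<omega>. R z = smul \<omega> (ident n)"
proof (rule irr_rep_scalar[OF R])
  have f: "rep G n R" using R by (simp add: irr_rep_def)
  have zc: "z \<in> carrier G" using z by (simp add: center_def)
  show "shaped n n (R z)" using rep_shaped[OF f zc] .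
  show "R g * R z = R z * R g" if "g \<in> carrier G" for g
    using that z zc by (simp flip: rep_mult[OF f] add: center_def)
qed

lemma Irr_class_fun:
  assumes "\<chi> \<in> Irr G" "g \<in> carrier G" "x \<in> carrier G" shows "\<chi> (x \<otimes> g \<otimes> inv x) = \<chi> g"
proof -
  obtain n R where R: "irr_rep G n R" "\<chi> = rep_char G R" using assms by (auto simp: Irr_iff)
  then have f: "rep G n R" by (simp add: irr_rep_def)
  have "tr (R (x \<otimes> g \<otimes> inv x)) = tr (R (inv x) * (R x * R g))"
    using assms by (simp add: rep_mult[OF f]) (subst tr_comm, simp)
  also have "R (inv x) * (R x * R g) = R (inv x \<otimes> (x \<otimes> g))" using assms by (simp add: rep_mult[OF f])
  also have "inv x \<otimes> (x \<otimes> g) = g" using assms by (simp add: m_assoc[symmetric])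
  finally show ?thesis using assms by (simp add: R rep_char_def)
qed

text \<open>
  The compression to the first block is recorded because it transfers faithfulness from \<open>R1\<close> to the direct sum.
\<close>

lemma direct_sum_rep:
  assumes f1: "rep G n1 R1" and f2: "rep G n2 R2"
  shows "\<exists>R. rep G (n1 + n2) R \<and> (\<forall>g\<in>carrier G. tr (R g) = tr (R1 g) + tr (R2 g) \<and> ident n1 * R g * ident n1 = R1 g)"
proof -
  define U where "U = (\<Sum>i<n2. munit (n1 + i) i)"
  define V where "V = (\<Sum>i<n2. munit i (n1 + i))"
  have entU: "ent U i j = (if j < n2 \<and> i = n1 + j then 1 else 0)" for i j
  proof -
    have "ent U i j = (\<Sum>l<n2. if l = j then (if i = n1 + j then 1 else 0) else 0)"
      unfolding U_def ent_sum by (rule sum.cong) (auto simp: ent_munit)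
    then show ?thesis by simp
  qed
  have entV: "ent V i j = (if i < n2 \<and> j = n1 + i then 1 else 0)" for i j
  proof -
    have "ent V i j = (\<Sum>l<n2. if l = i then (if j = n1 + i then 1 else 0) else 0)"
      unfolding V_def ent_sum by (rule sum.cong) (auto simp: ent_munit)
    then show ?thesis by simp
  qed
  have VU: "V * U = ident n2"
  proof -
    have "V * U = (\<Sum>i<n2. \<Sum>j<n2. if i = j then munit i i else 0)"
      unfolding U_def V_def sum_distrib_left sum_distrib_right
      by (subst sum.swap) (intro sum.cong refl, auto simp: munit_mult)
    also have "\<dots> = (\<Sum>i<n2. munit i i)" by simp
    also have "\<dots> = ident n2" by (induction n2) (auto simp: ident_Suc)
    finally show ?thesis .
  qed
  have UV: "U * V = (\<Sum>i<n2. munit (n1 + i) (n1 + i))"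
  proof -
    have "U * V = (\<Sum>i<n2. \<Sum>j<n2. if i = j then munit (n1 + i) (n1 + i) else 0)"
      unfolding U_def V_def sum_distrib_left sum_distrib_right
      by (subst sum.swap) (intro sum.cong refl, auto simp: munit_mult)
    then show ?thesis by simp
  qed
  have I: "ident n1 + U * V = ident (n1 + n2)" unfolding UV by (induction n2) (auto simp: ident_Suc)
  have iU: "ident n1 * U = 0" by (rule fmat_eqI) (auto simp: ent_ident_mult entU)
  have Vi: "V * ident n1 = 0" by (rule fmat_eqI) (auto simp: ent_mult_ident entV)
  have s1: "shaped n1 n1 (R1 g)" and s2: "shaped n2 n2 (R2 g)" if "g \<in> carrier G" for g
    using rep_shaped[OF f1 that] rep_shaped[OF f2 that] .
  have z1: "R1 g * U = 0" "V * R1 g = 0" if "g \<in> carrier G" for g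
  proof -
    have "R1 g * U = R1 g * (ident n1 * U)" using shaped_right[OF s1[OF that]] by (simp add: mult.assoc[symmetric])
    then show "R1 g * U = 0" by (simp add: iU)
    have "V * R1 g = V * ident n1 * R1 g" using shaped_left[OF s1[OF that]] by (simp add: mult.assoc)
    then show "V * R1 g = 0" by (simp add: Vi)
  qed
  define R where "R g = R1 g + U * R2 g * V" for g
  have "rep G (n1 + n2) R" unfolding rep_def
  proof (intro conjI ballI)
    have "U * ident n2 = U" by (rule fmat_eqI) (auto simp: ent_mult_ident entU)
    then show "R \<one> = ident (n1 + n2)" using I by (simp add: R_def rep_one[OF f1] rep_one[OF f2])
    fix g h assume gh: "g \<in> carrier G" "h \<in> carrier G"
    have "R g * R h = R1 g * R1 h + (R1 g * U) * R2 h * V + U * R2 g * (V * R1 h) + U * R2 g * (V * U) * R2 h * V"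
      by (simp add: R_def algebra_simps)
    also have "\<dots> = R1 g * R1 h + U * (R2 g * ident n2) * R2 h * V" using gh by (simp add: z1 VU mult.assoc)
    also have "\<dots> = R (g \<otimes> h)" using gh shaped_right[OF s2[OF gh(1)]]
      by (simp add: R_def rep_mult[OF f1] rep_mult[OF f2] mult.assoc)
    finally show "R (g \<otimes> h) = R g * R h" by simp
  qed
  moreover have "tr (R g) = tr (R1 g) + tr (R2 g)" if g: "g \<in> carrier G" for g
  proof -
    have "tr (U * R2 g * V) = tr (V * U * R2 g)" by (subst tr_comm) (simp add: mult.assoc)
    then show ?thesis using shaped_left[OF s2[OF g]] by (simp add: R_def VU)
  qed
  moreover have "ident n1 * R g * ident n1 = R1 g" if g: "g \<in> carrier G" for g
  proof -
    have "ident n1 * R g * ident n1 = ident n1 * R1 g * ident n1 + (ident n1 * U) * R2 g * (V * ident n1)"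
      by (simp add: R_def algebra_simps)
    then show ?thesis using shaped_left[OF s1[OF g]] shaped_right[OF s1[OF g]] by (simp add: iU)
  qed
  ultimately show ?thesis by blast
qed

lemma trivial_rep: "rep G n (\<lambda>_. ident n)"
  by (auto simp: rep_def)

lemma sum_chars_rep:
  assumes "finite C" "C \<subseteq> Irr G"
  shows "\<exists>n R. rep G n R \<and> (\<forall>g\<in>carrier G. tr (R g) = (\<Sum>\<chi>\<in>C. \<chi> g))"
  using assms
proof (induction C)
  case empty
  show ?case using trivial_rep[of 0] by (intro exI[of _ 0] exI[of _ "\<lambda>_. ident 0"]) simp
next
  case (insert \<chi> C)
  then obtain n R where R: "rep G n R" "\<forall>g\<in>carrier G. tr (R g) = (\<Sum>\<chi>\<in>C. \<chi> g)" by auto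
  obtain m S where S: "irr_rep G m S" "\<chi> = rep_char G S" using insert.prems by (auto simp: Irr_iff)
  obtain Q where "rep G (m + n) Q" "\<forall>g\<in>carrier G. tr (Q g) = tr (S g) + tr (R g)"
    using direct_sum_rep[of m S n R] S(1) R(1) by (auto simp: irr_rep_def)
  then show ?case using R S insert.hyps
    by (intro exI[of _ "m + n"] exI[of _ Q]) (auto simp: rep_char_def)
qed

end

section \<open>Galois conjugates of characters of p-groups\<close>

text \<open>
  The number \<open>N\<close> is a multiple of the exponent.  It is a nontrivial power of \<open>p\<close>, so that being a unit
  modulo \<open>N\<close> means not to be divisible by \<open>p\<close>.
\<close>

locale finite_p_group = fin_group G for G (structure) +
  fixes p k N :: nat
  assumes p: "prime p" and N: "N = p ^ Suc k"
    and pow_exponent: "\<And>g. g \<in> carrier G \<Longrightarrow> g [^] N = \<one>"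
    and order_p_power: "\<exists>m. Coset.order G = p ^ m"
begin

lemma p_gt_1: "1 < p" using p prime_gt_1_nat by auto
lemma N_pos: "0 < N" using p_gt_1 by (simp add: N)

lemma pow_cong:
  assumes g: "g \<in> carrier G" and ab: "[a = b] (mod N)" shows "g [^] a = g [^] b"
proof -
  have m: "g [^] a = g [^] (a mod N)" for a
  proof -
    have "g [^] a = g [^] (N * (a div N) + a mod N)" by simp
    also have "\<dots> = (g [^] N) [^] (a div N) \<otimes> g [^] (a mod N)"
      using g by (simp only: nat_pow_mult[symmetric] nat_pow_pow)
    finally show ?thesis using g pow_exponent by simp
  qed
  show ?thesis using m[of a] m[of b] ab by (simp add: cong_def)
qed

lemma unit_inverse:
  assumes "\<not> p dvd s" shows "\<exists>t. [s * t = 1] (mod N) \<and> \<not> p dvd t"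
proof -
  have "coprime s N" using assms p unfolding N
    by (metis coprime_commute coprime_power_right_iff prime_imp_coprime)
  then obtain t where t: "[s * t = 1] (mod N)" using cong_solve_coprime_nat by fastforce
  have "\<not> p dvd t"
  proof
    assume "p dvd t"
    moreover have "[s * t = 1] (mod p)" using t cong_dvd_modulus_nat[of "s * t" 1 N p] by (simp add: N)
    ultimately have "p dvd 1" using cong_dvd_iff dvd_mult by blast
    then show False using p_gt_1 by simp
  qed
  then show ?thesis using t by blast
qed

lemma pow_inverse:
  assumes g: "g \<in> carrier G" and t: "[s * t = 1] (mod N)"
  shows "(g [^] s) [^] t = g" "(g [^] t) [^] s = g"
proof -
  have "g [^] (s * t) = g" using pow_cong[OF g t] g by simp
  then show "(g [^] s) [^] t = g" "(g [^] t) [^] s = g" using g by (simp_all add: nat_pow_pow mult.commute)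
qed

lemma sum_pow_reindex:
  assumes "\<not> p dvd m" shows "(\<Sum>g\<in>carrier G. f (g [^] m)) = (\<Sum>g\<in>carrier G. f g)"
proof -
  obtain t where t: "[m * t = 1] (mod N)" using unit_inverse[OF assms] by blast
  show ?thesis
    by (rule sum.reindex_bij_witness[of _ "\<lambda>g. g [^] t" "\<lambda>g. g [^] m"]) (use pow_inverse[OF _ t] in auto)
qed

lemma pow_mem_iff:
  assumes H: "subgroup H G" and y: "y \<in> carrier G" and s: "\<not> p dvd s"
  shows "y [^] s \<in> H \<longleftrightarrow> y \<in> H"
proof
  have *: "x [^] (n::nat) \<in> H" if "x \<in> H" for x n
    using that subgroup.one_closed[OF H] subgroup.m_closed[OF H] by (induction n) auto
  obtain t where t: "[s * t = 1] (mod N)" using unit_inverse[OF s] by blast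
  show "y [^] s \<in> H \<Longrightarrow> y \<in> H" using *[of "y [^] s" t] pow_inverse[OF y t] by simp
  show "y \<in> H \<Longrightarrow> y [^] s \<in> H" using * by blast
qed

lemma Irr_monomial:
  assumes "\<chi> \<in> Irr G"
  obtains H T \<mu> where "subgroup H G" "transversal (carrier G) H T" "lin_char H \<mu>" "card T = char_degree G \<chi>"
    "finite T" "\<And>g. g \<in> carrier G \<Longrightarrow> \<chi> g = ind_char H T \<mu> g"
proof -
  obtain n R where R: "irr_rep G n R" "\<chi> = rep_char G R" using assms by (auto simp: Irr_iff)
  obtain m where m: "Coset.order G = p ^ m" using order_p_power by blast
  obtain H T \<mu> where HT: "subgroup H G" "transversal (carrier G) H T" "lin_char H \<mu>" "card T = n"
      "\<forall>g\<in>carrier G. tr (R g) = ind_char H T \<mu> g"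
    using p_group_monomial[OF p m R(1)] by blast
  have "R \<one> = ident n" using R unfolding irr_rep_def by (blast intro: rep_one)
  then have "\<chi> \<one> = of_nat n" by (simp add: R(2) rep_char_def)
  then have "n = char_degree G \<chi>" using Irr_degree(1)[OF assms] by (metis of_nat_eq_iff)
  moreover have "finite T" using HT(2) fin finite_subset by (auto simp: transversal_def)
  ultimately show ?thesis using HT R(2) that by (auto simp: rep_char_def)
qed

lemma degree_p_power: assumes "\<chi> \<in> Irr G" shows "\<exists>a. char_degree G \<chi> = p ^ a"
proof -
  obtain H T \<mu> where *: "subgroup H G" "transversal (carrier G) H T" "card T = char_degree G \<chi>"
    using Irr_monomial[OF assms] by metis
  obtain m where m: "Coset.order G = p ^ m" using order_p_power by blast
  have "card (carrier G) = card T * card H"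
    by (rule transversal_card[OF *(1) subgroup_self _ *(2)]) (use subgroup.subset[OF *(1)] in auto)
  then have "char_degree G \<chi> dvd p ^ m" using m * by (metis Coset.order_def dvd_triv_left)
  then show ?thesis using p divides_primepow_nat by blast
qed

lemma ind_char_pow:
  assumes H: "subgroup H G" and T: "transversal (carrier G) H T" and l: "lin_char H \<mu>"
    and g: "g \<in> carrier G" and s: "\<not> p dvd s"
  shows "ind_char H T \<mu> (g [^] s) = ind_char H T (\<lambda>y. \<mu> y ^ s) g"
  unfolding ind_char_def
proof (rule sum.cong[OF refl])
  fix t assume "t \<in> T"
  then have t: "t \<in> carrier G" using T by (auto simp: transversal_def)
  have "inv t \<otimes> g \<otimes> t \<in> carrier G" using t g by simp
  then have "inv t \<otimes> g [^] s \<otimes> t \<in> H \<longleftrightarrow> inv t \<otimes> g \<otimes> t \<in> H"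
    using pow_mem_iff[OF H _ s] conj_pow[OF t g, of s] by metis
  then show "zero_ext H \<mu> (inv t \<otimes> g [^] s \<otimes> t) = zero_ext H (\<lambda>y. \<mu> y ^ s) (inv t \<otimes> g \<otimes> t)"
    using lin_char_pow(2)[OF H l, of "inv t \<otimes> g \<otimes> t" s] conj_pow[OF t g, of s] by (auto simp: zero_ext_def)
qed

text \<open>
  For \<open>m\<close> prime to \<open>p\<close> this is the Galois conjugate of \<open>\<chi>\<close> under the automorphism that raises roots of unity of
  order dividing \<open>N\<close> to their \<open>m\<close>-th powers.
\<close>

definition power_conj :: "nat \<Rightarrow> ('a \<Rightarrow> complex) \<Rightarrow> 'a \<Rightarrow> complex" where
  "power_conj m \<chi> = (\<lambda>g\<in>carrier G. \<chi> (g [^] m))"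

text \<open>
  The function is a character because it is induced from the \<open>m\<close>-th power of the linear character that induces
  \<open>\<chi>\<close>, and its norm is that of \<open>\<chi>\<close> because \<open>g \<mapsto> g ^ m\<close> permutes the group.
\<close>

lemma power_conj_Irr:
  assumes \<chi>: "\<chi> \<in> Irr G" and m: "\<not> p dvd m" shows "power_conj m \<chi> \<in> Irr G"
proof -
  obtain H T \<mu> where HT: "subgroup H G" "transversal (carrier G) H T" "lin_char H \<mu>" "card T = char_degree G \<chi>"
    "finite T" "\<And>g. g \<in> carrier G \<Longrightarrow> \<chi> g = ind_char H T \<mu> g" using Irr_monomial[OF \<chi>] by metis
  have "lin_char H (\<lambda>y. \<mu> y ^ m)" using HT(3) by (auto simp: lin_char_def power_mult_distrib)
  then obtain R where R: "rep G (card T) R" "\<forall>g\<in>carrier G. tr (R g) = ind_char H T (\<lambda>y. \<mu> y ^ m) g"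
    using induced_rep[OF HT(1,2,5)] by blast
  have Rg: "tr (R g) = \<chi> (g [^] m)" if "g \<in> carrier G" for g
    using R(2) that HT(6)[of "g [^] m"] ind_char_pow[OF HT(1-3) that m] by simp
  have "rep_char G R \<in> Irr G"
  proof (rule norm_one_Irr[OF R(1)])
    show "0 < card T" using HT(4) Irr_degree(2)[OF \<chi>] by simp
    have "(\<Sum>g\<in>carrier G. tr (R g) * tr (R (inv g))) = (\<Sum>g\<in>carrier G. \<chi> (g [^] m) * \<chi> (inv (g [^] m)))"
      by (rule sum.cong) (auto simp: Rg nat_pow_inv)
    also have "\<dots> = pairing \<chi> \<chi>" unfolding pairing_def by (rule sum_pow_reindex[OF m])
    finally show "(\<Sum>g\<in>carrier G. tr (R g) * tr (R (inv g))) = of_nat (card (carrier G))"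
      using pairing_Irr[OF \<chi> \<chi>] by simp
  qed
  moreover have "rep_char G R = power_conj m \<chi>" unfolding rep_char_def power_conj_def by (rule restrict_ext) (simp add: Rg)
  ultimately show ?thesis by simp
qed

lemma power_conj_degree:
  assumes "\<chi> \<in> Irr G" "\<not> p dvd m" shows "char_degree G (power_conj m \<chi>) = char_degree G \<chi>"
proof -
  have "power_conj m \<chi> \<one> = \<chi> \<one>" by (simp add: power_conj_def)
  then show ?thesis using Irr_degree(1)[OF assms(1)] Irr_degree(1)[OF power_conj_Irr[OF assms]] by (metis of_nat_eq_iff)
qed

lemma power_conj_power_conj: "power_conj a (power_conj b \<chi>) = power_conj (a * b) \<chi>"
  unfolding power_conj_def by (rule restrict_ext) (simp add: nat_pow_pow)

lemma power_conj_cong: "[a = b] (mod N) \<Longrightarrow> power_conj a \<chi> = power_conj b \<chi>"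
  unfolding power_conj_def by (rule restrict_ext) (metis pow_cong)

lemma power_conj_1: "\<chi> \<in> Irr G \<Longrightarrow> power_conj 1 \<chi> = \<chi>"
  unfolding power_conj_def Irr_iff rep_char_def by (auto intro!: ext)

lemma lin_char_root:
  assumes "subgroup H G" "lin_char H \<mu>" "y \<in> H" shows "\<mu> y ^ N = 1"
proof -
  have "\<mu> (y [^] N) = \<mu> y ^ N" using lin_char_pow(2)[OF assms] .
  moreover have "y [^] N = \<one>" using pow_exponent subgroup.mem_carrier[OF assms(1,3)] by blast
  ultimately show ?thesis using assms(2) by (simp add: lin_char_def)
qed

lemma Irr_roots:
  assumes \<chi>: "\<chi> \<in> Irr G" and g: "g \<in> carrier G"
  shows "\<exists>es. length es \<le> char_degree G \<chi> \<and> (\<forall>e\<in>set es. e ^ N = 1) \<and>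
     (\<forall>s. \<not> p dvd s \<longrightarrow> \<chi> (g [^] s) = (\<Sum>e\<leftarrow>es. e ^ s))"
proof -
  obtain H T \<mu> where HT: "subgroup H G" "transversal (carrier G) H T" "lin_char H \<mu>" "card T = char_degree G \<chi>"
    "finite T" "\<And>g. g \<in> carrier G \<Longrightarrow> \<chi> g = ind_char H T \<mu> g" using Irr_monomial[OF \<chi>] by metis
  obtain ts where ts: "set ts = T" "distinct ts" using finite_distinct_list[OF HT(5)] by blast
  define es where "es = map (\<lambda>t. \<mu> (inv t \<otimes> g \<otimes> t)) (filter (\<lambda>t. inv t \<otimes> g \<otimes> t \<in> H) ts)"
  have "length es \<le> length ts" by (simp add: es_def)
  then have "length es \<le> char_degree G \<chi>" using HT(4) ts distinct_card[of ts] by simp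
  moreover have "\<forall>e\<in>set es. e ^ N = 1" using lin_char_root[OF HT(1,3)] by (auto simp: es_def)
  moreover have "\<chi> (g [^] s) = (\<Sum>e\<leftarrow>es. e ^ s)" if s: "\<not> p dvd s" for s
  proof -
    have "\<chi> (g [^] s) = ind_char H T (\<lambda>y. \<mu> y ^ s) g"
      using HT(6)[of "g [^] s"] ind_char_pow[OF HT(1-3) g s] g by simp
    also have "\<dots> = (\<Sum>t\<leftarrow>ts. zero_ext H (\<lambda>y. \<mu> y ^ s) (inv t \<otimes> g \<otimes> t))"
      using ts by (simp add: ind_char_def sum_list_distinct_conv_sum_set)
    also have "\<dots> = (\<Sum>e\<leftarrow>es. e ^ s)"
      unfolding es_def by (induction ts) (auto simp: zero_ext_def)
    finally show ?thesis .
  qed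
  ultimately show ?thesis by blast
qed

lemma Irr_list_roots:
  assumes "set L \<subseteq> Irr G" and g: "g \<in> carrier G"
  shows "\<exists>es. (\<forall>e\<in>set es. e ^ N = 1) \<and> (\<forall>s. \<not> p dvd s \<longrightarrow> (\<Sum>\<chi>\<leftarrow>L. \<chi> (g [^] s)) = (\<Sum>e\<leftarrow>es. e ^ s))"
  using assms(1)
proof (induction L)
  case (Cons \<chi> L)
  then obtain es where "\<forall>e\<in>set es. e ^ N = 1" "\<forall>s. \<not> p dvd s \<longrightarrow> (\<Sum>\<chi>\<leftarrow>L. \<chi> (g [^] s)) = (\<Sum>e\<leftarrow>es. e ^ s)" by auto
  moreover obtain fs where "\<forall>e\<in>set fs. e ^ N = 1" "\<forall>s. \<not> p dvd s \<longrightarrow> \<chi> (g [^] s) = (\<Sum>e\<leftarrow>fs. e ^ s)"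
    using Irr_roots[OF _ g, of \<chi>] Cons.prems by auto
  ultimately show ?case by (intro exI[of _ "fs @ es"]) auto
qed (auto intro: exI[of _ "[]"])

text \<open>
  The values at the powers \<open>g ^ s\<close>, for \<open>s\<close> prime to \<open>p\<close>, are the power sums of one list of roots of unity.
\<close>

lemma integral_char_pow:
  assumes L: "set L \<subseteq> Irr G" and int: "\<And>g. g \<in> carrier G \<Longrightarrow> (\<Sum>\<chi>\<leftarrow>L. \<chi> g) \<in> \<int>"
    and g: "g \<in> carrier G" and m: "\<not> p dvd m"
  shows "(\<Sum>\<chi>\<leftarrow>L. \<chi> (g [^] m)) = (\<Sum>\<chi>\<leftarrow>L. \<chi> g)"
proof -
  obtain es where es: "\<forall>e\<in>set es. e ^ N = 1" "\<forall>s. \<not> p dvd s \<longrightarrow> (\<Sum>\<chi>\<leftarrow>L. \<chi> (g [^] s)) = (\<Sum>e\<leftarrow>es. e ^ s)"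
    using Irr_list_roots[OF L g] by blast
  have "(\<Sum>e\<leftarrow>es. e ^ m) = (\<Sum>e\<leftarrow>es. e)"
  proof (rule power_sum_integral_invariant[OF p N es(1) _ m])
    fix s assume s: "\<not> p dvd s"
    have "(\<Sum>\<chi>\<leftarrow>L. \<chi> (g [^] s)) \<in> \<int>" using int[of "g [^] s"] g by simp
    then show "(\<Sum>e\<leftarrow>es. e ^ s) \<in> \<int>" using es(2) s by simp
  qed
  moreover have "\<not> p dvd 1" using p_gt_1 by simp
  moreover have "(\<Sum>\<chi>\<leftarrow>L. \<chi> (g [^] (1::nat))) = (\<Sum>e\<leftarrow>es. e ^ 1)" using es(2) \<open>\<not> p dvd 1\<close> by blast
  moreover have "(\<Sum>\<chi>\<leftarrow>L. \<chi> (g [^] m)) = (\<Sum>e\<leftarrow>es. e ^ m)" using es(2) m by blast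
  ultimately show ?thesis using g by simp
qed

text \<open>
  By the triangle inequality, the induced character takes its degree at \<open>g\<close> only if all conjugates of \<open>g\<close> by the
  transversal lie in \<open>H\<close> and in the kernel of \<open>\<mu>\<close>; this condition is closed under products.
\<close>

lemma char_kernel_normal:
  assumes \<chi>: "\<chi> \<in> Irr G"
  shows "subgroup (char_kernel G \<chi>) G" "\<And>g x. g \<in> char_kernel G \<chi> \<Longrightarrow> x \<in> carrier G \<Longrightarrow> x \<otimes> g \<otimes> inv x \<in> char_kernel G \<chi>"
proof -
  obtain H T \<mu> where HT: "subgroup H G" "transversal (carrier G) H T" "lin_char H \<mu>" "card T = char_degree G \<chi>"
    "finite T" "\<And>g. g \<in> carrier G \<Longrightarrow> \<chi> g = ind_char H T \<mu> g" using Irr_monomial[OF \<chi>] by metis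
  have Tc: "\<And>t. t \<in> T \<Longrightarrow> t \<in> carrier G" using HT(2) by (auto simp: transversal_def)
  have ker: "g \<in> char_kernel G \<chi> \<longleftrightarrow> g \<in> carrier G \<and> (\<forall>t\<in>T. inv t \<otimes> g \<otimes> t \<in> H \<and> \<mu> (inv t \<otimes> g \<otimes> t) = 1)" for g
  proof -
    have "\<chi> g = \<chi> \<one> \<longleftrightarrow> (\<forall>t\<in>T. inv t \<otimes> g \<otimes> t \<in> H \<and> \<mu> (inv t \<otimes> g \<otimes> t) = 1)" if g: "g \<in> carrier G"
    proof
      assume "\<chi> g = \<chi> \<one>"
      then have "(\<Sum>t\<in>T. zero_ext H \<mu> (inv t \<otimes> g \<otimes> t)) = of_nat (card T)"
        using HT(6)[OF g] Irr_degree(1)[OF \<chi>] HT(4) by (simp add: ind_char_def)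
      moreover have "norm (zero_ext H \<mu> y) \<le> 1" for y
        using norm_root_of_unity[OF lin_char_root[OF HT(1,3)] N_pos] by (auto simp: zero_ext_def)
      ultimately have "\<forall>t\<in>T. zero_ext H \<mu> (inv t \<otimes> g \<otimes> t) = 1"
        by (intro sum_eq_card_imp_all_one[OF HT(5)])
      then show "\<forall>t\<in>T. inv t \<otimes> g \<otimes> t \<in> H \<and> \<mu> (inv t \<otimes> g \<otimes> t) = 1"
        by (auto simp: zero_ext_def split: if_splits)
    next
      assume "\<forall>t\<in>T. inv t \<otimes> g \<otimes> t \<in> H \<and> \<mu> (inv t \<otimes> g \<otimes> t) = 1"
      then have "ind_char H T \<mu> g = of_nat (card T)" by (simp add: ind_char_def zero_ext_def)
      then show "\<chi> g = \<chi> \<one>" using HT(4,6) g Irr_degree(1)[OF \<chi>] by simp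
    qed
    then show ?thesis by (auto simp: char_kernel_def)
  qed
  have eq: "inv t \<otimes> (g \<otimes> h) \<otimes> t = (inv t \<otimes> g \<otimes> t) \<otimes> (inv t \<otimes> h \<otimes> t)"
    if "t \<in> carrier G" "g \<in> carrier G" "h \<in> carrier G" for t g h
  proof -
    have "(inv t \<otimes> g \<otimes> t) \<otimes> (inv t \<otimes> h \<otimes> t) = inv t \<otimes> g \<otimes> (t \<otimes> inv t) \<otimes> h \<otimes> t"
      using that by (simp only: m_assoc m_closed inv_closed)
    then show ?thesis using that by (simp add: m_assoc)
  qed
  show "subgroup (char_kernel G \<chi>) G"
  proof (rule subgroupI)
    show "char_kernel G \<chi> \<subseteq> carrier G" by (auto simp: char_kernel_def)
    show "char_kernel G \<chi> \<noteq> {}" by (auto simp: char_kernel_def)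
    show mult: "g \<otimes> h \<in> char_kernel G \<chi>" if "g \<in> char_kernel G \<chi>" "h \<in> char_kernel G \<chi>" for g h
      using that subgroup.m_closed[OF HT(1)] HT(3) Tc unfolding ker by (auto simp: eq lin_char_def)
    show "inv g \<in> char_kernel G \<chi>" if g: "g \<in> char_kernel G \<chi>" for g
    proof -
      have gc: "g \<in> carrier G" using g by (simp add: char_kernel_def)
      have "g [^] n \<in> char_kernel G \<chi>" for n :: nat
        using g mult by (induction n) (auto simp: char_kernel_def)
      moreover have "g [^] (N - 1) = inv g"
      proof -
        have "g [^] (N - 1) \<otimes> g = \<one>" using pow_exponent[OF gc] N_pos nat_pow_Suc[of g "N - 1"] by simp
        then show ?thesis using gc inv_equality by simp
      qed
      ultimately show ?thesis by metis
    qed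
  qed
  show "x \<otimes> g \<otimes> inv x \<in> char_kernel G \<chi>" if "g \<in> char_kernel G \<chi>" "x \<in> carrier G" for g x
    using that Irr_class_fun[OF \<chi>] by (simp add: char_kernel_def)
qed

lemma central_values:
  assumes \<chi>: "\<chi> \<in> Irr G" and z: "z \<in> center G"
  obtains \<omega> where "\<omega> ^ N = 1" "\<And>s::nat. \<chi> (z [^] s) = of_nat (char_degree G \<chi>) * \<omega> ^ s"
proof -
  obtain n R where R: "irr_rep G n R" "\<chi> = rep_char G R" using \<chi> by (auto simp: Irr_iff)
  have f: "rep G n R" and n: "0 < n" using R by (auto simp: irr_rep_def)
  have zc: "z \<in> carrier G" using z by (simp add: center_def)
  obtain \<omega> where \<omega>: "R z = smul \<omega> (ident n)" using central_scalar[OF R(1) z] by blast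
  have Rs: "R (z [^] s) = smul (\<omega> ^ s) (ident n)" for s :: nat
    using zc by (induction s) (auto simp: rep_one[OF f] rep_mult[OF f] \<omega> smul_mult)
  have "tr (R (z [^] N)) = of_nat n" using pow_exponent[OF zc] by (simp add: rep_one[OF f])
  then have "\<omega> ^ N = 1" using Rs[of N] n by simp
  moreover have "\<chi> (z [^] s) = of_nat (char_degree G \<chi>) * \<omega> ^ s" for s :: nat
  proof -
    have "\<chi> \<one> = of_nat n" by (simp add: R(2) rep_char_def rep_one[OF f])
    then have "char_degree G \<chi> = n" using Irr_degree(1)[OF \<chi>] by (metis of_nat_eq_iff)
    then show ?thesis using zc by (simp add: R(2) rep_char_def Rs mult.commute)
  qed
  ultimately show ?thesis using that by blast
qed

text \<open>
  The central elements in \<open>K\<close> are the fixed points of the conjugation action on \<open>K\<close>, and \<open>\<one>\<close> is one of them.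
\<close>

lemma normal_meets_center:
  assumes K: "subgroup K G" and norm: "\<And>g x. g \<in> K \<Longrightarrow> x \<in> carrier G \<Longrightarrow> x \<otimes> g \<otimes> inv x \<in> K" and K1: "K \<noteq> {\<one>}"
  shows "\<exists>z\<in>K. z \<in> center G \<and> z \<noteq> \<one>"
proof -
  obtain m where m: "Coset.order G = p ^ m" using order_p_power by blast
  have Kc: "\<And>x. x \<in> K \<Longrightarrow> x \<in> carrier G" using subgroup.subset[OF K] by auto
  define F where "F = {x \<in> K. \<forall>g\<in>carrier G. g \<otimes> x \<otimes> inv g = x}"
  have "[card F = card K] (mod p)" unfolding F_def
  proof (rule p_group_fixed_points[OF is_group p m subgroup_fin[OF K]])
    fix g h x assume gh: "g \<in> carrier G" "h \<in> carrier G" "x \<in> K"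
    then show "g \<otimes> h \<otimes> x \<otimes> inv (g \<otimes> h) = g \<otimes> (h \<otimes> x \<otimes> inv h) \<otimes> inv g"
      using Kc by (simp add: inv_mult_group m_assoc)
  qed (use norm Kc in auto)
  moreover obtain i where i: "card K = p ^ i" using subgroup_order[OF K p m] by blast
  moreover have "i \<noteq> 0"
  proof
    assume "i = 0"
    then have "card K = 1" using i by simp
    then show False using K1 subgroup.one_closed[OF K] by (metis card_1_singletonE singletonD)
  qed
  ultimately have "p dvd card F" by (simp add: cong_dvd_iff)
  moreover have oneF: "\<one> \<in> F" using subgroup.one_closed[OF K] by (simp add: F_def)
  ultimately have "F \<noteq> {\<one>}" using p_gt_1 by auto
  then obtain z where z: "z \<in> F" "z \<noteq> \<one>" using oneF by blast
  have "z \<otimes> g = g \<otimes> z" if g: "g \<in> carrier G" for g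
  proof -
    have e: "g \<otimes> z \<otimes> inv g = z" and zc: "z \<in> carrier G" using z g Kc by (auto simp: F_def)
    have "z \<otimes> g = (g \<otimes> z \<otimes> inv g) \<otimes> g" by (simp only: e)
    also have "\<dots> = g \<otimes> z" using zc g by (simp add: m_assoc)
    finally show ?thesis .
  qed
  then show ?thesis using z Kc by (auto simp: F_def center_def)
qed

end

section \<open>The orbit of a faithful character\<close>

lemma card_of_fibres:
  assumes fin: "finite A" and c: "\<And>a. a \<in> A \<Longrightarrow> card {x \<in> A. f x = f a} = c"
  shows "card A = card (f ` A) * c"
proof -
  have "card A = (\<Sum>x\<in>A. 1)" by simp
  also have "\<dots> = (\<Sum>y\<in>f ` A. \<Sum>x\<in>{x \<in> A. f x = y}. 1)" by (rule sum.image_gen[OF fin])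
  also have "\<dots> = (\<Sum>y\<in>f ` A. c)" by (rule sum.cong) (auto simp: c)
  finally show ?thesis by simp
qed

lemma card_units_prime_power:
  fixes p :: nat
  assumes p: "prime p" shows "card {m. m < p ^ Suc k \<and> \<not> p dvd m} = (p - 1) * p ^ k"
proof -
  have "(of_nat (card {m. m < p ^ Suc k \<and> \<not> p dvd m}) :: complex) = (\<Sum>m | m < p ^ Suc k \<and> \<not> p dvd m. 1 ^ m)" by simp
  also have "\<dots> = of_nat (p ^ Suc k) - of_nat (p ^ k)" by (subst sum_unit_powers[OF p refl]) auto
  also have "\<dots> = of_nat ((p - 1) * p ^ k)" using prime_gt_0_nat[OF p] by (simp add: algebra_simps of_nat_diff)
  finally show ?thesis by (simp only: of_nat_eq_iff)
qed

lemma sum_set_le_sum_list: "(\<Sum>x\<in>set L. f x) \<le> (\<Sum>x\<leftarrow>L. f x :: nat)"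
proof (induction L)
  case (Cons a L)
  have "(\<Sum>x\<in>set (a # L). f x) \<le> f a + (\<Sum>x\<in>set L. f x)" by (cases "a \<in> set L") (auto simp: insert_absorb)
  then show ?case using Cons by simp
qed simp

text \<open>
  The center is cyclic and nontrivial, so its order is a power of \<open>p\<close> with positive exponent; this exponent is \<open>Suc b\<close>.
\<close>

locale cyclic_center_p_group = finite_p_group G p k N for G (structure) and p k N +
  fixes z1 :: 'a and b :: nat
  assumes z1: "z1 \<in> center G" and center_powers: "\<And>z. z \<in> center G \<Longrightarrow> \<exists>i::nat. z = z1 [^] i"
    and z1_pow_one: "\<And>s::nat. z1 [^] s = \<one> \<longleftrightarrow> p ^ Suc b dvd s"
begin

text \<open>
  An element of order \<open>p\<close> of the center; it lies in every nontrivial normal subgroup (\<open>normal_contains_z0\<close>).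
\<close>

definition z0 :: 'a where "z0 = z1 [^] (p ^ b)"

lemma z1_carrier: "z1 \<in> carrier G" using z1 by (simp add: center_def)
lemma z0_carrier: "z0 \<in> carrier G" using z1_carrier by (simp add: z0_def)
lemma z0_pow: "z0 [^] s = z1 [^] (p ^ b * s)" using z1_carrier by (simp add: z0_def nat_pow_pow)
lemma z0_pow_one: "z0 [^] s = \<one> \<longleftrightarrow> p dvd (s::nat)"
  using p_gt_1 unfolding z0_pow z1_pow_one by simp
lemma z0_center: "z0 \<in> center G"
proof -
  have "(z1 [^] n) \<otimes> g = g \<otimes> (z1 [^] n)" if g: "g \<in> carrier G" for g and n :: nat
  proof -
    have "z1 \<otimes> g = g \<otimes> z1" using z1 g by (simp add: center_def)
    then show ?thesis
    proof (induction n)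
      case (Suc n)
      have "z1 [^] Suc n \<otimes> g = z1 [^] n \<otimes> (z1 \<otimes> g)" using z1_carrier g by (simp add: m_assoc)
      also have "\<dots> = (z1 [^] n \<otimes> g) \<otimes> z1" using Suc.prems z1_carrier g by (simp add: m_assoc)
      also have "\<dots> = g \<otimes> z1 [^] Suc n" using Suc z1_carrier g by (simp add: m_assoc)
      finally show ?case .
    qed (use g in simp)
  qed
  then show ?thesis using z0_carrier by (simp add: center_def z0_def)
qed

lemma normal_contains_z0:
  assumes K: "subgroup K G" and norm: "\<And>g x. g \<in> K \<Longrightarrow> x \<in> carrier G \<Longrightarrow> x \<otimes> g \<otimes> inv x \<in> K" and K1: "K \<noteq> {\<one>}"
  shows "z0 \<in> K"
proof -
  obtain z where z: "z \<in> K" "z \<in> center G" "z \<noteq> \<one>" using normal_meets_center[OF K norm K1] by blast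
  obtain i where i: "z = z1 [^] (i::nat)" using center_powers[OF z(2)] by blast
  have ndvd: "\<not> p ^ Suc b dvd i" using z(3) i z1_pow_one by simp
  then have "i \<noteq> 0" by (metis dvd_0_right)
  then have "\<exists>c u. i = p ^ c * u \<and> \<not> p dvd u"
    by (rule multiplicity_decompose'[of i p]) (use p_gt_1 in auto)
  then obtain c u where u: "i = p ^ c * u" "\<not> p dvd u" by blast
  have "c \<le> b"
  proof (rule ccontr)
    assume "\<not> c \<le> b"
    then have "p ^ Suc b dvd p ^ c" by (intro le_imp_power_dvd) simp
    then show False using ndvd u(1) by (metis dvd_mult2)
  qed
  then have "i * p ^ (b - c) = p ^ b * u" using u(1) by (simp add: power_add[symmetric])
  then have "z [^] (p ^ (b - c)) = z0 [^] u" unfolding i z0_pow using z1_carrier by (simp add: nat_pow_pow)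
  moreover have "z [^] n \<in> K" for n :: nat
    using z(1) subgroup.one_closed[OF K] subgroup.m_closed[OF K] by (induction n) auto
  ultimately have "z0 [^] u \<in> K" by metis
  then show ?thesis using pow_mem_iff[OF K z0_carrier u(2)] by simp
qed

lemma faithful_iff:
  assumes "\<chi> \<in> Irr G" shows "char_kernel G \<chi> = {\<one>} \<longleftrightarrow> \<chi> z0 \<noteq> \<chi> \<one>"
proof
  assume "char_kernel G \<chi> = {\<one>}"
  moreover have "z0 \<noteq> \<one>" using z0_pow_one[of 1] p_gt_1 z0_carrier by auto
  ultimately show "\<chi> z0 \<noteq> \<chi> \<one>" using z0_carrier by (auto simp: char_kernel_def)
next
  assume "\<chi> z0 \<noteq> \<chi> \<one>"
  then have "z0 \<notin> char_kernel G \<chi>" by (simp add: char_kernel_def)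
  then show "char_kernel G \<chi> = {\<one>}"
    using normal_contains_z0 char_kernel_normal[OF assms] by blast
qed

definition unit_exps :: "nat set" where "unit_exps = {m. m < N \<and> \<not> p dvd m}"
definition conj_orbit :: "('a \<Rightarrow> complex) \<Rightarrow> ('a \<Rightarrow> complex) set" where "conj_orbit \<chi> = (\<lambda>m. power_conj m \<chi>) ` unit_exps"

lemma finite_unit_exps: "finite unit_exps" by (rule finite_subset[of _ "{..<N}"]) (auto simp: unit_exps_def)
lemma mod_unit_exps: "\<not> p dvd m \<Longrightarrow> m mod N \<in> unit_exps"
proof -
  assume m: "\<not> p dvd m"
  have "p dvd N" by (simp add: N)
  then have "\<not> p dvd m mod N" using m by (simp add: dvd_mod_iff)
  then show "m mod N \<in> unit_exps" using N_pos by (simp add: unit_exps_def)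
qed
lemma power_conj_mod: "power_conj (m mod N) \<chi> = power_conj m \<chi>" by (rule power_conj_cong) (simp add: cong_def)
lemma power_conj_in_conj_orbit: "\<not> p dvd m \<Longrightarrow> power_conj m \<chi> \<in> conj_orbit \<chi>"
  unfolding conj_orbit_def using mod_unit_exps power_conj_mod by (metis image_eqI)
lemma conj_orbit_Irr: "\<chi> \<in> Irr G \<Longrightarrow> conj_orbit \<chi> \<subseteq> Irr G" using power_conj_Irr by (auto simp: conj_orbit_def unit_exps_def)
lemma conj_orbit_degree: "\<chi> \<in> Irr G \<Longrightarrow> \<psi> \<in> conj_orbit \<chi> \<Longrightarrow> char_degree G \<psi> = char_degree G \<chi>"
  using power_conj_degree by (auto simp: conj_orbit_def unit_exps_def)
lemma conj_orbit_self: "\<chi> \<in> Irr G \<Longrightarrow> \<chi> \<in> conj_orbit \<chi>" using power_conj_in_conj_orbit[of 1 \<chi>] p_gt_1 power_conj_1 by simp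

text \<open>
  Multiplication by \<open>m0\<close> maps the stabilizer of \<open>\<chi>\<close> onto the coset of exponents that move \<open>\<chi>\<close> to its conjugate under \<open>m0\<close>.
\<close>

lemma conj_orbit_fibre:
  assumes \<chi>: "\<chi> \<in> Irr G" and m0: "m0 \<in> unit_exps"
  shows "bij_betw (\<lambda>s. (m0 * s) mod N) {s \<in> unit_exps. power_conj s \<chi> = \<chi>} {m \<in> unit_exps. power_conj m \<chi> = power_conj m0 \<chi>}"
proof -
  obtain t where t: "[m0 * t = 1] (mod N)" "\<not> p dvd t" using unit_inverse m0 by (auto simp: unit_exps_def)
  have a: "(t * ((m0 * s) mod N)) mod N = s" "(m0 * ((t * s) mod N)) mod N = s" if "s \<in> unit_exps" for s
  proof -
    have "[m0 * t * s = 1 * s] (mod N)" using t(1) cong_refl by (rule cong_mult)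
    then show "(t * ((m0 * s) mod N)) mod N = s" "(m0 * ((t * s) mod N)) mod N = s"
      using that by (simp_all add: cong_def mod_mult_right_eq unit_exps_def ac_simps)
  qed
  have np: "\<not> p dvd x * y" if "\<not> p dvd x" "\<not> p dvd y" for x y using that p by (simp add: prime_dvd_mult_iff)
  show ?thesis
  proof (rule bij_betwI[of _ _ _ "\<lambda>m. (t * m) mod N"])
    show "(\<lambda>s. (m0 * s) mod N) \<in> {s \<in> unit_exps. power_conj s \<chi> = \<chi>} \<rightarrow> {m \<in> unit_exps. power_conj m \<chi> = power_conj m0 \<chi>}"
      using m0 np by (auto simp: power_conj_mod power_conj_power_conj[symmetric] intro!: mod_unit_exps) (auto simp: unit_exps_def)
    have "power_conj (t * m) \<chi> = \<chi>" if "power_conj m \<chi> = power_conj m0 \<chi>" for m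
    proof -
      have "power_conj (t * m) \<chi> = power_conj (t * m0) \<chi>" using that by (simp add: power_conj_power_conj[symmetric])
      also have "\<dots> = power_conj 1 \<chi>" by (rule power_conj_cong) (use t(1) in \<open>simp add: mult.commute\<close>)
      finally show ?thesis using power_conj_1[OF \<chi>] by simp
    qed
    then show "(\<lambda>m. (t * m) mod N) \<in> {m \<in> unit_exps. power_conj m \<chi> = power_conj m0 \<chi>} \<rightarrow> {s \<in> unit_exps. power_conj s \<chi> = \<chi>}"
      using t(2) np by (auto simp: power_conj_mod intro!: mod_unit_exps) (auto simp: unit_exps_def)
  qed (use a in auto)
qed

lemma faithful_z1_values:
  assumes \<chi>: "\<chi> \<in> Irr G" "char_kernel G \<chi> = {\<one>}"
  obtains \<omega> where "\<And>s. \<omega> ^ s = 1 \<longleftrightarrow> p ^ Suc b dvd s" "\<And>s::nat. \<chi> (z1 [^] s) = of_nat (char_degree G \<chi>) * \<omega> ^ s"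
proof -
  obtain \<omega> where \<omega>: "\<And>s::nat. \<chi> (z1 [^] s) = of_nat (char_degree G \<chi>) * \<omega> ^ s"
    using central_values[OF \<chi>(1) z1] by metis
  have "\<omega> ^ s = 1 \<longleftrightarrow> p ^ Suc b dvd s" for s
  proof -
    have "\<omega> ^ s = 1 \<longleftrightarrow> \<chi> (z1 [^] s) = \<chi> \<one>" using \<omega>[of s] Irr_degree[OF \<chi>(1)] by simp
    also have "\<dots> \<longleftrightarrow> z1 [^] s \<in> char_kernel G \<chi>" using z1_carrier by (simp add: char_kernel_def)
    finally show ?thesis using \<chi>(2) z1_pow_one by simp
  qed
  then show ?thesis using \<omega> that by blast
qed

lemma power_eq_imp_dvd:
  fixes \<omega> :: complex
  assumes "\<And>s. \<omega> ^ s = 1 \<longleftrightarrow> n dvd s" "\<omega> ^ a = \<omega> ^ c" "a \<le> c" "0 < n" shows "n dvd c - a"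
proof -
  have "\<omega> \<noteq> 0" using assms(1)[of n] assms(4) by (auto simp: zero_power)
  moreover have "\<omega> ^ c = \<omega> ^ a * \<omega> ^ (c - a)" using assms(3) by (simp add: power_add[symmetric])
  ultimately have "\<omega> ^ (c - a) = 1" using assms(2) by simp
  then show ?thesis using assms(1) by simp
qed

text \<open>
  All fibres of \<open>m \<mapsto> power_conj m \<chi>\<close> have the size of the stabilizer \<open>S\<close>.  The value at \<open>z0\<close> shows that \<open>S\<close> lies in the
  group \<open>U1\<close> of residues that are \<open>1\<close> modulo \<open>p\<close>, so \<open>U1\<close> is a union of fibres and \<open>card S\<close> divides
  \<open>card U1 = p ^ k\<close>.  This makes the orbit size \<open>p - 1\<close> times a power of \<open>p\<close>.  The lower bound counts the values
  \<open>\<chi>(1) * \<omega> ^ m\<close> of the conjugates at the generator of the center.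
\<close>

lemma orbit_size:
  assumes \<chi>: "\<chi> \<in> Irr G" "char_kernel G \<chi> = {\<one>}"
  obtains j where "b \<le> j" "j \<le> k" "card (conj_orbit \<chi>) = (p - 1) * p ^ j"
    "card {s \<in> unit_exps. power_conj s \<chi> = \<chi>} * p ^ j = p ^ k"
proof -
  define S where "S = {s \<in> unit_exps. power_conj s \<chi> = \<chi>}"
  obtain \<omega> where \<omega>: "\<And>s. \<omega> ^ s = 1 \<longleftrightarrow> p ^ Suc b dvd s"
      "\<And>s::nat. \<chi> (z1 [^] s) = of_nat (char_degree G \<chi>) * \<omega> ^ s"
    using faithful_z1_values[OF \<chi>] by metis
  have d0: "(of_nat (char_degree G \<chi>) :: complex) \<noteq> 0" using Irr_degree(2)[OF \<chi>(1)] by simp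
  have p0: "0 < p ^ Suc b" using p_gt_1 by simp
  have fib: "card {m \<in> unit_exps. power_conj m \<chi> = power_conj m0 \<chi>} = card S" if "m0 \<in> unit_exps" for m0
    using bij_betw_same_card[OF conj_orbit_fibre[OF \<chi>(1) that]] by (simp add: S_def)
  have cU: "card unit_exps = card (conj_orbit \<chi>) * card S"
    unfolding conj_orbit_def by (rule card_of_fibres[OF finite_unit_exps fib])
  define U1 where "U1 = {m \<in> unit_exps. m mod p = 1}"
  have SU1: "s mod p = 1" if "s \<in> S" for s
  proof -
    have s: "\<not> p dvd s" "power_conj s \<chi> = \<chi>" using that by (auto simp: S_def unit_exps_def)
    have "s \<noteq> 0" using s(1) by (metis dvd_0_right)
    have "\<chi> (z0 [^] s) = \<chi> (z0 [^] (1::nat))" using fun_cong[OF s(2), of z0] z0_carrier by (simp add: power_conj_def)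
    then have "\<omega> ^ (p ^ b * s) = \<omega> ^ (p ^ b)" using d0 unfolding z0_pow \<omega>(2) by simp
    then have "p ^ Suc b dvd p ^ b * s - p ^ b"
      using \<open>s \<noteq> 0\<close> by (intro power_eq_imp_dvd[OF \<omega>(1) _ _ p0]) auto
    also have "p ^ b * s - p ^ b = p ^ b * (s - 1)" by (simp add: algebra_simps)
    finally have "p dvd s - 1" using p_gt_1 by simp
    then obtain c where "s = 1 + p * c" using \<open>s \<noteq> 0\<close> by (auto elim!: dvdE) (metis Suc_pred gr0I)
    then show ?thesis using p_gt_1 by (simp add: mod_Suc)
  qed
  have "card {m \<in> U1. power_conj m \<chi> = power_conj m0 \<chi>} = card S" if m0: "m0 \<in> U1" for m0
  proof -
    have "{m \<in> unit_exps. power_conj m \<chi> = power_conj m0 \<chi>} \<subseteq> U1"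
    proof
      fix m assume m: "m \<in> {m \<in> unit_exps. power_conj m \<chi> = power_conj m0 \<chi>}"
      have "m0 \<in> unit_exps" using m0 by (simp add: U1_def)
      from m obtain s where s: "s \<in> S" "m = (m0 * s) mod N"
        using bij_betw_imp_surj_on[OF conj_orbit_fibre[OF \<chi>(1) \<open>m0 \<in> unit_exps\<close>]] unfolding S_def by blast
      have "m mod p = (m0 * s) mod p" unfolding s(2) N by (simp add: mod_mod_cancel)
      also have "\<dots> = ((m0 mod p) * (s mod p)) mod p" by (simp add: mod_mult_eq)
      also have "\<dots> = 1" using m0 SU1[OF s(1)] p_gt_1 by (simp add: U1_def)
      finally show "m \<in> U1" using m by (simp add: U1_def)
    qed
    then have "{m \<in> U1. power_conj m \<chi> = power_conj m0 \<chi>} = {m \<in> unit_exps. power_conj m \<chi> = power_conj m0 \<chi>}" by (auto simp: U1_def)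
    then show ?thesis using fib m0 by (simp add: U1_def)
  qed
  then have "card U1 = card ((\<lambda>m. power_conj m \<chi>) ` U1) * card S"
    using finite_unit_exps by (intro card_of_fibres) (auto simp: U1_def)
  moreover have "card U1 = p ^ k"
  proof -
    have "bij_betw (\<lambda>j. 1 + p * j) {..<p ^ k} U1"
    proof (rule bij_betwI[of _ _ _ "\<lambda>m. m div p"])
      show "(\<lambda>j. 1 + p * j) \<in> {..<p ^ k} \<rightarrow> U1"
      proof
        fix j assume "j \<in> {..<p ^ k}"
        then have "p * Suc j \<le> N" unfolding N power_Suc by (intro mult_le_mono2) simp
        moreover have "\<not> p dvd 1 + p * j" using p_gt_1 by (metis dvd_add_left_iff dvd_triv_left nat_dvd_1_iff_1 less_irrefl)
        ultimately show "1 + p * j \<in> U1" using p_gt_1 by (auto simp: U1_def unit_exps_def mod_Suc)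
      qed
      show "(\<lambda>m. m div p) \<in> U1 \<rightarrow> {..<p ^ k}"
      proof
        fix m assume "m \<in> U1"
        then have "m < N" by (simp add: U1_def unit_exps_def)
        then have "m < p ^ k * p" by (simp add: N mult.commute)
        then show "m div p \<in> {..<p ^ k}" by (simp add: less_mult_imp_div_less)
      qed
      show "(1 + p * x) div p = x" for x using p_gt_1 div_mult_self2[of p 1 x] by simp
      show "1 + p * (y div p) = y" if "y \<in> U1" for y
        using that mult_div_mod_eq[of p y] by (simp add: U1_def)
    qed
    from bij_betw_same_card[OF this] show ?thesis by simp
  qed
  ultimately have "card S dvd p ^ k" by (metis dvd_triv_right)
  then obtain i where i: "i \<le> k" "card S = p ^ i" using p divides_primepow_nat by blast
  define j where "j = k - i"
  have kj: "p ^ k = p ^ i * p ^ j" using i(1) by (simp add: j_def power_add[symmetric])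
  have "card (conj_orbit \<chi>) * p ^ i = (p - 1) * p ^ j * p ^ i"
  proof -
    have "card unit_exps = (p - 1) * p ^ k" unfolding unit_exps_def by (rule card_units_prime_power[OF p, of k, folded N])
    then show ?thesis using cU i(2) kj by (simp add: ac_simps)
  qed
  then have size: "card (conj_orbit \<chi>) = (p - 1) * p ^ j" using p_gt_1 by simp
  have "card ((\<lambda>m. \<chi> (z1 [^] m)) ` {m. m < p ^ Suc b \<and> \<not> p dvd m}) \<le> card (conj_orbit \<chi>)"
  proof -
    have "(\<lambda>m. \<chi> (z1 [^] m)) ` {m. m < p ^ Suc b \<and> \<not> p dvd m} \<subseteq> (\<lambda>\<psi>. \<psi> z1) ` conj_orbit \<chi>"
    proof
      fix x assume "x \<in> (\<lambda>m. \<chi> (z1 [^] m)) ` {m. m < p ^ Suc b \<and> \<not> p dvd m}"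
      then obtain m where m: "\<not> p dvd m" "x = \<chi> (z1 [^] m)" by auto
      then have "x = power_conj m \<chi> z1" using z1_carrier by (simp add: power_conj_def)
      then show "x \<in> (\<lambda>\<psi>. \<psi> z1) ` conj_orbit \<chi>" using power_conj_in_conj_orbit[OF m(1)] by blast
    qed
    moreover have "finite (conj_orbit \<chi>)" using finite_unit_exps by (simp add: conj_orbit_def)
    ultimately show ?thesis by (rule surj_card_le[rotated])
  qed
  moreover have "inj_on (\<lambda>m. \<chi> (z1 [^] m)) {m. m < p ^ Suc b \<and> \<not> p dvd m}"
  proof -
    have *: "a = c" if "a < p ^ Suc b" "c < p ^ Suc b" "\<omega> ^ a = \<omega> ^ c" "a \<le> c" for a c
      using power_eq_imp_dvd[OF \<omega>(1) that(3,4) p0] that by (metis diff_is_0_eq' dvd_imp_le le_antisym less_imp_diff_less not_le zero_less_diff)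
    show ?thesis
    proof (rule inj_onI)
      fix a c assume ac: "a \<in> {m. m < p ^ Suc b \<and> \<not> p dvd m}" "c \<in> {m. m < p ^ Suc b \<and> \<not> p dvd m}"
        and "\<chi> (z1 [^] a) = \<chi> (z1 [^] c)"
      then have "\<omega> ^ a = \<omega> ^ c" using d0 by (simp add: \<omega>(2))
      then show "a = c" using *[of a c] *[of c a] ac by (cases "a \<le> c") auto
    qed
  qed
  ultimately have "(p - 1) * p ^ b \<le> (p - 1) * p ^ j"
    by (simp only: card_image card_units_prime_power[OF p] size)
  then have "b \<le> j" using p_gt_1 by simp
  then show ?thesis using that[of j] size i kj unfolding S_def[symmetric] by (simp add: j_def)
qed

text \<open>
  The orbit sum times the order \<open>card S\<close> of the stabilizer is the sum of \<open>\<chi>(g ^ m)\<close> over all units \<open>m\<close>.  The values \<open>\<chi>(g ^ m)\<close> are the power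
  sums of a list of at most \<open>\<chi>(1)\<close> roots of unity \<open>e\<close>.  If \<open>A\<close> of them satisfy \<open>e = 1\<close> and \<open>B\<close> of them \<open>e ^ p = 1\<close>, the sum is \<open>p ^ k * (p * A - B)\<close>
  by \<open>sum_unit_powers\<close>, and \<open>B \<le> \<chi>(1)\<close>.
\<close>

lemma orbit_sum_values:
  assumes \<chi>: "\<chi> \<in> Irr G" and j: "card {s \<in> unit_exps. power_conj s \<chi> = \<chi>} * p ^ j = p ^ k" and g: "g \<in> carrier G"
  shows "\<exists>a::nat. (\<Sum>\<psi>\<in>conj_orbit \<chi>. \<psi> g) + of_nat (p ^ j * char_degree G \<chi>) = of_nat a"
proof -
  define S where "S = {s \<in> unit_exps. power_conj s \<chi> = \<chi>}"
  obtain es where es: "length es \<le> char_degree G \<chi>" "\<forall>e\<in>set es. e ^ N = 1"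
     "\<forall>s. \<not> p dvd s \<longrightarrow> \<chi> (g [^] s) = (\<Sum>e\<leftarrow>es. e ^ s)" using Irr_roots[OF \<chi> g] by blast
  define A where "A = length (filter (\<lambda>e. e = 1) es)"
  define B where "B = length (filter (\<lambda>e. e ^ p = 1) es)"
  have "of_nat (card S) * (\<Sum>\<psi>\<in>conj_orbit \<chi>. \<psi> g) = (\<Sum>\<psi>\<in>conj_orbit \<chi>. \<Sum>m\<in>{m \<in> unit_exps. power_conj m \<chi> = \<psi>}. power_conj m \<chi> g)"
    unfolding sum_distrib_left
  proof (rule sum.cong[OF refl])
    fix \<psi> assume "\<psi> \<in> conj_orbit \<chi>"
    then obtain m0 where m0: "m0 \<in> unit_exps" "\<psi> = power_conj m0 \<chi>" by (auto simp: conj_orbit_def)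
    have "card {m \<in> unit_exps. power_conj m \<chi> = \<psi>} = card S"
      using bij_betw_same_card[OF conj_orbit_fibre[OF \<chi> m0(1)]] by (simp add: S_def m0)
    then show "of_nat (card S) * \<psi> g = (\<Sum>m\<in>{m \<in> unit_exps. power_conj m \<chi> = \<psi>}. power_conj m \<chi> g)" by simp
  qed
  also have "\<dots> = (\<Sum>m\<in>unit_exps. power_conj m \<chi> g)" unfolding conj_orbit_def by (rule sum.image_gen[OF finite_unit_exps, symmetric])
  also have "\<dots> = (\<Sum>m\<in>unit_exps. \<Sum>e\<leftarrow>es. e ^ m)" using es(3) g by (intro sum.cong) (auto simp: power_conj_def unit_exps_def)
  also have "\<dots> = (\<Sum>e\<leftarrow>es. \<Sum>m\<in>unit_exps. e ^ m)" by (induction es) (auto simp: sum.distrib)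
  also have "\<dots> = (\<Sum>e\<leftarrow>es. (if e = 1 then of_nat N else 0) - (if e ^ p = 1 then of_nat (p ^ k) else 0))"
    using es(2) unfolding unit_exps_def by (intro arg_cong[of _ _ sum_list] map_cong sum_unit_powers[OF p N]) auto
  also have "\<dots> = of_nat N * of_nat A - of_nat (p ^ k) * of_nat B"
    unfolding A_def B_def by (induction es) (auto simp: algebra_simps)
  also have "\<dots> = of_nat (p ^ k) * (of_nat p * of_nat A - of_nat B)" by (simp add: N algebra_simps)
  also have "\<dots> = of_nat (card S) * (of_nat (p ^ j) * (of_nat p * of_nat A - of_nat B))"
    using j by (simp add: S_def mult.assoc[symmetric] flip: of_nat_mult of_nat_power)
  finally have "of_nat (card S) * (\<Sum>\<psi>\<in>conj_orbit \<chi>. \<psi> g) = of_nat (card S) * (of_nat (p ^ j) * (of_nat p * of_nat A - of_nat B))" .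
  moreover have "card S \<noteq> 0" using j p_gt_1 by (metis S_def mult_is_0 power_not_zero not_one_less_zero)
  ultimately have e: "(\<Sum>\<psi>\<in>conj_orbit \<chi>. \<psi> g) = of_nat (p ^ j) * (of_nat p * of_nat A - of_nat B)" by simp
  have BD: "B \<le> char_degree G \<chi>" using es(1) unfolding B_def by (meson le_trans length_filter_le)
  have "(\<Sum>\<psi>\<in>conj_orbit \<chi>. \<psi> g) + of_nat (p ^ j * char_degree G \<chi>)
      = of_nat (p ^ j) * (of_nat p * of_nat A + (of_nat (char_degree G \<chi>) - of_nat B))"
    unfolding e by (simp add: algebra_simps)
  also have "\<dots> = of_nat (p ^ j * (p * A + (char_degree G \<chi> - B)))" using BD by (simp add: of_nat_diff)
  finally show ?thesis by blast
qed

section \<open>The least degree of a faithful quasi-permutation representation\<close>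

definition quasi_perm_degree :: "nat \<Rightarrow> bool" where
  "quasi_perm_degree n \<longleftrightarrow> (\<exists>\<rho> \<in> hom G (GL n). inj_on \<rho> (carrier G) \<and> (\<forall>g \<in> carrier G. quasi_permutation_mat (\<rho> g)))"

lemma faithful_irr_inj:
  assumes S: "irr_rep G m S" "char_kernel G (rep_char G S) = {\<one>}" and gh: "g \<in> carrier G" "h \<in> carrier G" "S g = S h"
  shows "g = h"
proof -
  have f: "rep G m S" using S by (simp add: irr_rep_def)
  have "S (g \<otimes> inv h) = S h * S (inv h)" using gh by (simp add: rep_mult[OF f])
  also have "\<dots> = S \<one>" using gh by (simp flip: rep_mult[OF f])
  finally have "g \<otimes> inv h \<in> char_kernel G (rep_char G S)" using gh by (simp add: char_kernel_def rep_char_def)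
  then have "g \<otimes> inv h = \<one>" using S by simp
  then show ?thesis using gh by (metis inv_closed inv_equality inv_inv)
qed

text \<open>
  The representation is the sum of the conjugates of \<open>\<chi>\<close> and of \<open>w = p ^ j * \<chi>(1)\<close> trivial ones; by
  \<open>orbit_sum_values\<close> this is enough to make all traces nonnegative.
\<close>

lemma quasi_perm_degree_orbit:
  assumes \<chi>: "\<chi> \<in> Irr G" "char_kernel G \<chi> = {\<one>}" and size: "card (conj_orbit \<chi>) = (p - 1) * p ^ j"
    and j: "card {s \<in> unit_exps. power_conj s \<chi> = \<chi>} * p ^ j = p ^ k"
  shows "quasi_perm_degree (p ^ Suc j * char_degree G \<chi>)"
proof -
  define d where "d = char_degree G \<chi>"
  define w where "w = p ^ j * d"
  obtain m S where S: "irr_rep G m S" "\<chi> = rep_char G S" using \<chi>(1) by (auto simp: Irr_iff)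
  then have fS: "rep G m S" by (simp add: irr_rep_def)
  have finO: "finite (conj_orbit \<chi>)" using finite_unit_exps by (simp add: conj_orbit_def)
  obtain n1 R1 where R1: "rep G n1 R1" "\<forall>g\<in>carrier G. tr (R1 g) = (\<Sum>\<psi>\<in>conj_orbit \<chi> - {\<chi>}. \<psi> g)"
    using sum_chars_rep[of "conj_orbit \<chi> - {\<chi>}"] finO conj_orbit_Irr[OF \<chi>(1)] by auto
  obtain R2 where R2: "rep G (n1 + w) R2" "\<forall>g\<in>carrier G. tr (R2 g) = tr (R1 g) + of_nat w"
    using direct_sum_rep[OF R1(1) trivial_rep[of w]] by auto
  define n where "n = m + (n1 + w)"
  obtain Q where Q: "rep G n Q" "\<forall>g\<in>carrier G. tr (Q g) = tr (S g) + tr (R2 g) \<and> ident m * Q g * ident m = S g"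
    using direct_sum_rep[OF fS R2(1)] unfolding n_def by blast
  have trQ: "tr (Q g) = (\<Sum>\<psi>\<in>conj_orbit \<chi>. \<psi> g) + of_nat w" if g: "g \<in> carrier G" for g
  proof -
    have "(\<Sum>\<psi>\<in>conj_orbit \<chi>. \<psi> g) = \<chi> g + (\<Sum>\<psi>\<in>conj_orbit \<chi> - {\<chi>}. \<psi> g)"
      using finO conj_orbit_self[OF \<chi>(1)] by (rule sum.remove)
    then show ?thesis using g Q(2) R2(2) R1(2) by (simp add: S(2) rep_char_def)
  qed
  have "n = p ^ Suc j * d"
  proof -
    have "(of_nat n :: complex) = tr (Q \<one>)" by (simp add: rep_one[OF Q(1)])
    also have "\<dots> = (\<Sum>\<psi>\<in>conj_orbit \<chi>. \<psi> \<one>) + of_nat w" by (simp add: trQ)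
    also have "(\<Sum>\<psi>\<in>conj_orbit \<chi>. \<psi> \<one>) = (\<Sum>\<psi>\<in>conj_orbit \<chi>. of_nat d)"
    proof (rule sum.cong[OF refl])
      fix \<psi> assume "\<psi> \<in> conj_orbit \<chi>"
      then show "\<psi> \<one> = of_nat d" using Irr_degree(1)[of \<psi>] conj_orbit_Irr[OF \<chi>(1)] conj_orbit_degree[OF \<chi>(1)] by (auto simp: d_def)
    qed
    also have "\<dots> = of_nat ((p - 1) * p ^ j * d)" by (simp add: size)
    also have "\<dots> + of_nat w = of_nat ((p - 1) * p ^ j * d + p ^ j * d)" by (simp add: w_def)
    also have "(p - 1) * p ^ j * d + p ^ j * d = p ^ Suc j * d"
    proof -
      have "(p - 1) * p ^ j * d + p ^ j * d = Suc (p - 1) * (p ^ j * d)" by simp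
      then show ?thesis using p_gt_1 by simp
    qed
    finally show ?thesis by (simp only: of_nat_eq_iff)
  qed
  moreover have "quasi_perm_degree n" unfolding quasi_perm_degree_def
  proof (intro bexI conjI ballI)
    show "(\<lambda>g. to_mat n n (Q g)) \<in> hom G (GL n)" by (rule hom_to_mat[OF Q(1)])
    show "inj_on (\<lambda>g. to_mat n n (Q g)) (carrier G)"
    proof (rule inj_onI)
      fix g h assume gh: "g \<in> carrier G" "h \<in> carrier G" "to_mat n n (Q g) = to_mat n n (Q h)"
      then have "Q g = Q h" using of_mat_to_mat[OF rep_shaped[OF Q(1)]] by metis
      then have "S g = S h" using Q(2) gh by metis
      then show "g = h" using faithful_irr_inj[OF S(1)] \<chi>(2) S(2) gh by blast
    qed
    fix g assume g: "g \<in> carrier G"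
    have "mat_trace (to_mat n n (Q g)) = tr (Q g)"
      using tr_of_mat[of "to_mat n n (Q g)" n] of_mat_to_mat[OF rep_shaped[OF Q(1) g]] by simp
    moreover obtain a :: nat where "(\<Sum>\<psi>\<in>conj_orbit \<chi>. \<psi> g) + of_nat w = of_nat a"
      using orbit_sum_values[OF \<chi>(1) j g] by (auto simp: w_def d_def)
    ultimately have "mat_trace (to_mat n n (Q g)) \<in> \<nat>" using trQ[OF g] by simp
    then show "quasi_permutation_mat (to_mat n n (Q g))" by (simp add: quasi_permutation_mat_def to_mat_def)
  qed
  ultimately show ?thesis by (simp add: d_def)
qed

text \<open>
  The character \<open>\<theta>\<close> is invariant under \<open>g \<mapsto> g ^ m\<close>, so all conjugates of a faithful constituent \<open>\<chi>\<close> have the same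
  multiplicity in \<open>\<theta>\<close>.  Let \<open>S'\<close> be the degree of the part of \<open>\<theta>\<close> on which \<open>z0\<close> acts nontrivially.
  Summing \<open>\<theta>\<close> over the nontrivial powers of \<open>z0\<close> gives \<open>(p - 1) * \<theta>(z0) = (p - 1) * n - p * S'\<close>, and this is nonnegative.
\<close>

lemma quasi_perm_degree_ge_orbit:
  assumes "quasi_perm_degree n"
  shows "\<exists>\<chi>\<in>Irr G. char_kernel G \<chi> = {\<one>} \<and> p * (card (conj_orbit \<chi>) * char_degree G \<chi>) \<le> (p - 1) * n"
proof -
  obtain \<rho> where \<rho>: "\<rho> \<in> hom G (GL n)" "inj_on \<rho> (carrier G)" "\<forall>g \<in> carrier G. quasi_permutation_mat (\<rho> g)"
    using assms by (auto simp: quasi_perm_degree_def)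
  define R where "R g = of_mat (\<rho> g)" for g
  have f: "rep G n R" unfolding R_def by (rule rep_of_mat[OF is_group \<rho>(1)])
  obtain L where L: "set L \<subseteq> Irr G" "\<And>g. g \<in> carrier G \<Longrightarrow> tr (R g) = (\<Sum>\<chi>\<leftarrow>L. \<chi> g)"
    using char_decompose[OF f] by blast
  define \<theta> where "\<theta> g = (\<Sum>\<chi>\<leftarrow>L. \<chi> g)" for g
  have nat: "\<theta> g \<in> \<nat>" if "g \<in> carrier G" for g
    using \<rho>(3) that hom_carrier_mat[OF \<rho>(1) that] L(2)[OF that]
    by (auto simp: R_def \<theta>_def quasi_permutation_mat_def tr_of_mat)
  have int: "(\<Sum>\<chi>\<leftarrow>L. \<chi> g) \<in> \<int>" if "g \<in> carrier G" for g using nat[OF that] Nats_subset_Ints by (auto simp: \<theta>_def)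
  have pow: "\<theta> (g [^] m) = \<theta> g" if "g \<in> carrier G" "\<not> p dvd m" for g m
    unfolding \<theta>_def by (rule integral_char_pow[OF L(1) int that])
  have deg: "n = (\<Sum>\<psi>\<leftarrow>L. char_degree G \<psi>)"
  proof -
    have "(of_nat n :: complex) = (\<Sum>\<psi>\<leftarrow>L. \<psi> \<one>)" using L(2)[of \<one>] by (simp add: rep_one[OF f])
    also have "\<dots> = of_nat (\<Sum>\<psi>\<leftarrow>L. char_degree G \<psi>)" using L(1) by (induction L) (auto simp: Irr_degree)
    finally show ?thesis by (simp only: of_nat_eq_iff)
  qed
  have "\<exists>\<chi>\<in>set L. \<chi> z0 \<noteq> \<chi> \<one>"
  proof (rule ccontr)
    assume "\<not> ?thesis"
    then have tr: "z0 \<in> char_kernel G \<psi>" if "\<psi> \<in> set L" for \<psi> using that z0_carrier by (auto simp: char_kernel_def)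
    have "tr (R (z0 [^] s)) = of_nat n" for s :: nat
    proof -
      have "z0 [^] s \<in> char_kernel G \<psi>" if "\<psi> \<in> set L" for \<psi>
      proof -
        have sg: "subgroup (char_kernel G \<psi>) G" using char_kernel_normal(1) L(1) that by blast
        show ?thesis using tr[OF that] subgroup.one_closed[OF sg] subgroup.m_closed[OF sg] by (induction s) auto
      qed
      then have e: "map (\<lambda>\<psi>. \<psi> (z0 [^] s)) L = map (\<lambda>\<psi>. \<psi> \<one>) L"
        by (intro map_cong) (auto simp: char_kernel_def)
      have "tr (R (z0 [^] s)) = (\<Sum>\<psi>\<leftarrow>L. \<psi> (z0 [^] s))" using z0_carrier L(2)[of "z0 [^] s"] by simp
      also have "\<dots> = (\<Sum>\<psi>\<leftarrow>L. \<psi> \<one>)" by (simp only: e)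
      finally have "tr (R (z0 [^] s)) = (\<Sum>\<psi>\<leftarrow>L. \<psi> \<one>)" .
      then show ?thesis using L(2)[of \<one>] by (simp add: rep_one[OF f])
    qed
    then have "R z0 = R \<one>" using rep_trivial_of_trace[OF f z0_carrier] by (simp add: rep_one[OF f])
    then have "\<rho> z0 = \<rho> \<one>" unfolding R_def using hom_carrier_mat[OF \<rho>(1)] z0_carrier of_mat_inj by blast
    then have "z0 = \<one>" using \<rho>(2) z0_carrier by (auto simp: inj_on_def)
    then show False using z0_pow_one[of 1] p_gt_1 z0_carrier by auto
  qed
  then obtain \<chi> where \<chi>: "\<chi> \<in> set L" "\<chi> z0 \<noteq> \<chi> \<one>" by blast
  then have \<chi>I: "\<chi> \<in> Irr G" using L(1) by blast
  have ker: "char_kernel G \<chi> = {\<one>}" using faithful_iff[OF \<chi>I] \<chi>(2) by simp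
  have orbL: "\<psi> \<in> set L \<and> \<psi> z0 \<noteq> \<psi> \<one>" if \<psi>o: "\<psi> \<in> conj_orbit \<chi>" for \<psi>
  proof -
    obtain m where m: "\<not> p dvd m" "\<psi> = power_conj m \<chi>" using \<psi>o by (auto simp: conj_orbit_def unit_exps_def)
    have \<psi>: "\<psi> \<in> Irr G" using power_conj_Irr[OF \<chi>I m(1)] m(2) by simp
    have "pairing \<theta> \<psi> = (\<Sum>g\<in>carrier G. \<theta> (g [^] m) * \<chi> (inv (g [^] m)))"
      unfolding pairing_def by (rule sum.cong) (auto simp: m(2) power_conj_def pow m(1) nat_pow_inv)
    also have "\<dots> = pairing \<theta> \<chi>" unfolding pairing_def by (rule sum_pow_reindex[OF m(1)])
    finally have "count_list L \<psi> = count_list L \<chi>"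
      using pairing_sum_list[OF L(1) \<psi>, of \<theta>] pairing_sum_list[OF L(1) \<chi>I, of \<theta>] card_carrier_pos by (simp add: \<theta>_def)
    then have "\<psi> \<in> set L" using \<chi>(1) by (metis count_list_0_iff)
    moreover have "\<psi> z0 \<noteq> \<psi> \<one>"
    proof
      assume "\<psi> z0 = \<psi> \<one>"
      then have "z0 [^] m \<in> char_kernel G \<chi>" using z0_carrier by (simp add: m(2) power_conj_def char_kernel_def)
      then have "z0 [^] m = \<one>" using ker by simp
      then show False using z0_pow_one m(1) by simp
    qed
    ultimately show ?thesis by simp
  qed
  define M where "M = filter (\<lambda>\<psi>. \<psi> z0 \<noteq> \<psi> \<one>) L"
  define S' where "S' = (\<Sum>\<psi>\<leftarrow>M. char_degree G \<psi>)"
  have "card (conj_orbit \<chi>) * char_degree G \<chi> = (\<Sum>\<psi>\<in>conj_orbit \<chi>. char_degree G \<psi>)"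
    using conj_orbit_degree[OF \<chi>I] by simp
  also have "\<dots> \<le> (\<Sum>\<psi>\<in>set M. char_degree G \<psi>)"
    using orbL by (intro sum_mono2) (auto simp: M_def)
  also have "\<dots> \<le> S'" unfolding S'_def by (rule sum_set_le_sum_list)
  finally have S'_ge: "card (conj_orbit \<chi>) * char_degree G \<chi> \<le> S'" .
  have psum: "(\<Sum>s\<in>{1..<p}. \<psi> (z0 [^] s)) =
      of_int (int (p - 1) * int (char_degree G \<psi>) - int p * (if \<psi> z0 = \<psi> \<one> then 0 else int (char_degree G \<psi>)))"
    if "\<psi> \<in> set L" for \<psi>
  proof -
    have \<psi>: "\<psi> \<in> Irr G" using that L(1) by blast
    define D where "D = char_degree G \<psi>"
    have D0: "(of_nat D :: complex) \<noteq> 0" using Irr_degree(2)[OF \<psi>] by (simp add: D_def)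
    obtain \<omega> where \<omega>: "\<And>s::nat. \<psi> (z0 [^] s) = of_nat D * \<omega> ^ s"
      using central_values[OF \<psi> z0_center] unfolding D_def by metis
    have "of_nat D * \<omega> ^ p = \<psi> \<one>" using \<omega>[of p] z0_pow_one[of p] by simp
    then have \<omega>p: "\<omega> ^ p = 1" using Irr_degree(1)[OF \<psi>] D0 by (simp add: D_def)
    have triv: "\<psi> z0 = \<psi> \<one> \<longleftrightarrow> \<omega> = 1" using \<omega>[of 1] Irr_degree(1)[OF \<psi>] D0 z0_carrier by (simp add: D_def)
    have "{..<p} = insert 0 {1..<p}" using p_gt_1 by auto
    then have "(\<Sum>s<p. \<omega> ^ s) = 1 + (\<Sum>s\<in>{1..<p}. \<omega> ^ s)" by simp
    then have "(\<Sum>s\<in>{1..<p}. \<omega> ^ s) = (if \<omega> = 1 then of_nat p else 0) - 1"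
      using sum_root_of_unity[OF \<omega>p] by (simp add: algebra_simps)
    then have "(\<Sum>s\<in>{1..<p}. \<psi> (z0 [^] s)) = of_nat D * ((if \<omega> = 1 then of_nat p else 0) - 1)"
      by (simp add: \<omega> sum_distrib_left[symmetric])
    then show ?thesis unfolding triv using p_gt_1 by (simp add: D_def[symmetric] of_nat_diff algebra_simps)
  qed
  have "of_nat (p - 1) * \<theta> z0 = (\<Sum>s\<in>{1..<p}. \<theta> (z0 [^] s))"
  proof -
    have "(\<Sum>s\<in>{1..<p}. \<theta> (z0 [^] s)) = (\<Sum>s\<in>{1..<p}. \<theta> z0)"
    proof (rule sum.cong[OF refl])
      fix s assume "s \<in> {1..<p}"
      then have "\<not> p dvd s" by (auto dest: dvd_imp_le)
      then show "\<theta> (z0 [^] s) = \<theta> z0" by (rule pow[OF z0_carrier])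
    qed
    then show ?thesis by simp
  qed
  also have "\<dots> = (\<Sum>\<psi>\<leftarrow>L. \<Sum>s\<in>{1..<p}. \<psi> (z0 [^] s))"
    unfolding \<theta>_def by (induction L) (auto simp: sum.distrib)
  also have "\<dots> = (\<Sum>\<psi>\<leftarrow>L. of_int (int (p - 1) * int (char_degree G \<psi>) - int p * (if \<psi> z0 = \<psi> \<one> then 0 else int (char_degree G \<psi>))))"
    by (intro arg_cong[of _ _ sum_list] map_cong refl psum)
  also have "\<dots> = of_int (int (p - 1) * int (\<Sum>\<psi>\<leftarrow>L. char_degree G \<psi>) - int p * int S')"
    unfolding S'_def M_def by (induction L) (auto simp: algebra_simps)
  finally have "of_nat (p - 1) * \<theta> z0 = of_int (int (p - 1) * int n - int p * int S')" using deg by simp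
  moreover obtain a where "\<theta> z0 = of_nat a" using nat[OF z0_carrier] by (auto elim: Nats_cases)
  ultimately have "(of_int (int (p - 1) * int a) :: complex) = of_int (int (p - 1) * int n - int p * int S')" by simp
  then have "int (p - 1) * int a = int (p - 1) * int n - int p * int S'" by (simp only: of_int_eq_iff)
  then have "int (p * S') \<le> int ((p - 1) * n)" by (simp only: of_nat_mult) (metis diff_ge_0_iff_ge mult_nonneg_nonneg of_nat_0_le_iff)
  then have "p * S' \<le> (p - 1) * n" by (simp only: of_nat_le_iff)
  then show ?thesis using \<chi>I ker S'_ge by (meson le_trans mult_le_mono2)
qed

text \<open>
  The regular character vanishes at \<open>z0\<close>, so one of its constituents does not have \<open>z0\<close> in its kernel.
\<close>

lemma faithful_exists: "\<exists>\<chi>\<in>Irr G. char_kernel G \<chi> = {\<one>}"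
proof -
  have T: "transversal (carrier G) {\<one>} (carrier G)" unfolding transversal_def
  proof (intro conjI ballI)
    fix g assume g: "g \<in> carrier G"
    show "\<exists>!t. t \<in> carrier G \<and> inv t \<otimes> g \<in> {\<one>}"
      using g by (intro ex1I[of _ g]) (auto, metis inv_closed inv_equality inv_inv)
  qed simp
  have "lin_char {\<one>} (\<lambda>_. 1)" by (simp add: lin_char_def)
  then obtain R where R: "rep G (card (carrier G)) R" "\<forall>g\<in>carrier G. tr (R g) = ind_char {\<one>} (carrier G) (\<lambda>_. 1) g"
    using induced_rep[OF triv_subgroup T fin] by blast
  have "inv t \<otimes> z0 \<otimes> t \<noteq> \<one>" if "t \<in> carrier G" for t
  proof -
    have "z0 \<otimes> t = t \<otimes> z0" using z0_center that by (simp add: center_def)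
    then have "inv t \<otimes> z0 \<otimes> t = inv t \<otimes> t \<otimes> z0" using that z0_carrier m_assoc[of "inv t" z0 t] m_assoc[of "inv t" t z0] by simp
    then show ?thesis using z0_pow_one[of 1] p_gt_1 z0_carrier that by auto
  qed
  then have "tr (R z0) = 0" using R(2) z0_carrier by (auto simp: ind_char_def zero_ext_def intro!: sum.neutral)
  moreover have "tr (R \<one>) \<noteq> 0" using card_carrier_pos by (simp add: rep_one[OF R(1)])
  moreover obtain L where L: "set L \<subseteq> Irr G" "\<And>g. g \<in> carrier G \<Longrightarrow> tr (R g) = (\<Sum>\<chi>\<leftarrow>L. \<chi> g)"
    using char_decompose[OF R(1)] by blast
  ultimately have ne: "(\<Sum>\<chi>\<leftarrow>L. \<chi> z0) \<noteq> (\<Sum>\<chi>\<leftarrow>L. \<chi> \<one>)" using z0_carrier by (metis one_closed)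
  have "\<exists>\<chi>\<in>set L. \<chi> z0 \<noteq> \<chi> \<one>"
  proof (rule ccontr)
    assume "\<not> ?thesis"
    then have "map (\<lambda>\<chi>. \<chi> z0) L = map (\<lambda>\<chi>. \<chi> \<one>) L" by (intro map_cong) auto
    then have "(\<Sum>\<chi>\<leftarrow>L. \<chi> z0) = (\<Sum>\<chi>\<leftarrow>L. \<chi> \<one>)" by (rule arg_cong)
    with ne show False by contradiction
  qed
  then show ?thesis using L(1) faithful_iff by blast
qed

text \<open>
  The degree given by \<open>quasi_perm_degree_orbit\<close> meets the bound of \<open>quasi_perm_degree_ge_orbit\<close> for the
  character \<open>\<chi>\<close> that the latter finds in a representation of least degree.
\<close>

theorem min_quasi_perm_degree_formula:
  obtains \<chi> j where "\<chi> \<in> Irr G" "char_kernel G \<chi> = {\<one>}" "b \<le> j" "j \<le> k"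
    "min_quasi_perm_degree G = p ^ Suc j * char_degree G \<chi>"
proof -
  have c: "min_quasi_perm_degree G = (LEAST n. quasi_perm_degree n)" by (simp add: min_quasi_perm_degree_def quasi_perm_degree_def)
  obtain \<chi>' where \<chi>': "\<chi>' \<in> Irr G" "char_kernel G \<chi>' = {\<one>}" using faithful_exists by blast
  obtain j' where "card (conj_orbit \<chi>') = (p - 1) * p ^ j'" "card {s \<in> unit_exps. power_conj s \<chi>' = \<chi>'} * p ^ j' = p ^ k"
    by (rule orbit_size[OF \<chi>'], rule that)
  then have "quasi_perm_degree (p ^ Suc j' * char_degree G \<chi>')" by (rule quasi_perm_degree_orbit[OF \<chi>'])
  then have n: "quasi_perm_degree (min_quasi_perm_degree G)" unfolding c by (rule LeastI)
  obtain \<chi> where \<chi>: "\<chi> \<in> Irr G" "char_kernel G \<chi> = {\<one>}"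
    and le: "p * (card (conj_orbit \<chi>) * char_degree G \<chi>) \<le> (p - 1) * min_quasi_perm_degree G"
    using quasi_perm_degree_ge_orbit[OF n] by blast
  obtain j where j: "b \<le> j" "j \<le> k" "card (conj_orbit \<chi>) = (p - 1) * p ^ j" "card {s \<in> unit_exps. power_conj s \<chi> = \<chi>} * p ^ j = p ^ k"
    by (rule orbit_size[OF \<chi>], rule that)
  have "min_quasi_perm_degree G \<le> p ^ Suc j * char_degree G \<chi>"
    using quasi_perm_degree_orbit[OF \<chi> j(3,4)] unfolding c by (rule Least_le)
  moreover have "(p - 1) * (p ^ Suc j * char_degree G \<chi>) \<le> (p - 1) * min_quasi_perm_degree G"
    using le j(3) by (simp add: ac_simps)
  then have "p ^ Suc j * char_degree G \<chi> \<le> min_quasi_perm_degree G" using p_gt_1 by simp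
  ultimately have "min_quasi_perm_degree G = p ^ Suc j * char_degree G \<chi>" by (rule antisym)
  then show ?thesis by (rule that[OF \<chi> j(1,2)])
qed

end

section \<open>Faithful characters of small degree\<close>

context finite_p_group
begin

text \<open>
  The character \<open>\<chi>\<close> is induced from \<open>\<mu>\<close> on a subgroup \<open>H\<close> of index \<open>p\<close>.  The action of \<open>H\<close> on the \<open>p\<close> cosets of \<open>H\<close> has a fixed
  point, so by counting modulo \<open>p\<close> it is trivial, and the transversal normalizes \<open>H\<close>.  All conjugates of a commutator
  of elements of \<open>H\<close> are again such commutators, on which \<open>\<mu>\<close> is \<open>1\<close>; so the commutator is in the
  kernel of \<open>\<chi>\<close> and \<open>H\<close> is abelian.  The restriction of \<open>\<psi>\<close> to \<open>H\<close> contains a linear character \<open>\<nu>\<close>, and \<open>\<psi>\<close>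
  is a constituent of the character induced from \<open>\<nu>\<close>, which has degree \<open>p\<close>.
\<close>

lemma degree_le_prime_of_faithful_degree_prime:
  assumes \<chi>: "\<chi> \<in> Irr G" "char_kernel G \<chi> = {\<one>}" "char_degree G \<chi> = p" and \<psi>: "\<psi> \<in> Irr G"
  shows "char_degree G \<psi> \<le> p"
proof -
  obtain H T \<mu> where HT: "subgroup H G" "transversal (carrier G) H T" "lin_char H \<mu>" "card T = char_degree G \<chi>"
    "finite T" "\<And>g. g \<in> carrier G \<Longrightarrow> \<chi> g = ind_char H T \<mu> g" using Irr_monomial[OF \<chi>(1)] by metis
  obtain m where m: "Coset.order G = p ^ m" using order_p_power by blast
  have Tc: "\<And>t. t \<in> T \<Longrightarrow> t \<in> carrier G" using HT(2) by (auto simp: transversal_def)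
  have Hc: "\<And>t. t \<in> H \<Longrightarrow> t \<in> carrier G" using subgroup.subset[OF HT(1)] by auto
  have mH: "\<And>x y. x \<in> H \<Longrightarrow> y \<in> H \<Longrightarrow> x \<otimes> y \<in> H" "\<And>x. x \<in> H \<Longrightarrow> inv x \<in> H" "\<one> \<in> H"
    using subgroup.m_closed[OF HT(1)] subgroup.m_inv_closed[OF HT(1)] subgroup.one_closed[OF HT(1)] by auto
  define GA where "GA = G\<lparr>carrier := H\<rparr>"
  have gA: "group GA" using subgroup_imp_group[OF HT(1)] by (simp add: GA_def)
  define act where "act h t = coset_rep H T (h \<otimes> t)" for h t
  have act: "act h t \<in> T" "inv (act h t) \<otimes> (h \<otimes> t) \<in> H" if "h \<in> H" "t \<in> T" for h t
    using coset_rep[OF HT(2), of "h \<otimes> t"] that Tc Hc by (auto simp: act_def)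
  define F where "F = {t \<in> T. \<forall>h\<in>H. act h t = t}"
  obtain i where i: "card H = p ^ i" using subgroup_order[OF HT(1) p m] by blast
  have "[card {t \<in> T. \<forall>h\<in>carrier GA. act h t = t} = card T] (mod p)"
  proof (rule p_group_fixed_points[OF gA p _ HT(5)])
    show "Coset.order GA = p ^ i" using i by (simp add: Coset.order_def GA_def)
    fix x assume x: "x \<in> T"
    then show "act \<one>\<^bsub>GA\<^esub> x = x" unfolding act_def using Tc mH by (intro coset_rep_eqI[OF HT(2)]) (auto simp: GA_def)
  next
    fix h l x assume "h \<in> carrier GA" "l \<in> carrier GA" and x: "x \<in> T"
    then have hl: "h \<in> H" "l \<in> H" by (auto simp: GA_def)
    define u where "u = act l x"
    define w where "w = act h u"
    have u: "u \<in> T" "inv u \<otimes> (l \<otimes> x) \<in> H" using act[OF hl(2) x] by (auto simp: u_def)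
    have w: "w \<in> T" "inv w \<otimes> (h \<otimes> u) \<in> H" using act[OF hl(1) u(1)] by (auto simp: w_def)
    have c: "h \<in> carrier G" "l \<in> carrier G" "x \<in> carrier G" "u \<in> carrier G" "w \<in> carrier G" using hl x u w Hc Tc by auto
    have "(inv w \<otimes> (h \<otimes> u)) \<otimes> (inv u \<otimes> (l \<otimes> x)) = inv w \<otimes> h \<otimes> (u \<otimes> inv u) \<otimes> l \<otimes> x"
      using c by (simp only: m_assoc m_closed inv_closed)
    then have "inv w \<otimes> (h \<otimes> l \<otimes> x) = (inv w \<otimes> (h \<otimes> u)) \<otimes> (inv u \<otimes> (l \<otimes> x))" using c by (simp add: m_assoc)
    then have "inv w \<otimes> (h \<otimes> l \<otimes> x) \<in> H" using u w mH by simp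
    then have "act (h \<otimes> l) x = w" unfolding act_def using c w by (intro coset_rep_eqI[OF HT(2)]) auto
    then show "act (h \<otimes>\<^bsub>GA\<^esub> l) x = act h (act l x)" by (simp add: GA_def w_def u_def)
  qed (use act in \<open>auto simp: GA_def\<close>)
  then have "[card F = p] (mod p)" using HT(4) \<chi>(3) by (simp add: F_def GA_def)
  then have "p dvd card F" by (simp add: cong_dvd_iff)
  moreover have "card F \<noteq> 0"
  proof -
    define t0 where "t0 = coset_rep H T \<one>"
    have t0: "t0 \<in> T" "inv t0 \<otimes> \<one> \<in> H" using coset_rep[OF HT(2), of \<one>] by (auto simp: t0_def)
    then have it: "inv t0 \<in> H" using Tc by simp
    then have t0H: "t0 \<in> H" using mH(2)[OF it] Tc t0 by simp
    have "act h t0 = t0" if h: "h \<in> H" for h unfolding act_def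
    proof (rule coset_rep_eqI[OF HT(2)])
      show "inv t0 \<otimes> (h \<otimes> t0) \<in> H" using it t0H h mH by blast
    qed (use h t0 Hc Tc in auto)
    then have "t0 \<in> F" using t0 by (simp add: F_def)
    moreover have "finite F" using HT(5) by (simp add: F_def)
    ultimately show ?thesis by auto
  qed
  ultimately have "p \<le> card F" by (simp add: dvd_imp_le)
  then have "F = T" using HT(4,5) \<chi>(3) by (intro card_seteq) (auto simp: F_def)
  then have norm: "inv t \<otimes> h \<otimes> t \<in> H" if "t \<in> T" "h \<in> H" for t h
  proof -
    have "act h t = t" using that \<open>F = T\<close> unfolding F_def by blast
    then show ?thesis using act(2)[OF that(2,1)] that Tc Hc by (simp add: m_assoc)
  qed
  have comm: "x \<otimes> y = y \<otimes> x" if x: "x \<in> H" and y: "y \<in> H" for x y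
  proof -
    define v where "v = (x \<otimes> y) \<otimes> inv (y \<otimes> x)"
    have vH: "v \<in> H" using x y mH by (simp add: v_def)
    have "zero_ext H \<mu> (inv t \<otimes> v \<otimes> t) = 1" if t: "t \<in> T" for t
    proof -
      define a where "a = inv t \<otimes> x \<otimes> t"
      define b where "b = inv t \<otimes> y \<otimes> t"
      have ab: "a \<in> H" "b \<in> H" using norm t x y by (auto simp: a_def b_def)
      have c: "t \<in> carrier G" "x \<in> carrier G" "y \<in> carrier G" using t x y Tc Hc by auto
      have cm: "inv t \<otimes> (g \<otimes> h) \<otimes> t = (inv t \<otimes> g \<otimes> t) \<otimes> (inv t \<otimes> h \<otimes> t)"
        if "g \<in> carrier G" "h \<in> carrier G" for g h
      proof -
        have "(inv t \<otimes> g \<otimes> t) \<otimes> (inv t \<otimes> h \<otimes> t) = inv t \<otimes> g \<otimes> (t \<otimes> inv t) \<otimes> h \<otimes> t"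
          using that c by (simp only: m_assoc m_closed inv_closed)
        then show ?thesis using that c by (simp add: m_assoc)
      qed
      have "v \<otimes> (y \<otimes> x) = x \<otimes> y" using c by (simp add: v_def m_assoc)
      then have "(inv t \<otimes> v \<otimes> t) \<otimes> (b \<otimes> a) = a \<otimes> b"
        unfolding a_def b_def using c Hc[OF vH] by (simp only: cm[symmetric] m_closed)
      moreover have tv: "inv t \<otimes> v \<otimes> t \<in> H" using norm t vH by blast
      ultimately have "\<mu> (inv t \<otimes> v \<otimes> t) * (\<mu> b * \<mu> a) = \<mu> a * \<mu> b"
        using HT(3) ab mH unfolding lin_char_def by metis
      moreover have "\<mu> a \<noteq> 0" "\<mu> b \<noteq> 0"
        using lin_char_root[OF HT(1,3) ab(1)] lin_char_root[OF HT(1,3) ab(2)] N_pos by (metis zero_power zero_neq_one)+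
      ultimately show ?thesis using tv by (simp add: zero_ext_def)
    qed
    then have "\<chi> v = \<chi> \<one>" using HT(4,6) Hc[OF vH] Irr_degree(1)[OF \<chi>(1)] by (simp add: ind_char_def)
    then have "v = \<one>" using \<chi>(2) Hc[OF vH] by (auto simp: char_kernel_def)
    then have "inv (inv (y \<otimes> x)) = x \<otimes> y" using x y Hc unfolding v_def by (intro inv_equality) auto
    then show ?thesis using x y Hc by simp
  qed
  obtain n S where S: "irr_rep G n S" "\<psi> = rep_char G S" using \<psi> by (auto simp: Irr_iff)
  have fS: "rep G n S" and n0: "0 < n" using S by (auto simp: irr_rep_def)
  interpret A: fin_group GA
    using gA subgroup_fin[OF HT(1)] by (simp add: fin_group_def fin_group_axioms_def GA_def)
  have fA: "rep GA n S" using fS Hc by (auto simp: rep_def GA_def)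
  obtain L where L: "set L \<subseteq> Irr GA" "\<And>g. g \<in> H \<Longrightarrow> tr (S g) = (\<Sum>\<chi>\<leftarrow>L. \<chi> g)"
    using A.char_decompose[OF fA] by (auto simp: GA_def)
  have "L \<noteq> []" using L(2)[OF mH(3)] n0 by (auto simp: rep_one[OF fS])
  then obtain \<xi> where \<xi>: "\<xi> \<in> set L" by (meson last_in_set)
  then have \<xi>I: "\<xi> \<in> Irr GA" using L(1) by blast
  then obtain l Q where Q: "irr_rep GA l Q" "\<xi> = rep_char GA Q" using A.Irr_iff by blast
  have fQ: "rep GA l Q" and l0: "0 < l" using Q by (auto simp: irr_rep_def)
  have "\<exists>c. Q a = smul c (ident l)" if a: "a \<in> H" for a
  proof (rule A.irr_rep_scalar[OF Q(1)])
    show "shaped l l (Q a)" using A.rep_shaped[OF fQ] a by (simp add: GA_def)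
    fix g assume "g \<in> carrier GA"
    then have g: "g \<in> H" by (simp add: GA_def)
    have "Q (g \<otimes> a) = Q g * Q a" "Q (a \<otimes> g) = Q a * Q g"
      using A.rep_mult[OF fQ, of g a] A.rep_mult[OF fQ, of a g] a g by (auto simp: GA_def)
    then show "Q g * Q a = Q a * Q g" using comm[OF g a] by simp
  qed
  then obtain \<nu> where \<nu>: "\<And>a. a \<in> H \<Longrightarrow> Q a = smul (\<nu> a) (ident l)" by metis
  have idl: "ident l \<noteq> 0"
  proof
    assume "ident l = 0"
    then have "tr (ident l) = 0" by (simp only: tr_zero)
    then show False using l0 by simp
  qed
  have lin: "lin_char H \<nu>" unfolding lin_char_def
  proof (intro conjI ballI)
    have "smul (\<nu> \<one>) (ident l) = smul 1 (ident l)" using \<nu>[OF mH(3)] A.rep_one[OF fQ] by (simp add: GA_def)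
    then show "\<nu> \<one> = 1" using smul_cancel idl by blast
    fix x y assume xy: "x \<in> H" "y \<in> H"
    have "Q (x \<otimes> y) = Q x * Q y" using A.rep_mult[OF fQ, of x y] xy by (simp add: GA_def)
    then have "smul (\<nu> (x \<otimes> y)) (ident l) = smul (\<nu> x * \<nu> y) (ident l)" using \<nu> xy mH by (simp add: smul_mult mult.commute)
    then show "\<nu> (x \<otimes> y) = \<nu> x * \<nu> y" using smul_cancel idl by blast
  qed
  \<comment> \<open>Frobenius reciprocity: \<open>I\<close> is nonzero since \<open>\<nu>\<close> occurs in the restriction of \<open>\<psi>\<close>, and the pairing of the induced character with \<open>\<psi>\<close> is \<open>card T * I\<close>.\<close>
  define I where "I = (\<Sum>a\<in>H. \<nu> a * \<psi> (inv a))"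
  have "I \<noteq> 0"
  proof -
    have "A.pairing (\<lambda>g. tr (S g)) \<xi> = of_nat (card H) * of_nat (count_list L \<xi>)"
      using A.pairing_sum_list[OF L(1) \<xi>I, of "\<lambda>g. tr (S g)"] L(2) by (simp add: GA_def)
    moreover have "count_list L \<xi> \<noteq> 0" using \<xi> by (simp add: count_list_0_iff)
    moreover have "card H \<noteq> 0" using i p_gt_1 by simp
    ultimately have ne: "A.pairing (\<lambda>g. tr (S g)) \<xi> \<noteq> 0" by simp
    have "A.pairing (\<lambda>g. tr (S g)) \<xi> = (\<Sum>a\<in>H. of_nat l * (\<nu> (inv a) * \<psi> (inv (inv a))))"
      unfolding A.pairing_def
    proof (rule sum.cong)
      fix a assume a: "a \<in> H"
      have "inv\<^bsub>GA\<^esub> a = inv a" using m_inv_consistent[OF HT(1) a] by (simp add: GA_def)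
      then have "\<xi> (inv\<^bsub>GA\<^esub> a) = \<nu> (inv a) * of_nat l" using mH a by (simp add: Q(2) rep_char_def GA_def \<nu>)
      then show "tr (S a) * \<xi> (inv\<^bsub>GA\<^esub> a) = of_nat l * (\<nu> (inv a) * \<psi> (inv (inv a)))"
        using a Hc by (simp add: S(2) rep_char_def)
    qed (simp add: GA_def)
    also have "\<dots> = of_nat l * (\<Sum>a\<in>H. \<nu> (inv a) * \<psi> (inv (inv a)))" by (simp add: sum_distrib_left)
    also have "(\<Sum>a\<in>H. \<nu> (inv a) * \<psi> (inv (inv a))) = I" unfolding I_def
      by (rule sum.reindex_bij_witness[of _ "\<lambda>a. inv a" "\<lambda>a. inv a"]) (use mH Hc in auto)
    finally show ?thesis using ne by auto
  qed
  obtain R where R: "rep G (card T) R" "\<forall>g\<in>carrier G. tr (R g) = ind_char H T \<nu> g"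
    using induced_rep[OF HT(1,2,5) lin] by blast
  obtain L' where L': "set L' \<subseteq> Irr G" "\<And>g. g \<in> carrier G \<Longrightarrow> tr (R g) = (\<Sum>\<chi>\<leftarrow>L'. \<chi> g)"
    using char_decompose[OF R(1)] by blast
  have "pairing (\<lambda>g. tr (R g)) \<psi> = (\<Sum>g\<in>carrier G. \<Sum>t\<in>T. zero_ext H \<nu> (inv t \<otimes> g \<otimes> t) * \<psi> (inv g))"
    unfolding pairing_def using R(2) by (intro sum.cong) (auto simp: ind_char_def sum_distrib_right)
  also have "\<dots> = (\<Sum>t\<in>T. \<Sum>g\<in>carrier G. zero_ext H \<nu> (inv t \<otimes> g \<otimes> t) * \<psi> (inv g))" by (rule sum.swap)
  also have "\<dots> = (\<Sum>t\<in>T. I)"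
  proof (rule sum.cong[OF refl])
    fix t assume "t \<in> T"
    then have t: "t \<in> carrier G" using Tc by auto
    have "(\<Sum>g\<in>carrier G. zero_ext H \<nu> (inv t \<otimes> g \<otimes> t) * \<psi> (inv g)) = (\<Sum>y\<in>carrier G. zero_ext H \<nu> y * \<psi> (inv y))"
    proof (rule sum.reindex_bij_witness[of _ "\<lambda>y. t \<otimes> y \<otimes> inv t" "\<lambda>g. inv t \<otimes> g \<otimes> t"])
      fix g assume g: "g \<in> carrier G"
      show "t \<otimes> (inv t \<otimes> g \<otimes> t) \<otimes> inv t = g"
      proof -
        have "t \<otimes> (inv t \<otimes> g \<otimes> t) \<otimes> inv t = (t \<otimes> inv t) \<otimes> g \<otimes> (t \<otimes> inv t)" using t g by (simp only: m_assoc m_closed inv_closed)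
        then show ?thesis using t g by simp
      qed
      show "inv t \<otimes> (t \<otimes> g \<otimes> inv t) \<otimes> t = g"
      proof -
        have "inv t \<otimes> (t \<otimes> g \<otimes> inv t) \<otimes> t = (inv t \<otimes> t) \<otimes> g \<otimes> (inv t \<otimes> t)" using t g by (simp only: m_assoc m_closed inv_closed)
        then show ?thesis using t g by simp
      qed
      have "inv (inv t \<otimes> g \<otimes> t) = inv t \<otimes> inv g \<otimes> inv (inv t)" using t g by (simp add: inv_mult_group m_assoc)
      then show "zero_ext H \<nu> (inv t \<otimes> g \<otimes> t) * \<psi> (inv (inv t \<otimes> g \<otimes> t)) = zero_ext H \<nu> (inv t \<otimes> g \<otimes> t) * \<psi> (inv g)"
        using Irr_class_fun[OF \<psi>, of "inv g" "inv t"] t g by simp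
    qed (use t in auto)
    also have "\<dots> = I" unfolding I_def
      by (rule sum.mono_neutral_cong_right) (use fin Hc in \<open>auto simp: zero_ext_def\<close>)
    finally show "(\<Sum>g\<in>carrier G. zero_ext H \<nu> (inv t \<otimes> g \<otimes> t) * \<psi> (inv g)) = I" .
  qed
  finally have "pairing (\<lambda>g. tr (R g)) \<psi> \<noteq> 0" using \<open>I \<noteq> 0\<close> HT(4) \<chi>(3) p_gt_1 by simp
  then have "count_list L' \<psi> \<noteq> 0" using pairing_sum_list[OF L'(1) \<psi>, of "\<lambda>g. tr (R g)"] L'(2) by auto
  then have \<psi>L: "\<psi> \<in> set L'" by (simp add: count_list_0_iff)
  have "(of_nat (card T) :: complex) = (\<Sum>\<psi>\<leftarrow>L'. \<psi> \<one>)" using L'(2)[of \<one>] by (simp add: rep_one[OF R(1)])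
  also have "\<dots> = of_nat (\<Sum>\<psi>\<leftarrow>L'. char_degree G \<psi>)" using L'(1) by (induction L') (auto simp: Irr_degree)
  finally have "card T = (\<Sum>\<psi>\<leftarrow>L'. char_degree G \<psi>)" by (simp only: of_nat_eq_iff)
  moreover have "char_degree G \<psi> \<le> (\<Sum>\<psi>\<leftarrow>L'. char_degree G \<psi>)"
    using \<psi>L by (intro member_le_sum_list) auto
  ultimately show ?thesis using HT(4) \<chi>(3) by simp
qed

lemma faithful_degree_one_abelian:
  assumes \<chi>: "\<chi> \<in> Irr G" "char_kernel G \<chi> = {\<one>}" "char_degree G \<chi> = 1"
    and gh: "g \<in> carrier G" "h \<in> carrier G"
  shows "g \<otimes> h = h \<otimes> g"
proof -
  obtain n S where S: "irr_rep G n S" "\<chi> = rep_char G S" using \<chi> by (auto simp: Irr_iff)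
  have f: "rep G n S" using S by (auto simp: irr_rep_def)
  have "\<chi> \<one> = of_nat n" by (simp add: S(2) rep_char_def rep_one[OF f])
  then have n: "n = 1" using Irr_degree(1)[OF \<chi>(1)] \<chi>(3) by (metis of_nat_eq_iff)
  have sc: "S x = smul (ent (S x) 0 0) (ident 1)" if "x \<in> carrier G" for x
  proof (rule fmat_eqI)
    fix i j show "ent (S x) i j = ent (smul (ent (S x) 0 0) (ident 1)) i j"
      using rep_shaped[OF f that] unfolding n shaped_iff by (cases "i = 0 \<and> j = 0") (auto simp: ent_ident Suc_le_eq)
  qed
  have "S g * S h = S h * S g"
    by (subst (1 2) sc[OF gh(1)], subst (1 2) sc[OF gh(2)]) (simp add: smul_mult mult.commute)
  then have e: "S (g \<otimes> h) = S (h \<otimes> g)" using gh by (simp add: rep_mult[OF f])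
  have "S ((g \<otimes> h) \<otimes> inv (h \<otimes> g)) = S ((h \<otimes> g) \<otimes> inv (h \<otimes> g))"
    using gh e by (simp only: rep_mult[OF f] m_closed inv_closed)
  then have "(g \<otimes> h) \<otimes> inv (h \<otimes> g) \<in> char_kernel G \<chi>"
    using gh by (simp add: char_kernel_def S(2) rep_char_def)
  then have "(g \<otimes> h) \<otimes> inv (h \<otimes> g) = \<one>" using \<chi>(2) by simp
  then have "inv (inv (h \<otimes> g)) = g \<otimes> h" using gh by (intro inv_equality) auto
  then show ?thesis using gh by simp
qed

lemma degree_le_order: assumes "\<chi> \<in> Irr G" shows "char_degree G \<chi> \<le> card (carrier G)"
proof -
  obtain H T \<mu> where *: "transversal (carrier G) H T" "card T = char_degree G \<chi>"
    using Irr_monomial[OF assms] by metis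
  then show ?thesis using card_mono[OF fin, of T] by (simp add: transversal_def)
qed

end

section \<open>Exponent, center and the divisibilities\<close>

lemma group_exponent_p_power:
  fixes G (structure)
  assumes G: "group G" "finite (carrier G)" and p: "prime p" and ord: "Coset.order G = p ^ m"
  shows "\<exists>c. group_exponent G = p ^ c" "\<And>g. g \<in> carrier G \<Longrightarrow> g [^]\<^bsub>G\<^esub> group_exponent G = \<one>\<^bsub>G\<^esub>"
proof -
  interpret group G by fact
  define P where "P n \<longleftrightarrow> 0 < n \<and> (\<forall>g \<in> carrier G. g [^] n = \<one>)" for n :: nat
  have e: "group_exponent G = (LEAST n. P n)" by (simp add: group_exponent_def P_def)
  have Po: "P (p ^ m)" using pow_order_eq_1 p ord prime_gt_0_nat by (auto simp: P_def)
  then have PE: "P (group_exponent G)" unfolding e by (rule LeastI)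
  then show "\<And>g. g \<in> carrier G \<Longrightarrow> g [^] group_exponent G = \<one>" by (simp add: P_def)
  define E where "E = group_exponent G"
  have E: "0 < E" "\<And>g. g \<in> carrier G \<Longrightarrow> g [^] E = \<one>" using PE by (auto simp: P_def E_def)
  have "p ^ m mod E = 0"
  proof (rule ccontr)
    assume ne: "p ^ m mod E \<noteq> 0"
    have "g [^] (p ^ m mod E) = \<one>" if g: "g \<in> carrier G" for g
    proof -
      have "g [^] (p ^ m) = g [^] (E * (p ^ m div E) + p ^ m mod E)" by simp
      also have "\<dots> = (g [^] E) [^] (p ^ m div E) \<otimes> g [^] (p ^ m mod E)"
        using g by (simp only: nat_pow_mult[symmetric] nat_pow_pow)
      finally show ?thesis using g E(2)[OF g] Po by (simp add: P_def)
    qed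
    then have "P (p ^ m mod E)" using ne by (simp add: P_def)
    then have "E \<le> p ^ m mod E" unfolding E_def e by (rule Least_le)
    then show False using mod_less_divisor[OF E(1), of "p ^ m"] by linarith
  qed
  then have "E dvd p ^ m" by (rule mod_0_imp_dvd)
  then show "\<exists>c. group_exponent G = p ^ c" using p divides_primepow_nat unfolding E_def by blast
qed

lemma center_subgroup: fixes G (structure) assumes "group G" shows "subgroup (center G) G"
proof -
  interpret group G by fact
  show ?thesis
  proof (rule subgroupI)
    show "center G \<subseteq> carrier G" "center G \<noteq> {}" by (auto simp: center_def)
    fix a assume "a \<in> center G"
    then have a: "a \<in> carrier G" "\<And>g. g \<in> carrier G \<Longrightarrow> a \<otimes> g = g \<otimes> a" by (auto simp: center_def)
    have "inv a \<otimes> g = g \<otimes> inv a" if g: "g \<in> carrier G" for g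
    proof -
      have "inv a \<otimes> g = inv a \<otimes> (g \<otimes> a) \<otimes> inv a" using a(1) g by (simp add: m_assoc)
      also have "\<dots> = inv a \<otimes> (a \<otimes> g) \<otimes> inv a" by (simp only: a(2)[OF g])
      also have "\<dots> = (inv a \<otimes> a) \<otimes> g \<otimes> inv a"
        using a(1) g by (simp only: m_assoc m_closed inv_closed)
      finally show ?thesis using a(1) g by simp
    qed
    then show "inv a \<in> center G" using a(1) by (simp add: center_def)
    fix b assume "b \<in> center G"
    then have b: "b \<in> carrier G" "\<And>g. g \<in> carrier G \<Longrightarrow> b \<otimes> g = g \<otimes> b" by (auto simp: center_def)
    have "(a \<otimes> b) \<otimes> g = g \<otimes> (a \<otimes> b)" if g: "g \<in> carrier G" for g
    proof -
      have "(a \<otimes> b) \<otimes> g = a \<otimes> (g \<otimes> b)" using a(1) b(1) b(2)[OF g] g by (simp add: m_assoc)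
      also have "\<dots> = (g \<otimes> a) \<otimes> b" using a(1) a(2)[OF g] b(1) g by (simp add: m_assoc[symmetric])
      finally show ?thesis using a(1) b(1) g by (simp add: m_assoc)
    qed
    then show "a \<otimes> b \<in> center G" using a(1) b(1) by (simp add: center_def)
  qed
qed

theorem corollary6:
  fixes G :: "('a, 'b) monoid_scheme" and p e \<alpha> :: nat
  assumes "prime p"
    and "p_group p G"
    and "\<not> comm_group G"
    and "cyclic_group (G\<lparr>carrier := center G\<rparr>)"
    and "p ^ e = Max (cd G)"
    and "p ^ \<alpha> = Min {char_degree G \<chi> | \<chi>. \<chi> \<in> nl G \<and> char_kernel G \<chi> = {\<one>\<^bsub>G\<^esub>}}"
  shows "(p ^ \<alpha> * card (center G) dvd min_quasi_perm_degree G \<and>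
          min_quasi_perm_degree G dvd p ^ e * group_exponent G) \<and>
         (cd G = {1, p, p ^ e} \<and> e > 1 \<and> group_exponent G = p \<longrightarrow>
          min_quasi_perm_degree G = p ^ (e + 1))"
proof -
  obtain m where G: "group G" "finite (carrier G)" and m: "Coset.order G = p ^ m"
    using assms(2) by (auto simp: p_group_def)
  interpret group G by fact
  interpret fin_group G using G by (simp add: fin_group_def fin_group_axioms_def)
  have p_gt_1: "1 < p" using assms(1) prime_gt_1_nat by auto
  have nab: "\<exists>g\<in>carrier G. \<exists>h\<in>carrier G. g \<otimes>\<^bsub>G\<^esub> h \<noteq> h \<otimes>\<^bsub>G\<^esub> g"
    using assms(3) group_comm_groupI by blast
  obtain c where c: "group_exponent G = p ^ c" using group_exponent_p_power(1)[OF G assms(1) m] by blast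
  have "c \<noteq> 0"
  proof
    assume "c = 0"
    then have "g = \<one>\<^bsub>G\<^esub>" if "g \<in> carrier G" for g using group_exponent_p_power(2)[OF G assms(1) m that] c that by simp
    then show False using nab by metis
  qed
  then obtain k where k: "group_exponent G = p ^ Suc k" using c by (metis not0_implies_Suc)
  interpret finite_p_group G p k "p ^ Suc k"
    using assms(1) k group_exponent_p_power(2)[OF G assms(1) m] m by unfold_locales auto
  have sub: "subgroup (center G) G" by (rule center_subgroup[OF G(1)])
  interpret Z: group "G\<lparr>carrier := center G\<rparr>" by (rule subgroup_imp_group[OF sub])
  obtain z1 where z1: "z1 \<in> center G" and "center G = range (\<lambda>n::int. z1 [^]\<^bsub>G\<lparr>carrier := center G\<rparr>\<^esub> n)"
    using assms(4) unfolding Z.cyclic_group by auto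
  moreover have "z1 [^]\<^bsub>G\<lparr>carrier := center G\<rparr>\<^esub> n = z1 [^]\<^bsub>G\<^esub> n" for n :: int
    using int_pow_consistent[OF sub z1] by simp
  ultimately have range: "center G = range (\<lambda>n::int. z1 [^]\<^bsub>G\<^esub> n)" by simp
  have z1_carrier: "z1 \<in> carrier G" using z1 by (simp add: center_def)
  have cgen: "center G = generate G {z1}" using range generate_pow[OF z1_carrier] by (auto simp: full_SetCompr_eq)
  have card: "card (center G) = ord z1" unfolding cgen by (rule generate_pow_card[OF z1_carrier, symmetric])
  have ordn0: "ord z1 \<noteq> 0" using ord_ge_1[OF G(2) z1_carrier] by simp
  obtain i where i: "card (center G) = p ^ i" using subgroup_order[OF sub assms(1) m] by blast
  have "i \<noteq> 0"
  proof
    assume "i = 0"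
    then have "card (center G) = 1" using i by simp
    moreover have "\<one>\<^bsub>G\<^esub> \<in> center G" by (rule subgroup.one_closed[OF sub])
    ultimately have Z1: "center G = {\<one>\<^bsub>G\<^esub>}" by (metis card_1_singletonE singletonD)
    have "carrier G \<noteq> {\<one>\<^bsub>G\<^esub>}" using nab by auto
    then obtain z where "z \<in> center G" "z \<noteq> \<one>\<^bsub>G\<^esub>" using normal_meets_center[OF subgroup_self] by auto
    then show False using Z1 by simp
  qed
  then obtain b where b: "card (center G) = p ^ Suc b" using i by (metis not0_implies_Suc)
  interpret cyclic_center_p_group G p k "p ^ Suc k" z1 b
  proof
    show "z1 \<in> center G" by fact
    show "\<exists>i::nat. z = z1 [^]\<^bsub>G\<^esub> i" if "z \<in> center G" for z
      using that generate_pow_nat[OF z1_carrier ordn0] unfolding cgen by blast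
    show "z1 [^]\<^bsub>G\<^esub> s = \<one>\<^bsub>G\<^esub> \<longleftrightarrow> p ^ Suc b dvd s" for s :: nat
      using pow_eq_id[OF z1_carrier, of s] card b by simp
  qed
  obtain \<chi> j where \<chi>: "\<chi> \<in> Irr G" "char_kernel G \<chi> = {\<one>\<^bsub>G\<^esub>}" and j: "b \<le> j" "j \<le> k"
    and c_eq: "min_quasi_perm_degree G = p ^ Suc j * char_degree G \<chi>"
    by (rule min_quasi_perm_degree_formula)
  have deg1: "char_degree G \<psi> \<noteq> 1" if "\<psi> \<in> Irr G" "char_kernel G \<psi> = {\<one>\<^bsub>G\<^esub>}" for \<psi>
    using faithful_degree_one_abelian[OF that] nab by blast
  define D where "D = {char_degree G \<chi> | \<chi>. \<chi> \<in> nl G \<and> char_kernel G \<chi> = {\<one>\<^bsub>G\<^esub>}}"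
  have dD: "char_degree G \<chi> \<in> D" using \<chi> deg1[OF \<chi>] by (auto simp: D_def nl_def)
  have fincd: "finite (cd G)"
    by (rule finite_subset[of _ "{..card (carrier G)}"]) (use degree_le_order in \<open>auto simp: cd_def\<close>)
  have "D \<subseteq> cd G" by (auto simp: D_def nl_def cd_def)
  then have finD: "finite D" using fincd finite_subset by blast
  have \<alpha>_le: "p ^ \<alpha> \<le> char_degree G \<chi>" using assms(6) Min_le[OF finD dD] by (simp add: D_def)
  have e_ge: "char_degree G \<psi> \<le> p ^ e" if "\<psi> \<in> Irr G" for \<psi>
    using that Max_ge[OF fincd, of "char_degree G \<psi>"] assms(5) by (auto simp: cd_def)
  obtain a where a: "char_degree G \<chi> = p ^ a" using degree_p_power[OF \<chi>(1)] by blast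
  have "\<alpha> \<le> a" "a \<le> e" using \<alpha>_le e_ge[OF \<chi>(1)] p_gt_1 by (simp_all add: a)
  moreover have c_pow: "min_quasi_perm_degree G = p ^ (Suc j + a)" by (simp add: c_eq a power_add)
  ultimately have "p ^ (\<alpha> + Suc b) dvd min_quasi_perm_degree G" "min_quasi_perm_degree G dvd p ^ (e + Suc k)"
    using j by (auto intro!: le_imp_power_dvd)
  then have "p ^ \<alpha> * card (center G) dvd min_quasi_perm_degree G" "min_quasi_perm_degree G dvd p ^ e * group_exponent G"
    unfolding b k by (simp_all only: power_add)
  moreover have "min_quasi_perm_degree G = p ^ (e + 1)" if h: "cd G = {1, p, p ^ e}" "e > 1" "group_exponent G = p"
  proof -
    have "char_degree G \<chi> \<in> {1, p, p ^ e}" using \<chi>(1) h(1) by (auto simp: cd_def)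
    moreover have "char_degree G \<chi> \<noteq> p"
    proof
      assume dp: "char_degree G \<chi> = p"
      have "p ^ e \<in> cd G" using h(1) by simp
      then obtain \<psi> where "\<psi> \<in> Irr G" "char_degree G \<psi> = p ^ e" by (auto simp: cd_def)
      then have "p ^ e \<le> p ^ 1" using degree_le_prime_of_faithful_degree_prime[OF \<chi> dp] by force
      then show False using h(2) p_gt_1 by (simp only: power_increasing_iff)
    qed
    ultimately have "char_degree G \<chi> = p ^ e" using deg1[OF \<chi>] by auto
    moreover have "j = 0"
    proof -
      have "p ^ Suc k = p ^ 1" using h(3) k by simp
      then have "k = 0" using p_gt_1 by (simp only: power_inject_exp)
      then show ?thesis using j by simp
    qed
    ultimately show ?thesis using c_eq by simp
  qed
  ultimately show ?thesis by blast
qed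

end
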